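(* Let $G=(V,E)$ be an unweighted graph (directed or undirected) with $n$ vertices and $m$ edges, and let $s\in V$ be a designated source. Then there is a subgraph $H=(V,E')$ of $G$ with $E'\subseteq E$ and $|E'|=O(n^{5/3})$, computable in time polynomial in $n$ and $m$, which is a dual FT-BFS subgraph of $G$ with respect to $s$: for every set $F\subseteq E$ of at most two failed edges, a BFS tree from $s$ in $H\setminus F$ is a valid BFS tree from $s$ in $G\setminus F$.
   Context: For a graph $G$ and a set $F$ of failed edges, $G\setminus F$ denotes the graph obtained by deleting the edges of $F$ (similarly $H\setminus F$). A BFS tree from $s$ in $H\setminus F$ being a valid BFS tree from $s$ in $G\setminus F$ means, equivalently, that for every vertex $v$ the (unweighted, hop-count) distance from $s$ to $v$ in $H\setminus F$ equals the distance from $s$ to $v$ in $G\setminus F$ (in particular $v$ is reachable from $s$ in $H\setminus F$ iff it is reachable in $G\setminus F$). In directed graphs distances are along directed paths. *)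

theory Defs
  imports Complex_Main "Graph_Theory.Pair_Digraph" "Graph_Theory.Shortest_Path"
begin

text \<open>
  A directed edge is a pair of vertices, an undirected edge is a set \<open>{u, v}\<close>.  An undirected
  edge can be traversed in both directions, but it fails as a whole.  Both cases are treated
  uniformly through a function \<open>arcs_of\<close> that maps a set of edges to the set of arcs that a walk may
  use: the identity for directed graphs and \<open>bidirected\<close> for undirected ones.
\<close>

definition bidirected :: "'a set set \<Rightarrow> ('a \<times> 'a) set" where
  "bidirected E = {(u, v). {u, v} \<in> E}"

definition undirected_edge :: "'a \<times> 'a \<Rightarrow> 'a set" where
  "undirected_edge = (\<lambda>(u, v). {u, v})"

text \<open>The infimum in \<^const>\<open>wf_digraph.\<mu>\<close> is \<open>\<infinity>\<close> if there is no walk from \<open>u\<close> to \<open>v\<close>.\<close>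

definition hop_dist :: "'a set \<Rightarrow> ('a \<times> 'a) set \<Rightarrow> 'a \<Rightarrow> 'a \<Rightarrow> ereal" where
  "hop_dist V A u v = wf_digraph.\<mu> (with_proj \<lparr>pverts = V, parcs = A\<rparr>) (\<lambda>_. 1) u v"

definition dual_FT_BFS ::
    "('e set \<Rightarrow> ('a \<times> 'a) set) \<Rightarrow> 'a set \<Rightarrow> 'e set \<Rightarrow> 'a \<Rightarrow> 'e set \<Rightarrow> bool" where
  "dual_FT_BFS arcs_of V E s E' \<longleftrightarrow> E' \<subseteq> E \<and>
     (\<forall>F \<subseteq> E. finite F \<and> card F \<le> 2 \<longrightarrow>
       (\<forall>v \<in> V. hop_dist V (arcs_of (E' - F)) s v = hop_dist V (arcs_of (E - F)) s v))"

text \<open>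
  Programs of a random access machine, written as while programs over named arrays of natural
  numbers; a scalar \<open>x\<close> is the cell \<open>x[0]\<close>.  A program mentions only finitely many arrays and
  its expressions have bounded size, so charging one unit per assignment and per test is the usual
  unit-cost measure up to a constant factor.  The only arithmetic operations are addition and
  truncated subtraction.  Hence the bit lengths of all values grow at most linearly with the
  number of steps, and polynomial time here agrees with polynomial time on Turing machines
  (which would fail if multiplication had unit cost).
\<close>

type_synonym state = "string \<Rightarrow> nat \<Rightarrow> nat"

datatype expr =
    Lit nat
  | Read string expr
  | Add expr expr
  | Sub expr expr

datatype prog =
    Skip
  | Write string expr expr
  | Seq prog prog
  | Cond expr prog prog
  | Loop expr prog

primrec eval_expr :: "expr \<Rightarrow> state \<Rightarrow> nat" where
  "eval_expr (Lit n) \<sigma> = n"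
| "eval_expr (Read a i) \<sigma> = \<sigma> a (eval_expr i \<sigma>)"
| "eval_expr (Add e f) \<sigma> = eval_expr e \<sigma> + eval_expr f \<sigma>"
| "eval_expr (Sub e f) \<sigma> = eval_expr e \<sigma> - eval_expr f \<sigma>"

definition update :: "state \<Rightarrow> string \<Rightarrow> nat \<Rightarrow> nat \<Rightarrow> state" where
  "update \<sigma> a i x = \<sigma>(a := (\<sigma> a)(i := x))"

text \<open>\<open>runs P \<sigma> t \<tau>\<close>: started in \<open>\<sigma>\<close>, \<open>P\<close> halts in \<open>\<tau>\<close> after \<open>t\<close> steps.
  A test succeeds iff its value is nonzero.\<close>

inductive runs :: "prog \<Rightarrow> state \<Rightarrow> nat \<Rightarrow> state \<Rightarrow> bool" where
  Skip: "runs Skip \<sigma> 1 \<sigma>"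
| Write: "runs (Write a i e) \<sigma> 1 (update \<sigma> a (eval_expr i \<sigma>) (eval_expr e \<sigma>))"
| Seq: "runs P \<sigma> t \<sigma>' \<Longrightarrow> runs Q \<sigma>' u \<sigma>'' \<Longrightarrow> runs (Seq P Q) \<sigma> (t + u) \<sigma>''"
| CondTrue: "eval_expr b \<sigma> \<noteq> 0 \<Longrightarrow> runs P \<sigma> t \<sigma>' \<Longrightarrow> runs (Cond b P Q) \<sigma> (t + 1) \<sigma>'"
| CondFalse: "eval_expr b \<sigma> = 0 \<Longrightarrow> runs Q \<sigma> t \<sigma>' \<Longrightarrow> runs (Cond b P Q) \<sigma> (t + 1) \<sigma>'"
| LoopFalse: "eval_expr b \<sigma> = 0 \<Longrightarrow> runs (Loop b P) \<sigma> 1 \<sigma>"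
| LoopTrue: "eval_expr b \<sigma> \<noteq> 0 \<Longrightarrow> runs P \<sigma> t \<sigma>' \<Longrightarrow> runs (Loop b P) \<sigma>' u \<sigma>''
    \<Longrightarrow> runs (Loop b P) \<sigma> (t + u + 1) \<sigma>''"

text \<open>
  The input is a graph whose vertices are numbered \<open>0, \<dots>, n - 1\<close> by \<open>\<nu>\<close>, given by an edge list,
  together with the source.  All other cells are zero.  For an undirected graph each edge occurs
  once in the list, in an arbitrary orientation.
\<close>

definition graph_input :: "('a \<Rightarrow> nat) \<Rightarrow> nat \<Rightarrow> 'a \<Rightarrow> ('a \<times> 'a) list \<Rightarrow> state" where
  "graph_input \<nu> n s es = (\<lambda>a i.
     if a = ''n'' \<and> i = 0 then n
     else if a = ''m'' \<and> i = 0 then length es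
     else if a = ''source'' \<and> i = 0 then \<nu> s
     else if a = ''tail'' \<and> i < length es then \<nu> (fst (es ! i))
     else if a = ''head'' \<and> i < length es then \<nu> (snd (es ! i))
     else 0)"

definition kept_edges :: "state \<Rightarrow> 'e list \<Rightarrow> 'e set" where
  "kept_edges \<sigma> es = {es ! i | i. i < length es \<and> \<sigma> ''keep'' i \<noteq> 0}"

end

(*
  The program deletes edges greedily, as long as the remaining subgraph stays a dual FT-BFS
  subgraph, so it returns an inclusion-minimal one, H.  By minimality every edge e of H enters some
  vertex v such that, for some set F of at most two faults, all shortest s-v paths in H - F end
  with e.  It remains to show that each v has only O(L^2) such forced edges, where n <= L^3.

  Let pi be a shortest s-v path.  For a vertex w let R(w) be a fixed shortest w-v path that avoids
  pi, and let the basin of e consist of the w for which R(w) ends with e.  Basins are disjoint, so at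
  most n/L edges have basins of size at least L.  Now assume that the basin of e is
  small and that e is not the last edge of pi, so that F meets pi.
  If F lies on pi, then the part of the replacement path after its last vertex on pi lies in the basin,
  which leaves at most L edges.  Otherwise F = {f, g} with f on pi and g off pi, and the replacement
  path consists of a prefix of pi that ends above f and a detour off pi.

  If the detour has at least L^2 vertices, double counting applies: for each vertex u on the detour
  outside of the basin, g is among the last L edges of R(u), and u and g determine e.  So each u
  lies on at most L + 1 of these detours.

  If the detour is shorter than L^2, then f is among the last L^2 edges of pi, and the length of the
  replacement path is one of L^2 values.  Choose F for e such that this length is minimal and,
  subject to that, f is as low as possible.  Apart from one edge per f, at most two edges then share
  the same length.
*)

theory Submission
  imports Defs
begin

text \<open>Most arguments are exchanges. If two replacement paths meet at a vertex x other than v,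
  and each suffix from x avoids the faults of the other path, then the shorter suffix can replace
  the longer one, so both forced edges are the same. The obstacle is that a path chosen for one pair
  of faults need not avoid the other pair. For faults on \<pi> this is under control: a path that
  has left \<pi> above its fault and never uses an edge of \<pi> again also avoids every lower edge
  of \<pi>. Nothing similar holds for the fault g off \<pi>, and here the minimal choice of F helps.
  Keeping g while lowering the fault on \<pi> does not lengthen the replacement path, so by
  minimality the new pair cannot force e; it admits a shortest path with another last edge. Such a
  path links the edges of equal length to each other and rules out a third one.\<close>

section \<open>Shortest walks and forced edges\<close>

text \<open>Labels are the objects that fail: the arc itself in the directed case, its unordered
  pair of endpoints in the undirected one, where a single fault removes both opposite arcs.
  \<open>lab_eqD\<close> is the property that both cases share.\<close>

locale labelled_digraph =
  fixes V :: "'a set" and A :: "('a \<times> 'a) set" and lab :: "'a \<times> 'a \<Rightarrow> 'e"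
  assumes finite_V: "finite V"
    and A_subset: "A \<subseteq> V \<times> V"
    and lab_eqD: "\<And>x y x' y'. lab (x, y) = lab (x', y') \<Longrightarrow> {x, y} = {x', y'}"
begin

fun labs :: "'a list \<Rightarrow> 'e set" where
  "labs (a # b # p) = insert (lab (a, b)) (labs (b # p))"
| "labs _ = {}"

definition walk :: "'e set \<Rightarrow> 'a \<Rightarrow> 'a list \<Rightarrow> 'a \<Rightarrow> bool" where
  "walk F x p y \<longleftrightarrow> p \<noteq> [] \<and> hd p = x \<and> last p = y \<and>
     successively (\<lambda>a b. (a, b) \<in> A) p \<and> labs p \<inter> F = {}"

definition shortest :: "'e set \<Rightarrow> 'a \<Rightarrow> 'a list \<Rightarrow> 'a \<Rightarrow> bool" where
  "shortest F x p y \<longleftrightarrow> walk F x p y \<and> (\<forall>q. walk F x q y \<longrightarrow> length p \<le> length q)"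

text \<open>The label of the last arc; meaningless for walks without arcs.\<close>

definition end_lab :: "'a list \<Rightarrow> 'e" where
  "end_lab p = lab (last (butlast p), last p)"

text \<open>The existence clause excludes unreachable targets, for which the second clause would
  hold vacuously for every e.\<close>

definition forces :: "'a \<Rightarrow> 'a \<Rightarrow> 'e set \<Rightarrow> 'e \<Rightarrow> bool" where
  "forces s v F e \<longleftrightarrow> (\<exists>p. walk F s p v) \<and> (\<forall>p. shortest F s p v \<longrightarrow> end_lab p = e)"

lemma labs_append: "labs (p @ x # q) = labs (p @ [x]) \<union> labs (x # q)"
  by (induction p rule: labs.induct) auto

lemma labs_nth: "labs p = (\<lambda>j. lab (p ! j, p ! Suc j)) ` {j. Suc j < length p}"
proof (induction p rule: labs.induct)
  case (1 a b p)
  have "{j. Suc j < length (a # b # p)} = insert 0 (Suc ` {j. Suc j < length (b # p)})"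
    by (auto simp: image_iff gr0_conv_Suc less_Suc_eq_0_disj)
  then show ?case using 1 by (simp add: image_image)
qed auto

lemma labs_finite: "finite (labs p)"
  by (induction p rule: labs.induct) auto

lemma labs_split:
  assumes "g \<in> labs p"
  obtains p1 a b p2 where "p = p1 @ a # b # p2" "lab (a, b) = g"
proof -
  from assms obtain j where j: "Suc j < length p" "g = lab (p ! j, p ! Suc j)"
    unfolding labs_nth by auto
  have "p = take j p @ p ! j # p ! Suc j # drop (Suc (Suc j)) p"
    using j(1) by (simp add: Cons_nth_drop_Suc)
  with j(2) that show thesis by metis
qed

lemma walk_split:
  "walk F x (p @ z # q) y \<longleftrightarrow> walk F x (p @ [z]) z \<and> walk F z (z # q) y"
  unfolding walk_def labs_append[of p z q]
  by (cases p; cases q) (auto simp: successively_append_iff successively_Cons hd_append split: if_splits)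

lemma walk_append: "walk F x (p @ [z]) z \<Longrightarrow> walk F z (z # q) y \<Longrightarrow> walk F x (p @ z # q) y"
  using walk_split by blast

lemma walk_suffix: "walk F x (p @ z # q) y \<Longrightarrow> walk F z (z # q) y"
  using walk_split by blast

lemma walk_prefix: "walk F x (p @ z # q) y \<Longrightarrow> walk F x (p @ [z]) z"
  using walk_split by blast

lemma walk_splice:
  "walk F x (p @ z # q') y' \<Longrightarrow> walk F z (z # q) y \<Longrightarrow> walk F x (p @ z # q) y"
  using walk_prefix walk_append by metis

lemma walk_mono: "walk F x p y \<Longrightarrow> F' \<subseteq> F \<Longrightarrow> walk F' x p y"
  unfolding walk_def by auto

lemma walk_insert: "walk (insert g F) x p y \<longleftrightarrow> walk F x p y \<and> g \<notin> labs p"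
  unfolding walk_def by auto

lemma walk_Un: "walk (F \<union> F') x p y \<longleftrightarrow> walk F x p y \<and> walk F' x p y"
  unfolding walk_def by auto

lemma walk_disjoint: "walk F x p y \<Longrightarrow> labs p \<inter> F' = {} \<Longrightarrow> walk F' x p y"
  unfolding walk_def by auto

lemma walk_nonempty: "walk F x p y \<Longrightarrow> p \<noteq> []"
  unfolding walk_def by auto

lemma walk_last: "walk F x p y \<Longrightarrow> last p = y"
  unfolding walk_def by auto

lemma walk_in_V:
  assumes "walk F x p y" "x \<in> V"
  shows "set p \<subseteq> V"
proof -
  have "successively (\<lambda>a b. (a, b) \<in> A) p \<Longrightarrow> p \<noteq> [] \<Longrightarrow> hd p \<in> V \<Longrightarrow> set p \<subseteq> V" for p
    using A_subset by (induction p rule: induct_list012) auto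
  with assms show ?thesis unfolding walk_def by auto
qed

lemma shortest_walk: "shortest F x p y \<Longrightarrow> walk F x p y"
  unfolding shortest_def by auto

lemma shortest_le: "shortest F x p y \<Longrightarrow> walk F x q y \<Longrightarrow> length p \<le> length q"
  unfolding shortest_def by auto

lemma shortest_exists:
  assumes "walk F x p y"
  obtains q where "shortest F x q y"
  using arg_min_nat_lemma[of "\<lambda>q. walk F x q y" p length, OF assms] that
  unfolding shortest_def by auto

lemma shortestI: "shortest F x p y \<Longrightarrow> walk F x q y \<Longrightarrow> length q \<le> length p \<Longrightarrow> shortest F x q y"
  unfolding shortest_def by fastforce

lemma shortest_distinct:
  assumes "shortest F x p y"
  shows "distinct p"
proof (rule ccontr)
  assume "\<not> distinct p"
  then obtain xs z ys zs where p: "p = xs @ [z] @ ys @ [z] @ zs"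
    using not_distinct_decomp by blast
  have "walk F x (xs @ z # ys @ z # zs) y"
    using assms p unfolding shortest_def by simp
  then have "walk F x (xs @ [z]) z" "walk F z (z # ys @ z # zs) y"
    using walk_split by blast+
  moreover have "walk F z (z # zs) y"
    using calculation(2) iffD1[OF walk_split, of F z "z # ys" z zs y] by simp
  ultimately have "walk F x (xs @ z # zs) y"
    using walk_split by blast
  then have "length p \<le> length (xs @ z # zs)" using assms shortest_le by blast
  then show False using p by simp
qed

lemma shortest_suffix:
  assumes "shortest F x (p @ z # q) y"
  shows "shortest F z (z # q) y"
proof -
  have w: "walk F x (p @ [z]) z" "walk F z (z # q) y"
    using assms shortest_walk walk_split by blast+
  { fix r assume r: "walk F z r y"
    then obtain r' where r': "r = z # r'" unfolding walk_def by (cases r) auto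
    then have "walk F x (p @ z # r') y" using w r walk_split by blast
    then have "length (p @ z # q) \<le> length (p @ z # r')" using assms shortest_le by blast
    then have "length (z # q) \<le> length r" using r' by simp }
  with w show ?thesis unfolding shortest_def by blast
qed

lemma shortest_prefix:
  assumes "shortest F x (p @ z # q) y"
  shows "shortest F x (p @ [z]) z"
proof -
  have w: "walk F x (p @ [z]) z" "walk F z (z # q) y"
    using assms shortest_walk walk_split by blast+
  { fix r assume r: "walk F x r z"
    then obtain r' where r': "r = r' @ [z]" unfolding walk_def
      by (metis append_butlast_last_id)
    then have "walk F x (r' @ z # q) y" using w r walk_split by blast
    then have "length (p @ z # q) \<le> length (r' @ z # q)" using assms shortest_le by blast
    then have "length (p @ [z]) \<le> length r" using r' by simp }
  with w show ?thesis unfolding shortest_def by blast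
qed

lemma end_lab_append: "q \<noteq> [] \<Longrightarrow> end_lab (p @ x # q) = end_lab (x # q)"
  unfolding end_lab_def by (auto simp: butlast_append)

lemma walk_Cons_neq: "walk F x (x # q) y \<Longrightarrow> x \<noteq> y \<Longrightarrow> q \<noteq> []"
  unfolding walk_def by auto

text \<open>Equal labels determine only the unordered pair of endpoints, so the walk may traverse
  the edge in the opposite direction; no order of a and b on p can be claimed.\<close>

lemma labs_endpoints:
  assumes "lab (a, b) \<in> labs p"
  shows "a \<in> set p" "b \<in> set p"
proof -
  obtain p1 a' b' p2 where "p = p1 @ a' # b' # p2" "lab (a', b') = lab (a, b)"
    using assms labs_split by metis
  moreover from this have "{a, b} = {a', b'}" using lab_eqD by metis
  ultimately show "a \<in> set p" "b \<in> set p" by auto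
qed

text \<open>If two suffixes that avoid both fault sets met, the shorter one could replace the other.\<close>

lemma forces_swap:
  assumes e: "forces s v F e" "shortest F s (p @ w # q) v"
    and e': "forces s v F' e'" "shortest F' s (p' @ w # q') v"
    and avoid: "walk F' w (w # q) v" "walk F w (w # q') v"
    and "w \<noteq> v"
  shows "e = e'"
proof -
  have ne: "q \<noteq> []" "q' \<noteq> []"
    using avoid \<open>w \<noteq> v\<close> walk_Cons_neq by blast+
  have w: "walk F s (p @ w # q') v" "walk F' s (p' @ w # q) v"
    using e(2) e'(2) avoid walk_split shortest_walk by blast+
  have ends: "end_lab (p @ w # q) = e" "end_lab (p' @ w # q') = e'"
    using e e' unfolding forces_def by auto
  consider "length q \<le> length q'" | "length q' \<le> length q" by linarith
  then show ?thesis
  proof cases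
    case 1
    then have "shortest F' s (p' @ w # q) v" using shortestI[OF e'(2) w(2)] by simp
    then have "end_lab (p' @ w # q) = e'" using e'(1) unfolding forces_def by auto
    then show ?thesis using ends ne by (simp add: end_lab_append)
  next
    case 2
    then have "shortest F s (p @ w # q') v" using shortestI[OF e(2) w(1)] by simp
    then have "end_lab (p @ w # q') = e" using e(1) unfolding forces_def by auto
    then show ?thesis using ends ne by (simp add: end_lab_append)
  qed
qed

text \<open>Used mostly for contradictions: a competitor that avoids F and is no longer than a
  shortest path is shortest itself.\<close>

lemma forces_le_end:
  assumes "forces s v F e" "shortest F s p v" "walk F s q v" "length q \<le> length p"
  shows "end_lab q = e"
  using shortestI[OF assms(2-4)] assms(1) unfolding forces_def by simp

end

lemma card_le_fibres:
  assumes "finite T" "f ` S \<subseteq> T" "\<And>t. t \<in> T \<Longrightarrow> card {x \<in> S. f x = t} \<le> c"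
  shows "card S \<le> c * card T"
proof -
  have "S = (\<Union>t\<in>T. {x \<in> S. f x = t})" using assms(2) by auto
  then have "card S \<le> (\<Sum>t\<in>T. card {x \<in> S. f x = t})"
    using card_UN_le[OF assms(1), of "\<lambda>t. {x \<in> S. f x = t}"] by simp
  also have "\<dots> \<le> card T * c" using assms(3) sum_bounded_above[of T _ c] by simp
  finally show ?thesis by (simp add: mult.commute)
qed

lemma card_le_2I:
  assumes "\<And>x y z. x \<in> S \<Longrightarrow> y \<in> S \<Longrightarrow> z \<in> S \<Longrightarrow> distinct [x, y, z] \<Longrightarrow> False"
  shows "card S \<le> 2"
proof (rule ccontr)
  assume "\<not> card S \<le> 2"
  then have "3 \<le> card S" by simp
  then obtain T where T: "T \<subseteq> S" "card T = 3" using obtain_subset_with_card_n by metis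
  then obtain x y z where "T = {x, y, z}" "x \<noteq> y" "y \<noteq> z" "x \<noteq> z"
    unfolding card_3_iff by blast
  then show False using assms[of x y z] T(1) by auto
qed

section \<open>Walks relative to a fixed shortest path \<pi> to v\<close>

locale labelled_digraph_target = labelled_digraph V A lab
  for V :: "'a set" and A :: "('a \<times> 'a) set" and lab :: "'a \<times> 'a \<Rightarrow> 'e" +
  fixes s v :: 'a and \<pi> :: "'a list"
  assumes s_in_V: "s \<in> V" and s_neq_v: "s \<noteq> v" and pi_shortest: "shortest {} s \<pi> v"
begin

definition D :: nat where "D = length \<pi> - 1"

definition fault :: "nat \<Rightarrow> 'e" where "fault j = lab (\<pi> ! j, \<pi> ! Suc j)"

abbreviation \<Lambda> :: "'e set" where "\<Lambda> \<equiv> labs \<pi>"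

text \<open>This is R(w) of the overview. It avoids the edges of \<pi> but may visit vertices of
  \<pi>.\<close>

definition detour :: "'a \<Rightarrow> 'a list" where
  "detour w = (SOME p. shortest \<Lambda> w p v)"

text \<open>The target v is excluded because \<open>detour v\<close> has no last arc; the existence
  clause ensures that \<open>detour w\<close> is a walk at all.\<close>

definition detour_basin :: "'e \<Rightarrow> 'a set" where
  "detour_basin e = {w \<in> V. w \<noteq> v \<and> (\<exists>p. walk \<Lambda> w p v) \<and> end_lab (detour w) = e}"

lemma detour_shortest: "walk \<Lambda> w p v \<Longrightarrow> shortest \<Lambda> w (detour w) v"
  unfolding detour_def by (metis shortest_exists someI)

lemma pi_distinct: "distinct \<pi>"
  using pi_shortest shortest_distinct by blast

lemma length_pi: "length \<pi> = Suc D"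
  using pi_shortest unfolding shortest_def walk_def D_def by (cases \<pi>) auto

lemma pi_nth_D: "\<pi> ! D = v"
  using pi_shortest length_pi unfolding shortest_def walk_def by (auto simp: last_conv_nth)

lemma pi_nth_eq_iff: "j \<le> D \<Longrightarrow> k \<le> D \<Longrightarrow> \<pi> ! j = \<pi> ! k \<longleftrightarrow> j = k"
  using pi_distinct length_pi by (simp add: nth_eq_iff_index_eq)

lemma set_pi: "set \<pi> = (\<lambda>j. \<pi> ! j) ` {..D}"
  using length_pi by (auto simp: set_conv_nth less_Suc_eq_le)

lemma pi_decomp: "k \<le> D \<Longrightarrow> \<pi> = take k \<pi> @ \<pi> ! k # drop (Suc k) \<pi>"
  using length_pi by (simp add: id_take_nth_drop)

lemma labs_pi: "\<Lambda> = fault ` {..<D}"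
  unfolding labs_nth fault_def using length_pi by auto

lemma fault_inj: "i < D \<Longrightarrow> j < D \<Longrightarrow> fault i = fault j \<Longrightarrow> i = j"
proof -
  assume *: "i < D" "j < D" "fault i = fault j"
  then have "{\<pi> ! i, \<pi> ! Suc i} = {\<pi> ! j, \<pi> ! Suc j}"
    using lab_eqD unfolding fault_def by blast
  then show "i = j" using * by (auto simp: doubleton_eq_iff pi_nth_eq_iff)
qed

lemma fault_eq_iff: "i < D \<Longrightarrow> j < D \<Longrightarrow> fault i = fault j \<longleftrightarrow> i = j"
  using fault_inj by blast

lemma walk_pi_prefix: "k \<le> D \<Longrightarrow> walk {} s (take k \<pi> @ [\<pi> ! k]) (\<pi> ! k)"
  using pi_shortest pi_decomp[of k] walk_split shortest_walk by metis

lemma walk_pi_suffix: "k \<le> D \<Longrightarrow> shortest {} (\<pi> ! k) (\<pi> ! k # drop (Suc k) \<pi>) v"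
  using pi_shortest pi_decomp[of k] shortest_suffix by metis

lemma labs_pi_prefix:
  assumes "k \<le> D"
  shows "labs (take k \<pi> @ [\<pi> ! k]) = fault ` {..<k}"
proof -
  have "take k \<pi> @ [\<pi> ! k] = take (Suc k) \<pi>"
    using assms length_pi by (simp add: take_Suc_conv_app_nth)
  moreover have "labs (take (Suc k) \<pi>) = fault ` {..<k}"
    unfolding labs_nth fault_def using assms length_pi by (auto intro!: image_cong)
  ultimately show ?thesis by simp
qed

lemma labs_pi_suffix:
  assumes "k \<le> D"
  shows "labs (\<pi> ! k # drop (Suc k) \<pi>) = fault ` {k..<D}"
proof -
  have "\<pi> ! k # drop (Suc k) \<pi> = drop k \<pi>"
    using assms length_pi by (simp add: Cons_nth_drop_Suc)
  moreover have "labs (drop k \<pi>) = fault ` {k..<D}"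
  proof -
    have "{j. Suc j < length (drop k \<pi>)} = {j. k + j < D}" using length_pi by auto
    moreover have "{k..<D} = (+) k ` {j. k + j < D}"
      by (auto simp: image_iff) (metis le_add_diff_inverse)
    ultimately show ?thesis unfolding labs_nth fault_def using length_pi
      by (auto simp: image_image intro!: image_cong)
  qed
  ultimately show ?thesis by simp
qed

lemma prefix_avoids:
  assumes "k \<le> j" "j < D" "g \<notin> \<Lambda>"
  shows "walk {fault j, g} s (take k \<pi> @ [\<pi> ! k]) (\<pi> ! k)"
proof -
  have "k \<le> D" using assms by simp
  have "fault j \<notin> fault ` {..<k}"
  proof
    assume "fault j \<in> fault ` {..<k}"
    then obtain i where "i < k" "fault i = fault j" by auto
    then show False using fault_inj[of i j] assms by simp
  qed
  moreover have "g \<notin> fault ` {..<k}"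
    using assms(3) image_mono[of "{..<k}" "{..<D}" fault] \<open>k \<le> D\<close> unfolding labs_pi by auto
  ultimately show ?thesis
    using walk_pi_prefix[OF \<open>k \<le> D\<close>] labs_pi_prefix[OF \<open>k \<le> D\<close>] by (auto intro: walk_disjoint)
qed

text \<open>A prefix of \<pi> is shortest even among walks that may use every edge, so putting it in
  place of the start of a replacement path never lengthens that path.\<close>

lemma prefix_length:
  assumes "walk F s (p @ [\<pi> ! k]) (\<pi> ! k)" "k \<le> D"
  shows "k \<le> length p"
proof -
  have "shortest {} s (take k \<pi> @ [\<pi> ! k]) (\<pi> ! k)"
    using pi_shortest pi_decomp[OF assms(2)] shortest_prefix by metis
  then have "length (take k \<pi> @ [\<pi> ! k]) \<le> length (p @ [\<pi> ! k])"
    using shortest_le walk_mono[OF assms(1)] by blast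
  then show ?thesis using assms(2) length_pi by simp
qed

lemma suffix_length:
  assumes "walk F (\<pi> ! k) (\<pi> ! k # q) v" "k \<le> D"
  shows "D - k \<le> length q"
  using shortest_le[OF walk_pi_suffix[OF assms(2)] walk_mono[OF assms(1)]] length_pi by simp

text \<open>An edge of \<pi> used after the last visit to \<pi> before v must have the departure
  vertex and v as its ends. It is then the last edge of \<pi> and also the last edge of p, contrary
  to the assumption.\<close>

lemma last_departure:
  assumes "shortest F s p v" "end_lab p \<noteq> end_lab \<pi>"
  obtains p1 k q where "p = p1 @ \<pi> ! k # q" "k < D" "walk \<Lambda> (\<pi> ! k) (\<pi> ! k # q) v"
proof -
  have p: "p \<noteq> []" "hd p = s" "last p = v" "distinct p"
    using assms(1) shortest_distinct unfolding shortest_def walk_def by auto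
  have "s \<in> set \<pi>" using pi_shortest unfolding shortest_def walk_def by (metis hd_in_set)
  then have "\<exists>x\<in>set p. x \<in> set \<pi> \<and> x \<noteq> v" using p s_neq_v hd_in_set by metis
  then obtain p1 a q where q: "p = p1 @ a # q" "a \<in> set \<pi>" "a \<noteq> v"
      "\<forall>x\<in>set q. \<not> (x \<in> set \<pi> \<and> x \<noteq> v)"
    using split_list_last_prop[of p "\<lambda>x. x \<in> set \<pi> \<and> x \<noteq> v"] by blast
  obtain k where k: "k < D" "a = \<pi> ! k"
    using q(2,3) pi_nth_D unfolding set_pi by (metis atMost_iff imageE le_neq_implies_less)
  have "labs (a # q) \<inter> \<Lambda> = {}"
  proof (rule ccontr)
    assume "labs (a # q) \<inter> \<Lambda> \<noteq> {}"
    then obtain j where j: "j < D" "fault j \<in> labs (a # q)" unfolding labs_pi by auto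
    then have "{\<pi> ! j, \<pi> ! Suc j} \<subseteq> set (a # q) \<inter> set \<pi>"
      using labs_endpoints[of "\<pi> ! j" "\<pi> ! Suc j" "a # q"] length_pi unfolding fault_def by auto
    then have "{\<pi> ! j, \<pi> ! Suc j} \<subseteq> {a, v}" using q(4) by auto
    then have j': "\<pi> ! j = a" "\<pi> ! Suc j = v"
      using j(1) pi_nth_D pi_nth_eq_iff[of j "Suc j"] pi_nth_eq_iff[of j D] by auto
    obtain u b c w where ubw: "a # q = u @ b # c # w" "lab (b, c) = lab (a, v)"
      using j labs_split j' unfolding fault_def by metis
    then have bc: "{b, c} = {a, v}" using lab_eqD by metis
    have "distinct (a # q)" using p q by auto
    moreover have "last (a # q) = v" using p q by auto
    \<comment> \<open>This fixes the direction of traversal: v ends a list without repetitions, so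
      nothing can follow it.\<close>
    moreover have "b \<noteq> v"
    proof
      assume "b = v"
      moreover have "last (c # w) = v" using \<open>last (a # q) = v\<close> ubw(1) by simp
      ultimately have "b \<in> set (c # w)" by (metis last_in_set list.distinct(1))
      then show False using \<open>distinct (a # q)\<close> ubw(1) by simp
    qed
    then have "b = a" "c = v" using bc by (auto simp: doubleton_eq_iff)
    moreover have "u = []"
      using \<open>b = a\<close> ubw(1) \<open>distinct (a # q)\<close> by (cases u) auto
    moreover have "w = []"
    proof (rule ccontr)
      assume "w \<noteq> []"
      then have "v \<in> set w" using \<open>last (a # q) = v\<close> ubw(1) by (metis last.simps last_append last_in_set list.distinct(1))
      then show False using \<open>c = v\<close> \<open>distinct (a # q)\<close> ubw(1) by simp
    qed
    ultimately have "end_lab p = lab (a, v)" using ubw q(1) end_lab_append[of q p1 a]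
      by (simp add: end_lab_def)
    moreover have "end_lab \<pi> = lab (a, v)"
    proof -
      have "Suc j = D" using j' j(1) pi_nth_D pi_nth_eq_iff[of "Suc j" D] by auto
      then have "\<pi> = take j \<pi> @ a # v # []"
        using pi_decomp[of j] pi_decomp[of D] j' length_pi j(1) Cons_nth_drop_Suc[of "Suc j" \<pi>] by simp
      then show ?thesis by (metis end_lab_append end_lab_def butlast.simps(2) last.simps list.distinct(1))
    qed
    ultimately show False using assms(2) by simp
  qed
  moreover have "walk F a (a # q) v" using assms(1) q(1) walk_split shortest_walk by metis
  ultimately have "walk \<Lambda> a (a # q) v" using walk_disjoint by blast
  then show thesis using that q(1) k by blast
qed

text \<open>\<open>detour w\<close> is at most as long as the suffix \<open>w # q\<close>, since
  that suffix avoids \<pi> too. Replacing the suffix by it therefore gives another shortest path for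
  F.\<close>

lemma detour_end:
  assumes "forces s v F e" "shortest F s (p @ w # q) v" "w \<noteq> v"
    and "walk \<Lambda> w (w # q) v" "walk F w (detour w) v"
  shows "end_lab (detour w) = e"
proof -
  have sh: "shortest \<Lambda> w (detour w) v" using assms(4) detour_shortest by blast
  then have le: "length (detour w) \<le> length (w # q)" using assms(4) shortest_le by blast
  obtain r where r: "detour w = w # r"
    using sh unfolding shortest_def walk_def by (cases "detour w") auto
  have "walk F s (p @ w # r) v"
    using assms(2,5) r walk_split shortest_walk by metis
  then have "end_lab (p @ w # r) = e"
    using forces_le_end[OF assms(1,2)] le r by simp
  moreover have "r \<noteq> []" using assms(5) r walk_Cons_neq assms(3) by metis
  ultimately show ?thesis using r end_lab_append by metis
qed

lemma card_detour_basins: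
  assumes "finite S" "\<And>e. e \<in> S \<Longrightarrow> L \<le> card (detour_basin e)"
  shows "card S * L \<le> card V"
proof -
  have "card S * L \<le> (\<Sum>e\<in>S. card (detour_basin e))"
    using assms sum_bounded_below[of S L "\<lambda>e. card (detour_basin e)"] by simp
  also have "\<dots> = card (\<Union>e\<in>S. detour_basin e)"
    using assms(1) finite_V unfolding detour_basin_def
    by (intro card_UN_disjoint[symmetric]) auto
  also have "\<dots> \<le> card V"
    using finite_V unfolding detour_basin_def by (intro card_mono) auto
  finally show ?thesis .
qed

text \<open>Since F lies on \<pi>, \<open>detour w\<close> avoids F for every w on the final
  segment, and \<open>detour_end\<close> puts w into the basin. The segment has at least
  \<open>D - k\<close> edges because the rest of \<pi> is a shortest path.\<close>

lemma faults_on_path: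
  assumes "forces s v F e" "F \<subseteq> \<Lambda>" "e \<noteq> end_lab \<pi>"
  obtains k where "k < D" "\<pi> ! k \<in> detour_basin e" "D - k \<le> card (detour_basin e)"
proof -
  obtain p where p: "shortest F s p v"
    using assms(1) shortest_exists unfolding forces_def by metis
  then have "end_lab p = e" using assms(1) unfolding forces_def by blast
  then obtain p1 k q where q: "p = p1 @ \<pi> ! k # q" "k < D" "walk \<Lambda> (\<pi> ! k) (\<pi> ! k # q) v"
    using last_departure[OF p] assms(3) by metis
  define c where "c = \<pi> ! k # q"
  have "set p \<subseteq> V" using p walk_in_V s_in_V shortest_walk by blast
  have basin: "set c - {v} \<subseteq> detour_basin e"
  proof
    fix w assume w: "w \<in> set c - {v}"
    then obtain c1 c2 where c: "c = c1 @ w # c2" using split_list by fastforce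
    then have wc: "walk \<Lambda> w (w # c2) v" using q(3) walk_split unfolding c_def by metis
    have "shortest F s ((p1 @ c1) @ w # c2) v" using p q(1) c unfolding c_def by simp
    moreover have "walk F w (detour w) v"
      using detour_shortest[OF wc] assms(2) walk_mono shortest_walk by blast
    ultimately have "end_lab (detour w) = e"
      using detour_end[OF assms(1) _ _ wc] w by blast
    then show "w \<in> detour_basin e"
      using w wc \<open>set p \<subseteq> V\<close> q(1) unfolding detour_basin_def c_def by auto
  qed
  have "distinct c" using p q(1) shortest_distinct unfolding c_def by fastforce
  moreover have "v \<in> set c"
    using walk_last[OF q(3)] unfolding c_def by (metis last_in_set list.distinct(1))
  ultimately have "card (set c - {v}) = length q"
    by (simp add: distinct_card c_def[symmetric] card_Diff_singleton) (simp add: c_def)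
  moreover have "finite (detour_basin e)" using finite_V unfolding detour_basin_def by auto
  ultimately have "length q \<le> card (detour_basin e)" using basin card_mono by metis
  moreover have "D - k \<le> length q" using suffix_length q by simp
  moreover have "\<pi> ! k \<in> set c - {v}"
    using q(2) pi_nth_D pi_nth_eq_iff[of k D] unfolding c_def by auto
  ultimately show thesis using that q(2) basin by (meson le_trans subsetD)
qed

text \<open>Each edge selects a vertex of \<pi> in its own basin, at most L edges of \<pi> away from
  v. As basins are disjoint, the selection is injective.\<close>

lemma card_faults_on_path:
  assumes "\<And>e. e \<in> S \<Longrightarrow> e \<noteq> end_lab \<pi> \<and> card (detour_basin e) < L \<and> (\<exists>F \<subseteq> \<Lambda>. forces s v F e)"
  shows "card S \<le> L"
proof -
  have "\<exists>k. k < D \<and> D - k \<le> L \<and> \<pi> ! k \<in> detour_basin e" if eS: "e \<in> S" for e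
  proof -
    obtain F where "forces s v F e" "F \<subseteq> \<Lambda>" "e \<noteq> end_lab \<pi>" "card (detour_basin e) < L"
      using assms[OF eS] by blast
    moreover from calculation(1-3) obtain k
      where "k < D" "\<pi> ! k \<in> detour_basin e" "D - k \<le> card (detour_basin e)"
      by (rule faults_on_path)
    ultimately show ?thesis by (intro exI[of _ k]) simp
  qed
  then obtain k where k: "\<And>e. e \<in> S \<Longrightarrow> k e < D \<and> D - k e \<le> L \<and> \<pi> ! k e \<in> detour_basin e"
    by metis
  have "inj_on k S"
  proof (rule inj_onI)
    fix x y assume "x \<in> S" "y \<in> S" "k x = k y"
    then have "\<pi> ! k x \<in> detour_basin x" "\<pi> ! k x \<in> detour_basin y" using k by metis+
    then show "x = y" unfolding detour_basin_def by simp
  qed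
  moreover have "k ` S \<subseteq> {D - L..<D}" using k by fastforce
  ultimately have "card S \<le> card {D - L..<D}" using card_inj_on_le by blast
  then show ?thesis by simp
qed

end

section \<open>Replacement paths\<close>

context labelled_digraph
begin

text \<open>Counts vertices, as \<open>length\<close> does. Values are compared only for faults that
  leave the target reachable, which \<open>forces\<close> guarantees.\<close>

definition walk_length :: "'a \<Rightarrow> 'a \<Rightarrow> 'e set \<Rightarrow> nat" where
  "walk_length x y F = (LEAST n. \<exists>p. walk F x p y \<and> length p = n)"

lemma walk_length_shortest: "shortest F x p y \<Longrightarrow> walk_length x y F = length p"
  unfolding walk_length_def shortest_def by (intro Least_equality) auto

text \<open>Walks that use the same edge share both of its ends, and at least one of these differs
  from y. With v for y, the suffixes to be exchanged are nonempty and have a last edge.\<close>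

lemma common_vertex:
  assumes "g \<in> labs p" "g \<in> labs q" "distinct p"
  obtains x where "x \<noteq> y" "x \<in> set p" "x \<in> set q"
proof -
  obtain p1 a b p2 where p: "p = p1 @ a # b # p2" "lab (a, b) = g"
    using assms(1) labs_split by metis
  then have "a \<noteq> b" using assms(3) by auto
  moreover have "a \<in> set q" "b \<in> set q" using labs_endpoints[of a b q] p assms(2) by auto
  ultimately show thesis using that[of a] that[of b] p by auto
qed

lemma labs_suffix: "labs (x # q) \<subseteq> labs (p @ x # q)"
  using labs_append by blast

text \<open>Since p uses \<open>g'\<close>, it passes x and can continue along Q, which is at least
  as short from there because it has fewer faults to avoid. This part of Q avoids g, so the result
  is a competitor for e.\<close>

lemma forces_same_fault_aux:
  assumes Q: "shortest {f} s (u @ x # y # w) v" "g' = lab (x, y)" "g \<notin> labs (x # y # w)"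
    and p: "forces s v {f, g} e" "shortest {f, g} s p v" "g' \<in> labs p"
  shows "end_lab (u @ x # y # w) = e"
proof -
  have "x \<in> set p" using labs_endpoints(1)[of x y p] p(3) Q(2) by simp
  then obtain a b where ab: "p = a @ x # b" using split_list by metis
  have Qx: "shortest {f} x (x # y # w) v" using Q(1) shortest_suffix by blast
  have px: "walk {f, g} x (x # b) v" using p(2) ab walk_suffix shortest_walk by metis
  then have "length (x # y # w) \<le> length (x # b)"
    using shortest_le[OF Qx] walk_mono[of "{f, g}" x "x # b" v "{f}"] by blast
  moreover have "walk {f, g} x (x # y # w) v"
    using Qx Q(3) walk_insert[of g "{f}"] shortest_walk by (metis insert_commute)
  then have "walk {f, g} s (a @ x # y # w) v"
    using walk_splice[OF shortest_walk[OF p(2), unfolded ab]] by simp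
  ultimately have "end_lab (a @ x # y # w) = e" using forces_le_end[OF p(1,2)] ab by simp
  then show ?thesis using end_lab_append[of "y # w"] by (metis list.distinct(1))
qed

text \<open>Q must use g1 and g2, or it would itself compete with p1 or p2 and end with e1 or e2.
  Likewise p1 uses g2 and p2 uses g1, as their lengths are equal and their last edges differ. The
  suffix of Q from the later of the two faults avoids the other one, and
  \<open>forces_same_fault_aux\<close> switches p1 or p2 to that suffix.\<close>

lemma forces_same_fault:
  assumes Q: "shortest {f} s Q v" "end_lab Q \<noteq> e1" "end_lab Q \<noteq> e2"
    and 1: "forces s v {f, g1} e1" "shortest {f, g1} s p1 v"
    and 2: "forces s v {f, g2} e2" "shortest {f, g2} s p2 v"
    and len: "length p1 = length p2"
  shows "e1 = e2"
proof (rule ccontr)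
  assume "e1 \<noteq> e2"
  then have "g1 \<noteq> g2" using 1 2 unfolding forces_def by auto
  have on_Q: "g \<in> labs Q" if "forces s v {f, g} e" "shortest {f, g} s p v" "end_lab Q \<noteq> e" for g e p
  proof (rule ccontr)
    assume "g \<notin> labs Q"
    then have "walk {f, g} s Q v"
      using walk_insert[of g "{f}"] shortest_walk[OF Q(1)] by (metis insert_commute)
    moreover have "length Q \<le> length p"
      using shortest_le[OF Q(1)] walk_mono[OF shortest_walk[OF that(2)], of "{f}"] by blast
    ultimately show False using forces_le_end that by blast
  qed
  have cross: "g \<in> labs p'"
    if "forces s v {f, g} e" "shortest {f, g} s p v" "forces s v {f, g'} e'" "shortest {f, g'} s p' v"
      "length p' = length p" "e \<noteq> e'" for g g' e e' p p'
  proof (rule ccontr)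
    assume "g \<notin> labs p'"
    moreover have "walk {f} s p' v" using walk_mono[OF shortest_walk[OF that(4)]] by blast
    ultimately have "walk {f, g} s p' v" using walk_insert[of g "{f}"] by (metis insert_commute)
    then have "end_lab p' = e" using forces_le_end[OF that(1,2)] that(5) by simp
    then show False using that(3,4,6) unfolding forces_def by blast
  qed
  have gQ: "g1 \<in> labs Q" "g2 \<in> labs Q" using on_Q 1 2 Q by blast+
  obtain u x y w where Qs: "Q = u @ x # y # w" "lab (x, y) = g2" using gQ(2) labs_split by metis
  show False
  proof (cases "g1 \<in> labs (x # y # w)")
    case False
    then have "end_lab Q = e1"
      using forces_same_fault_aux[of f s u x y w v g2 g1 e1 p1] Q(1) Qs 1
        cross[OF 2 1 len] \<open>e1 \<noteq> e2\<close> by simp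
    then show False using Q by simp
  next
    case True
    then have "g1 \<in> labs (y # w)" using \<open>g1 \<noteq> g2\<close> Qs by auto
    then obtain u' x' y' w' where Qs': "y # w = u' @ x' # y' # w'" "lab (x', y') = g1"
      using labs_split by metis
    have "distinct Q" using Q(1) shortest_distinct by blast
    then have "x \<notin> set (x' # y' # w')"
    proof -
      have "x \<notin> set (y # w)" using \<open>distinct Q\<close> Qs by simp
      then show ?thesis unfolding Qs'(1) by simp
    qed
    then have "g2 \<notin> labs (x' # y' # w')" using labs_endpoints(1) Qs(2) by metis
    moreover have "Q = (u @ x # u') @ x' # y' # w'" using Qs Qs' by simp
    ultimately have "end_lab Q = e2"
      using forces_same_fault_aux[of f s "u @ x # u'" x' y' w' v g1 g2 e2 p2] Q(1) Qs' 2
        cross[OF 1 2] len \<open>e1 \<noteq> e2\<close> by simp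
    then show False using Q by simp
  qed
qed

end

section \<open>Exchange arguments for one fault on \<pi> and one off \<pi>\<close>

context labelled_digraph_target
begin

text \<open>If p left \<pi> for the last time below \<open>fault \<phi>\<close>, the rest of \<pi>
  would avoid both faults and be no longer, so e would be the last edge of \<pi>. As the departure
  is above the fault, a prefix of \<pi> can replace the start of p.\<close>

lemma departure_above_fault:
  assumes "\<phi> < D" "g \<notin> \<Lambda>" and F: "forces s v {fault \<phi>, g} e" and "e \<noteq> end_lab \<pi>"
    and p: "shortest {fault \<phi>, g} s p v"
  obtains p1 k q where "p = p1 @ \<pi> ! k # q" "k \<le> \<phi>" "walk \<Lambda> (\<pi> ! k) (\<pi> ! k # q) v"
    "shortest {fault \<phi>, g} s (take k \<pi> @ \<pi> ! k # q) v"
proof -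
  have "end_lab p = e" using F p unfolding forces_def by blast
  then obtain p1 k q where q: "p = p1 @ \<pi> ! k # q" "k < D" "walk \<Lambda> (\<pi> ! k) (\<pi> ! k # q) v"
    using last_departure[OF p] \<open>e \<noteq> end_lab \<pi>\<close> by metis
  have p1: "walk {fault \<phi>, g} s (p1 @ [\<pi> ! k]) (\<pi> ! k)"
    using p q(1) walk_prefix shortest_walk by metis
  have "k \<le> \<phi>"
  proof (rule ccontr)
    assume "\<not> k \<le> \<phi>"
    define r where "r = drop (Suc k) \<pi>"
    have sr: "shortest {} (\<pi> ! k) (\<pi> ! k # r) v" using walk_pi_suffix q(2) unfolding r_def by simp
    have "fault \<phi> \<notin> fault ` {k..<D}" using \<open>\<not> k \<le> \<phi>\<close> \<open>\<phi> < D\<close> by (auto simp: fault_eq_iff)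
    moreover have "g \<notin> fault ` {k..<D}" using assms(2) unfolding labs_pi by auto
    ultimately have "labs (\<pi> ! k # r) \<inter> {fault \<phi>, g} = {}"
      using labs_pi_suffix[of k] q(2) unfolding r_def by auto
    then have "walk {fault \<phi>, g} s (p1 @ \<pi> ! k # r) v"
      using walk_append[OF p1 walk_disjoint[OF shortest_walk[OF sr]]] by blast
    moreover have "length (p1 @ \<pi> ! k # r) \<le> length p"
      using shortest_le[OF sr walk_mono[OF q(3)]] q(1) by simp
    ultimately have "end_lab (p1 @ \<pi> ! k # r) = e" using forces_le_end[OF F p] by blast
    moreover have "r \<noteq> []" using q(2) length_pi unfolding r_def by simp
    moreover have "\<pi> = take k \<pi> @ \<pi> ! k # r" using pi_decomp q(2) unfolding r_def by simp
    ultimately show False using \<open>e \<noteq> end_lab \<pi>\<close> end_lab_append by metis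
  qed
  have "walk {fault \<phi>, g} (\<pi> ! k) (\<pi> ! k # q) v" using p q(1) walk_suffix shortest_walk by metis
  then have "walk {fault \<phi>, g} s (take k \<pi> @ \<pi> ! k # q) v"
    using walk_append[OF prefix_avoids[OF \<open>k \<le> \<phi>\<close> assms(1,2)]] by blast
  moreover have "length (take k \<pi> @ \<pi> ! k # q) \<le> length p"
    using prefix_length[OF p1] q(1,2) length_pi by simp
  ultimately have "shortest {fault \<phi>, g} s (take k \<pi> @ \<pi> ! k # q) v"
    using shortestI[OF p] by blast
  then show thesis using that q \<open>k \<le> \<phi>\<close> by blast
qed

text \<open>Encodes the lexicographic order: first the length of the replacement path, then the distance of
  the fault on \<open>\<pi>\<close> from the target.\<close>

definition weight :: "nat \<Rightarrow> 'e \<Rightarrow> nat" where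
  "weight \<phi> g = walk_length s v {fault \<phi>, g} * Suc D + (D - \<phi>)"

text \<open>The normal form of a replacement path: a prefix of \<pi>, then a detour. The list q
  omits the departure vertex, so its length is the number of edges of the detour, and the whole path
  has \<open>k + length q\<close> edges.\<close>

definition detours :: "nat \<Rightarrow> 'e \<Rightarrow> nat \<Rightarrow> 'a list \<Rightarrow> 'e \<Rightarrow> bool" where
  "detours \<phi> g k q e \<longleftrightarrow> \<phi> < D \<and> g \<notin> \<Lambda> \<and> e \<noteq> end_lab \<pi> \<and> k \<le> \<phi> \<and>
     forces s v {fault \<phi>, g} e \<and> walk \<Lambda> (\<pi> ! k) (\<pi> ! k # q) v \<and>
     shortest {fault \<phi>, g} s (take k \<pi> @ \<pi> ! k # q) v"

definition tight :: "nat \<Rightarrow> 'e \<Rightarrow> 'e \<Rightarrow> bool" where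
  "tight \<phi> g e \<longleftrightarrow>
     (\<forall>\<phi>' g'. \<phi>' < D \<and> g' \<notin> \<Lambda> \<and> forces s v {fault \<phi>', g'} e \<longrightarrow> weight \<phi> g \<le> weight \<phi>' g')"

text \<open>The prefix ends above \<open>fault \<phi>\<close> and the detour uses no edge of \<pi>,
  so the fault on \<pi> may be moved towards v without destroying the path.\<close>

lemma detours_avoids:
  assumes "detours \<phi> g k q e" "\<phi> \<le> j" "j < D"
  shows "walk {fault j} s (take k \<pi> @ \<pi> ! k # q) v"
proof -
  have "walk {fault j} s (take k \<pi> @ [\<pi> ! k]) (\<pi> ! k)"
    using prefix_avoids[of k j g] assms unfolding detours_def by (auto intro: walk_mono)
  moreover have "{fault j} \<subseteq> \<Lambda>" using assms(3) labs_pi by auto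
  then have "walk {fault j} (\<pi> ! k) (\<pi> ! k # q) v"
    using assms(1) walk_mono unfolding detours_def by blast
  ultimately show ?thesis by (rule walk_append)
qed

text \<open>By \<open>detours_avoids\<close> the path of e2 avoids \<open>fault \<phi>1\<close>. If
  it avoided g1 too, it would compete with p1 and end with e1. The edge g1 cannot be on the prefix,
  which runs along \<pi>.\<close>

lemma detours_fault_on:
  assumes 1: "forces s v {fault \<phi>1, g1} e1" "shortest {fault \<phi>1, g1} s p1 v"
    and "\<phi>1 < D" "g1 \<notin> \<Lambda>"
    and 2: "detours \<phi>2 g2 k2 q2 e2" "\<phi>2 \<le> \<phi>1" "k2 + Suc (length q2) \<le> length p1" and "e1 \<noteq> e2"
  shows "g1 \<in> labs (\<pi> ! k2 # q2)"
proof (rule ccontr)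
  assume "g1 \<notin> labs (\<pi> ! k2 # q2)"
  have "k2 < D" using 2(1) unfolding detours_def by auto
  have "g1 \<notin> labs (take k2 \<pi> @ [\<pi> ! k2])"
    using assms(4) labs_pi_prefix[of k2] \<open>k2 < D\<close> unfolding labs_pi by auto
  then have "g1 \<notin> labs (take k2 \<pi> @ \<pi> ! k2 # q2)"
    using \<open>g1 \<notin> labs (\<pi> ! k2 # q2)\<close> labs_append[of "take k2 \<pi>"] by blast
  then have "walk {fault \<phi>1, g1} s (take k2 \<pi> @ \<pi> ! k2 # q2) v"
    using detours_avoids[OF 2(1,2) assms(3)] walk_insert[of g1 "{fault \<phi>1}"]
    by (metis insert_commute)
  moreover have "length (take k2 \<pi> @ \<pi> ! k2 # q2) \<le> length p1"
    using 2(3) \<open>k2 < D\<close> length_pi by simp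
  ultimately have "end_lab (take k2 \<pi> @ \<pi> ! k2 # q2) = e1"
    using forces_le_end[OF 1] by blast
  moreover have "end_lab (take k2 \<pi> @ \<pi> ! k2 # q2) = e2"
    using 2(1) unfolding detours_def forces_def by blast
  ultimately show False using \<open>e1 \<noteq> e2\<close> by simp
qed

text \<open>If all shortest paths avoiding \<open>fault \<phi>1\<close> and \<open>g2\<close> ended with \<open>e2\<close>, then these two faults
  would force \<open>e2\<close> with a smaller weight.\<close>

lemma tight_pair:
  assumes 1: "forces s v {fault \<phi>1, g1} e1" "shortest {fault \<phi>1, g1} s p1 v"
    and \<phi>: "\<phi>2 < \<phi>1" "\<phi>1 < D" and "g1 \<notin> \<Lambda>"
    and 2: "detours \<phi>2 g2 k2 q2 e2" "tight \<phi>2 g2 e2" and "e1 \<noteq> e2"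
    and len: "length p1 = k2 + Suc (length q2)"
  obtains p where "shortest {fault \<phi>1, g1} s p v" "shortest {fault \<phi>1, g2} s p v"
proof -
  note det2 = 2(1)[unfolded detours_def]
  have g2: "g2 \<notin> \<Lambda>" using det2 by blast
  have k2: "k2 \<le> \<phi>2" using det2 by blast
  define P2 where "P2 = take k2 \<pi> @ \<pi> ! k2 # q2"
  have P2: "shortest {fault \<phi>2, g2} s P2 v" "length P2 = length p1"
    using det2 len length_pi unfolding P2_def by auto
  \<comment> \<open>Hence lowering the fault from \<open>fault \<phi>2\<close> to
    \<open>fault \<phi>1\<close> while keeping g2 does not increase the distance of v; this makes
    the weight strictly smaller.\<close>
  have P2_walk: "walk {fault \<phi>1, g2} s P2 v"
    using detours_avoids[OF 2(1) less_imp_le[OF \<phi>(1)] \<phi>(2)] shortest_walk[OF P2(1)]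
      walk_Un[of "{fault \<phi>1}" "{fault \<phi>2, g2}"] unfolding P2_def by (auto intro: walk_mono)
  obtain p where p: "shortest {fault \<phi>1, g2} s p v" "end_lab p \<noteq> e2"
  proof (rule ccontr)
    assume "\<not> thesis"
    then have "forces s v {fault \<phi>1, g2} e2" using that P2_walk unfolding forces_def by blast
    then have "weight \<phi>2 g2 \<le> weight \<phi>1 g2" using 2(2) \<phi> g2 unfolding tight_def by blast
    moreover obtain r where r: "shortest {fault \<phi>1, g2} s r v" using shortest_exists[OF P2_walk] .
    have "length r * Suc D \<le> length P2 * Suc D" using P2_walk shortest_le[OF r] mult_le_mono1 by blast
    ultimately have "length P2 * Suc D + (D - \<phi>2) \<le> length P2 * Suc D + (D - \<phi>1)"
      unfolding weight_def walk_length_shortest[OF P2(1)] walk_length_shortest[OF r] by linarith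
    then show False using \<phi> by simp
  qed
  have "hd p = s" "p \<noteq> []" using p(1) unfolding shortest_def walk_def by auto
  moreover have "\<pi> ! 0 = s" using pi_shortest unfolding shortest_def walk_def by (auto simp: hd_conv_nth)
  ultimately have "\<exists>x\<in>set p. x \<in> (\<lambda>j. \<pi> ! j) ` {..\<phi>1}" by (metis atMost_iff hd_in_set imageI le0)
  \<comment> \<open>a is the last vertex of p on \<pi> down to the upper end of
    \<open>fault \<phi>1\<close>. Both ends of \<open>fault \<phi>2\<close> belong to this part of
    \<pi>, so p does not use that edge after a.\<close>
  then obtain u a w where pd: "p = u @ a # w" "a \<in> (\<lambda>j. \<pi> ! j) ` {..\<phi>1}"
      "\<forall>x\<in>set w. x \<notin> (\<lambda>j. \<pi> ! j) ` {..\<phi>1}"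
    using split_list_last_prop[of p "\<lambda>x. x \<in> (\<lambda>j. \<pi> ! j) ` {..\<phi>1}"] by blast
  from pd(2) obtain j where j: "a = \<pi> ! j" "j \<le> \<phi>1" by auto
  define p' where "p' = take j \<pi> @ a # w"
  have aw: "walk {fault \<phi>1, g2} a (a # w) v" using p(1) pd(1) walk_suffix shortest_walk by metis
  have "walk {fault \<phi>1, g2} s p' v"
    using walk_append[OF prefix_avoids[OF j(2) \<phi>(2) g2]] aw j(1) unfolding p'_def by simp
  moreover have "length p' \<le> length p"
  proof -
    have "walk {fault \<phi>1, g2} s (u @ [\<pi> ! j]) (\<pi> ! j)"
      using p(1) pd(1) j(1) walk_prefix shortest_walk by metis
    then have "j \<le> length u" using prefix_length j \<phi> by simp
    then show ?thesis using pd(1) unfolding p'_def by simp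
  qed
  ultimately have p': "shortest {fault \<phi>1, g2} s p' v" using shortestI[OF p(1)] by blast
  have "a \<noteq> v" using j \<phi> pi_nth_D pi_nth_eq_iff[of j D] by auto
  then have "w \<noteq> []" using aw walk_Cons_neq by blast
  then have end_p': "end_lab p' \<noteq> e2" using p(2) pd(1) end_lab_append unfolding p'_def by metis
  have aw2: "fault \<phi>2 \<notin> labs (a # w)"
  proof
    assume "fault \<phi>2 \<in> labs (a # w)"
    then have "\<pi> ! \<phi>2 \<in> set (a # w)" "\<pi> ! Suc \<phi>2 \<in> set (a # w)"
      using labs_endpoints unfolding fault_def by blast+
    then have "\<pi> ! \<phi>2 = a" "\<pi> ! Suc \<phi>2 = a" using pd(3) \<phi>(1) by auto
    then show False using pi_nth_eq_iff[of \<phi>2 "Suc \<phi>2"] \<phi> by simp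
  qed
  \<comment> \<open>If g1 were on \<open>p'\<close>, it would be on the detour of e2 as well, and
    the two would meet at some x. Either the suffix of \<open>p'\<close> fits into P2 and must end
    with e2, or the suffix of P2 shortens \<open>p'\<close>; both are impossible.\<close>
  have "g1 \<notin> labs p'"
  proof
    assume "g1 \<in> labs p'"
    moreover have "g1 \<notin> labs (take j \<pi> @ [a])"
      using assms(5) labs_pi_prefix[of j] j \<phi> unfolding labs_pi by auto
    ultimately have g1: "g1 \<in> labs (a # w)" unfolding p'_def using labs_append by blast
    have g1': "g1 \<in> labs (\<pi> ! k2 # q2)"
      using detours_fault_on[OF 1 \<phi>(2) \<open>g1 \<notin> \<Lambda>\<close> 2(1)] \<phi> len \<open>e1 \<noteq> e2\<close> by simp
    have "distinct (a # w)" using shortest_distinct[OF p'] unfolding p'_def by simp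
    then obtain x where x: "x \<noteq> v" "x \<in> set (a # w)" "x \<in> set (\<pi> ! k2 # q2)"
      using common_vertex[OF g1 g1'] by metis
    obtain c d where cd: "a # w = c @ x # d" using x(2) split_list by metis
    obtain c' d' where cd': "\<pi> ! k2 # q2 = c' @ x # d'" using x(3) split_list by metis
    have xd: "walk {fault \<phi>1, g2} x (x # d) v" using aw cd walk_suffix by metis
    have "fault \<phi>2 \<notin> labs (x # d)" using aw2 cd labs_suffix by (metis subsetD)
    then have xd2: "walk {fault \<phi>2, g2} x (x # d) v"
      using xd walk_mono[OF xd, of "{g2}"] walk_insert[of "fault \<phi>2" "{g2}"] by blast
    have P2e: "P2 = (take k2 \<pi> @ c') @ x # d'" unfolding P2_def cd' by simp
    have xd': "walk {fault \<phi>1, g2} x (x # d') v" using P2_walk P2e walk_suffix by metis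
    have p'e: "p' = (take j \<pi> @ c) @ x # d" unfolding p'_def cd by simp
    have ne: "d \<noteq> []" using xd x(1) walk_Cons_neq by blast
    show False
    proof (cases "length d \<le> length d'")
      case True
      have "walk {fault \<phi>2, g2} s ((take k2 \<pi> @ c') @ x # d) v"
        using walk_splice[OF shortest_walk[OF P2(1), unfolded P2e] xd2] .
      then have "end_lab ((take k2 \<pi> @ c') @ x # d) = e2"
        using forces_le_end[OF _ P2(1)] det2 True P2e by simp
      then have "end_lab p' = e2" unfolding p'e using ne end_lab_append by metis
      then show False using end_p' by simp
    next
      case False
      have "walk {fault \<phi>1, g2} s ((take j \<pi> @ c) @ x # d') v"
        using walk_splice[OF shortest_walk[OF p', unfolded p'e] xd'] .
      then have "length p' \<le> length ((take j \<pi> @ c) @ x # d')" using p' shortest_le by blast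
      then show False using False p'e by simp
    qed
  qed
  then have "walk {fault \<phi>1, g1} s p' v"
    using walk_mono[OF shortest_walk[OF p'], of "{fault \<phi>1}"] walk_insert[of g1 "{fault \<phi>1}"]
    by (metis insert_commute insert_mono empty_subsetI)
  moreover have "length p' \<le> length p1" using shortest_le[OF p' P2_walk] P2(2) by simp
  ultimately have "shortest {fault \<phi>1, g1} s p' v" using shortestI[OF 1(2)] by blast
  then show thesis using that p' by blast
qed

text \<open>By \<open>tight_pair\<close>, a single path p is shortest for
  \<open>fault \<phi>2\<close> with g2 and for \<open>fault \<phi>2\<close> with g3; P is p with its
  start replaced by a prefix of \<pi>. Both P and P3 avoid \<open>fault \<phi>1\<close>, are as long
  as p1 and do not end with e1, so g1 lies on both detours, which hence meet at some x. If the
  suffix of P from x is no longer, it fits into P3, which would then end with e2 instead of e3.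
  Otherwise the suffix of P3 yields a walk avoiding \<open>fault \<phi>2\<close> and g3 that is
  shorter than p.\<close>

lemma tight_triple:
  assumes 1: "forces s v {fault \<phi>1, g1} e1" "shortest {fault \<phi>1, g1} s p1 v" "g1 \<notin> \<Lambda>"
    and \<phi>: "\<phi>3 < \<phi>2" "\<phi>2 < \<phi>1" "\<phi>1 < D"
    and 2: "detours \<phi>2 g2 k2 q2 e2"
    and 3: "detours \<phi>3 g3 k3 q3 e3" "tight \<phi>3 g3 e3"
    and len: "length p1 = k2 + Suc (length q2)" "length p1 = k3 + Suc (length q3)"
    and "distinct [e1, e2, e3]"
  shows False
proof -
  note det2 = 2[unfolded detours_def] and det3 = 3(1)[unfolded detours_def]
  define P2 where "P2 = take k2 \<pi> @ \<pi> ! k2 # q2"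
  define P3 where "P3 = take k3 \<pi> @ \<pi> ! k3 # q3"
  have P2: "shortest {fault \<phi>2, g2} s P2 v" "length P2 = length p1"
    using det2 len length_pi unfolding P2_def by auto
  have P3: "shortest {fault \<phi>3, g3} s P3 v" "length P3 = length p1"
    using det3 len length_pi unfolding P3_def by auto
  obtain p where p: "shortest {fault \<phi>2, g2} s p v" "shortest {fault \<phi>2, g3} s p v"
    using tight_pair[of \<phi>2 g2 e2 P2 \<phi>3 g3 k3 q3 e3] P2 det2 3 \<phi> len \<open>distinct [e1, e2, e3]\<close> by auto
  have len_p: "length p = length p1"
    using shortest_le[OF p(1)] shortest_le[OF P2(1)] p(1) P2 shortest_walk by (metis le_antisym)
  obtain r k q where q: "p = r @ \<pi> ! k # q" "k \<le> \<phi>2" "walk \<Lambda> (\<pi> ! k) (\<pi> ! k # q) v"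
      "shortest {fault \<phi>2, g2} s (take k \<pi> @ \<pi> ! k # q) v"
    using departure_above_fault[of \<phi>2 g2 e2 p] det2 p(1) by blast
  define P where "P = take k \<pi> @ \<pi> ! k # q"
  have det: "detours \<phi>2 g2 k q e2" using det2 q unfolding detours_def by blast
  have P: "shortest {fault \<phi>2, g2} s P v" using q(4) unfolding P_def .
  have len_P: "length P = length p1"
    using shortest_le[OF P] shortest_le[OF p(1)] p(1) P shortest_walk len_p by (metis le_antisym)
  have "walk {fault \<phi>2, g3} (\<pi> ! k) (\<pi> ! k # q) v"
    using p(2) q(1) walk_suffix shortest_walk by metis
  then have P_walk: "walk {fault \<phi>2, g3} s P v"
    using walk_append[OF prefix_avoids[OF q(2)]] \<phi> det3 unfolding P_def by simp
  have kD: "k < D" using q(2) \<phi> by simp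
  have g1: "g1 \<in> labs (\<pi> ! k # q)"
    using detours_fault_on[OF 1(1,2) _ 1(3) det] \<phi> \<open>distinct [e1, e2, e3]\<close> len_P kD length_pi
    unfolding P_def by simp
  have g1': "g1 \<in> labs (\<pi> ! k3 # q3)"
    using detours_fault_on[OF 1(1,2) _ 1(3) 3(1)] \<phi> \<open>distinct [e1, e2, e3]\<close> len by simp
  have "distinct (\<pi> ! k # q)" using shortest_distinct[OF P] unfolding P_def by simp
  then obtain x where x: "x \<noteq> v" "x \<in> set (\<pi> ! k # q)" "x \<in> set (\<pi> ! k3 # q3)"
    using common_vertex[OF g1 g1'] by metis
  obtain c d where cd: "\<pi> ! k # q = c @ x # d" using x(2) split_list by metis
  obtain c' d' where cd': "\<pi> ! k3 # q3 = c' @ x # d'" using x(3) split_list by metis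
  have Pe: "P = (take k \<pi> @ c) @ x # d" unfolding P_def cd by simp
  have P3e: "P3 = (take k3 \<pi> @ c') @ x # d'" unfolding P3_def cd' by simp
  have in_Pi: "fault \<phi>2 \<in> \<Lambda>" "fault \<phi>3 \<in> \<Lambda>" using \<phi> unfolding labs_pi by auto
  have Pi_d: "walk \<Lambda> x (x # d) v" using q(3) cd walk_suffix by metis
  have Pi_d': "walk \<Lambda> x (x # d') v" using det3 cd' walk_suffix by metis
  have g3d: "g3 \<notin> labs (x # d)"
    using P_walk Pe walk_suffix walk_insert[of g3 "{fault \<phi>2}"] by (metis insert_commute)
  have g3d': "g3 \<notin> labs (x # d')"
    using shortest_walk[OF P3(1)] P3e walk_suffix walk_insert[of g3 "{fault \<phi>3}"]
    by (metis insert_commute)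
  have ne: "d \<noteq> []" using Pi_d x(1) walk_Cons_neq by blast
  show False
  proof (cases "length d \<le> length d'")
    case True
    have "walk {fault \<phi>3, g3} x (x # d) v"
      using walk_mono[OF Pi_d, of "{fault \<phi>3}"] in_Pi g3d walk_insert[of g3 "{fault \<phi>3}"]
      by (simp add: insert_commute)
    then have "walk {fault \<phi>3, g3} s ((take k3 \<pi> @ c') @ x # d) v"
      using walk_splice[OF shortest_walk[OF P3(1), unfolded P3e]] by simp
    then have "end_lab ((take k3 \<pi> @ c') @ x # d) = e3"
      using forces_le_end[OF _ P3(1)] det3 True P3e by simp
    then have "end_lab P = e3" unfolding Pe using ne end_lab_append by metis
    moreover have "end_lab P = e2" using det2 P unfolding forces_def by blast
    ultimately show False using \<open>distinct [e1, e2, e3]\<close> by simp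
  next
    case False
    have "walk {fault \<phi>2, g3} x (x # d') v"
      using walk_mono[OF Pi_d', of "{fault \<phi>2}"] in_Pi g3d' walk_insert[of g3 "{fault \<phi>2}"]
      by (simp add: insert_commute)
    then have "walk {fault \<phi>2, g3} s ((take k \<pi> @ c) @ x # d') v"
      using walk_splice[OF P_walk[unfolded Pe]] by simp
    then have "length p \<le> length ((take k \<pi> @ c) @ x # d')" using p(2) shortest_le by blast
    then show False using False Pe len_p len_P by simp
  qed
qed

end

section \<open>Counting forced edges\<close>

lemma (in labelled_digraph) card_labs: "card (labs p) \<le> length p - 1"
  by (induction p rule: labs.induct) (auto simp: card_insert_if labs_finite)

context labelled_digraph_target
begin

lemma detours_exist:
  assumes "\<phi> < D" "g \<notin> \<Lambda>" "forces s v {fault \<phi>, g} e" "e \<noteq> end_lab \<pi>"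
  obtains \<phi>' g' k q where "detours \<phi>' g' k q e" "tight \<phi>' g' e"
proof -
  define P where "P = (\<lambda>(\<phi>, g). \<phi> < D \<and> g \<notin> \<Lambda> \<and> forces s v {fault \<phi>, g} e)"
  have "P (\<phi>, g)" using assms unfolding P_def by simp
  then obtain x where x: "P x" "\<forall>y. P y \<longrightarrow> case_prod weight x \<le> case_prod weight y"
    using ex_has_least_nat[of P "(\<phi>, g)" "case_prod weight"] by blast
  obtain \<phi>' g' where x': "x = (\<phi>', g')" by (cases x)
  have 1: "\<phi>' < D" "g' \<notin> \<Lambda>" "forces s v {fault \<phi>', g'} e" using x(1) unfolding x' P_def by auto
  have "tight \<phi>' g' e" using x(2) unfolding x' P_def tight_def by auto
  moreover obtain p where p: "shortest {fault \<phi>', g'} s p v"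
    using 1(3) shortest_exists unfolding forces_def by metis
  then obtain p1 k q where "k \<le> \<phi>'" "walk \<Lambda> (\<pi> ! k) (\<pi> ! k # q) v"
      "shortest {fault \<phi>', g'} s (take k \<pi> @ \<pi> ! k # q) v"
    using departure_above_fault[OF 1 assms(4) p] by metis
  then have "detours \<phi>' g' k q e" using 1 assms(4) unfolding detours_def by blast
  ultimately show thesis using that by blast
qed

text \<open>An edge that ends the fixed path \<open>Q j\<close> for its own fault j is charged to
  that fault; these are at most l. Of the other edges, those with equal path length have different
  faults on \<pi> by \<open>forces_same_fault\<close>, and \<open>tight_triple\<close> excludes
  three of them. With l possible lengths this gives l + 2 l.\<close>

lemma card_short_detours:
  assumes det: "\<And>e. e \<in> S \<Longrightarrow> detours (\<phi> e) (g e) (k e) (q e) e"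
    and tight: "\<And>e. e \<in> S \<Longrightarrow> tight (\<phi> e) (g e) e"
    and short: "\<And>e. e \<in> S \<Longrightarrow> length (q e) < l"
  shows "card S \<le> 3 * l"
proof -
  define P where "P e = take (k e) \<pi> @ \<pi> ! k e # q e" for e
  define Q where "Q j = (SOME p. shortest {fault j} s p v)" for j
  define N where "N = {e \<in> S. e = end_lab (Q (\<phi> e))}"
  define M where "M = S - N"
  have P: "shortest {fault (\<phi> e), g e} s (P e) v" "length (P e) = k e + Suc (length (q e))"
    and F: "forces s v {fault (\<phi> e), g e} e" if "e \<in> S" for e
    using det[OF that] length_pi unfolding detours_def P_def by auto
  have Q: "shortest {fault (\<phi> e)} s (Q (\<phi> e)) v" if e: "e \<in> S" for e
  proof -
    have "walk {fault (\<phi> e)} s (P e) v" using shortest_walk[OF P(1)[OF e]] by (auto intro: walk_mono)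
    then show ?thesis unfolding Q_def by (metis shortest_exists someI)
  qed
  \<comment> \<open>The lower bound on the length holds since the rest of \<pi> from the departure
    vertex is shortest. As the departure is not below the fault, the same bound places the fault
    among the last l edges of \<pi>.\<close>
  have range: "D \<le> k e + length (q e)" "k e + length (q e) < D + l" "\<phi> e \<in> {D - l..<D}"
    if e: "e \<in> S" for e
    using det[OF e] short[OF e] suffix_length[of \<Lambda> "k e" "q e"] unfolding detours_def by auto
  have "N \<subseteq> (\<lambda>j. end_lab (Q j)) ` {D - l..<D}" using range(3) unfolding N_def by auto
  then have "card N \<le> card {D - l..<D}" using surj_card_le by blast
  then have N: "card N \<le> l" by simp
  have distinct_\<phi>: "\<phi> x \<noteq> \<phi> y"
    if xy: "x \<in> M" "y \<in> M" "x \<noteq> y" "k x + length (q x) = k y + length (q y)" for x y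
  proof
    assume eq: "\<phi> x = \<phi> y"
    have S: "x \<in> S" "y \<in> S" using xy unfolding M_def by auto
    have "end_lab (Q (\<phi> x)) \<noteq> x" "end_lab (Q (\<phi> x)) \<noteq> y" using xy eq unfolding M_def N_def by auto
    then show False
      using forces_same_fault[OF Q[OF S(1)] _ _ F[OF S(1)] P(1)[OF S(1)], of y "g y" "P y"]
        F[OF S(2)] P(1)[OF S(2)] P(2)[OF S(1)] P(2)[OF S(2)] xy eq by simp
  qed
  have ordered: False
    if xyz: "x \<in> S" "y \<in> S" "z \<in> S" "\<phi> z < \<phi> y" "\<phi> y < \<phi> x"
      "k x + length (q x) = k y + length (q y)" "k x + length (q x) = k z + length (q z)" for x y z
  proof -
    have "\<phi> x < D" "g x \<notin> \<Lambda>" using det[OF xyz(1)] unfolding detours_def by auto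
    then show False
      using tight_triple[OF F[OF xyz(1)] P(1)[OF xyz(1)] _ xyz(4,5) _ det[OF xyz(2)] det[OF xyz(3)]
          tight[OF xyz(3)]] P(2)[OF xyz(1)] xyz(4-7) by force
  qed
  have "card M \<le> 2 * card {D..<D + l}"
  proof (rule card_le_fibres[where f = "\<lambda>e. k e + length (q e)"])
    show "(\<lambda>e. k e + length (q e)) ` M \<subseteq> {D..<D + l}" using range unfolding M_def by auto
    fix t
    show "card {e \<in> M. k e + length (q e) = t} \<le> 2"
    proof (rule card_le_2I)
      fix x y z
      assume *: "x \<in> {e \<in> M. k e + length (q e) = t}" "y \<in> {e \<in> M. k e + length (q e) = t}"
        "z \<in> {e \<in> M. k e + length (q e) = t}" "distinct [x, y, z]"
      then have "\<phi> x \<noteq> \<phi> y" "\<phi> y \<noteq> \<phi> z" "\<phi> x \<noteq> \<phi> z" using distinct_\<phi> by auto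
      then consider "\<phi> x < \<phi> y \<and> \<phi> y < \<phi> z" | "\<phi> x < \<phi> z \<and> \<phi> z < \<phi> y" | "\<phi> y < \<phi> x \<and> \<phi> x < \<phi> z"
        | "\<phi> y < \<phi> z \<and> \<phi> z < \<phi> x" | "\<phi> z < \<phi> x \<and> \<phi> x < \<phi> y" | "\<phi> z < \<phi> y \<and> \<phi> y < \<phi> x"
        by linarith
      then show False
        using * ordered[of x y z] ordered[of x z y] ordered[of y x z] ordered[of y z x]
          ordered[of z x y] ordered[of z y x] unfolding M_def by cases auto
    qed
  qed auto
  then have "card M \<le> 2 * l" by simp
  moreover have "card S \<le> card N + card M"
    using card_Un_le[of N M] unfolding M_def N_def by (simp add: Un_absorb1)
  ultimately show ?thesis using N by simp
qed

text \<open>\<open>detour u\<close> avoids \<open>fault \<phi>\<close> because it avoids all of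
  \<pi>. If it avoided g as well, \<open>detour_end\<close> would make it end with e.\<close>

lemma detour_meets_fault:
  assumes det: "detours \<phi> g k q e" and c: "\<pi> ! k # q = a @ u # b" and "u \<noteq> v"
    and "end_lab (detour u) \<noteq> e"
  shows "g \<in> labs (detour u)"
proof (rule ccontr)
  assume "g \<notin> labs (detour u)"
  note d = det[unfolded detours_def]
  have w: "walk \<Lambda> u (u # b) v" using d c walk_suffix by metis
  have "fault \<phi> \<in> \<Lambda>" using d unfolding labs_pi by auto
  then have "walk {fault \<phi>} u (detour u) v"
    using walk_mono[OF shortest_walk[OF detour_shortest[OF w]]] by blast
  then have *: "walk {fault \<phi>, g} u (detour u) v"
    using walk_insert[of g "{fault \<phi>}"] \<open>g \<notin> labs (detour u)\<close> by (simp add: insert_commute)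
  have "shortest {fault \<phi>, g} s ((take k \<pi> @ a) @ u # b) v" using d c by simp
  then have "end_lab (detour u) = e" using detour_end[OF _ _ \<open>u \<noteq> v\<close> w *] d by blast
  then show False using assms(4) by simp
qed

lemma detours_vertices:
  assumes det: "detours \<phi> g k q e"
  shows "distinct (\<pi> ! k # q)" "last (\<pi> ! k # q) = v" "set (\<pi> ! k # q) \<subseteq> V"
    "card (set (\<pi> ! k # q) - {v}) = length q"
proof -
  note d = det[unfolded detours_def]
  have sh: "shortest {fault \<phi>, g} s (take k \<pi> @ \<pi> ! k # q) v" using d by blast
  show 1: "distinct (\<pi> ! k # q)" using shortest_distinct[OF sh] by simp
  show 2: "last (\<pi> ! k # q) = v" using walk_last[OF shortest_walk[OF sh]] by simp
  show "set (\<pi> ! k # q) \<subseteq> V" using walk_in_V[OF shortest_walk[OF sh] s_in_V] by simp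
  have "v \<in> set (\<pi> ! k # q)" using 2 last_in_set by (metis list.distinct(1))
  then show "card (set (\<pi> ! k # q) - {v}) = length q"
    using distinct_card[OF 1] by (simp add: card_Diff_singleton)
qed

text \<open>The last L vertices of the detour before v do not all fit into the basin; let w be one
  outside. By \<open>detour_meets_fault\<close> the short path \<open>detour w\<close> uses g, so
  both ends of g have distance at most L to v off \<pi>. Since \<open>detour u\<close> is shortest,
  g is among its last L edges, that is, among its last L + 1 vertices.\<close>

lemma fault_near_target:
  assumes det: "detours \<phi> g k q e" and basin: "card (detour_basin e) < L" "L \<le> length q"
    and c: "\<pi> ! k # q = a @ u # b" and "u \<noteq> v" "end_lab (detour u) \<noteq> e"
  shows "g \<in> labs (drop (length (detour u) - Suc L) (detour u))"
proof -
  note d = det[unfolded detours_def]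
  define c where "c = \<pi> ! k # q"
  define T where "T = set (drop (length q - L) (butlast c))"
  have len: "length (butlast c) = length q" unfolding c_def by simp
  have dist: "distinct c" "last c = v" using detours_vertices[OF det] unfolding c_def by auto
  have c_eq: "c = butlast c @ [v]" using dist(2) unfolding c_def by (metis append_butlast_last_id list.distinct(1))
  have "card T = L"
    using distinct_card[of "drop (length q - L) (butlast c)"] dist(1) len basin(2)
    unfolding T_def by (simp add: distinct_butlast)
  have "\<not> T \<subseteq> detour_basin e"
    using card_mono[of "detour_basin e" T] \<open>card T = L\<close> basin(1) finite_V
    unfolding detour_basin_def by auto
  then obtain w where w: "w \<in> T" "w \<notin> detour_basin e" by blast
  obtain a2 b2 where ab2: "drop (length q - L) (butlast c) = a2 @ w # b2"
    using w(1) split_list unfolding T_def by metis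
  have cw: "\<pi> ! k # q = (take (length q - L) (butlast c) @ a2) @ w # (b2 @ [v])"
    using c_eq ab2 append_take_drop_id[of "length q - L" "butlast c"] unfolding c_def[symmetric]
    by (metis append.assoc append_Cons)
  have lenw: "length (b2 @ [v]) \<le> L"
    using arg_cong[OF ab2, of length] len by simp
  have "distinct ((take (length q - L) (butlast c) @ a2) @ w # (b2 @ [v]))"
    using dist(1) cw c_def by metis
  then have wv: "w \<noteq> v" by auto
  have ww: "walk \<Lambda> w (w # (b2 @ [v])) v" using d cw walk_suffix by metis
  have "w \<in> V" using detours_vertices(3)[OF det] cw by auto
  then have "end_lab (detour w) \<noteq> e" using w(2) wv ww unfolding detour_basin_def by blast
  then have gw: "g \<in> labs (detour w)" using detour_meets_fault[OF det cw wv] by blast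
  have lw: "length (detour w) \<le> Suc L"
    using shortest_le[OF detour_shortest[OF ww] ww] lenw by simp
  have wu: "walk \<Lambda> u (u # b) v" using d assms(4) walk_suffix by metis
  have gu: "g \<in> labs (detour u)" using detour_meets_fault[OF det assms(4-6)] .
  then obtain h x y t where h: "detour u = h @ x # y # t" "lab (x, y) = g" using labs_split by metis
  have "x \<in> set (detour w)" using labs_endpoints(1) gw h(2) by metis
  then obtain i j where ij: "detour w = i @ x # j" using split_list by metis
  have "walk \<Lambda> x (x # j) v" using shortest_walk[OF detour_shortest[OF ww]] ij walk_suffix by metis
  moreover have "shortest \<Lambda> x (x # y # t) v" using detour_shortest[OF wu] h(1) shortest_suffix by metis
  ultimately have "length (x # y # t) \<le> length (x # j)" using shortest_le by blast
  then have "length (x # y # t) \<le> Suc L" using lw ij by simp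
  then have "drop (length (detour u) - Suc L) (detour u)
      = drop (length (detour u) - Suc L) h @ x # y # t"
    using h(1) by simp
  then show ?thesis using h(2) labs_suffix[of x "y # t"] by auto
qed

lemma card_long_detours:
  assumes "finite S"
    and det: "\<And>e. e \<in> S \<Longrightarrow> detours (\<phi> e) (g e) (k e) (q e) e"
    and long: "\<And>e. e \<in> S \<Longrightarrow> l \<le> length (q e)"
    and basin: "\<And>e. e \<in> S \<Longrightarrow> card (detour_basin e) < L" and "L \<le> l"
  shows "card S * l \<le> card V * Suc L"
proof -
  define W where "W e = set (\<pi> ! k e # q e) - {v}" for e
  have per_vertex: "card {e \<in> S. u \<in> W e} \<le> Suc L" for u
  proof -
    \<comment> \<open>Only one edge can have u in its basin, namely the last edge of
      \<open>detour u\<close>. It is set aside here and accounts for the 1 in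
      \<open>Suc L\<close>.\<close>
    define N where "N = {e \<in> S. u \<in> W e \<and> e \<noteq> end_lab (detour u)}"
    define G where "G = labs (drop (length (detour u) - Suc L) (detour u))"
    have "g ` N \<subseteq> G"
    proof
      fix x assume "x \<in> g ` N"
      then obtain e where e: "e \<in> S" "u \<in> W e" "e \<noteq> end_lab (detour u)" "x = g e"
        unfolding N_def by auto
      obtain a b where ab: "\<pi> ! k e # q e = a @ u # b"
        using e(2) unfolding W_def by (metis DiffD1 split_list)
      show "x \<in> G"
        using fault_near_target[OF det[OF e(1)] basin[OF e(1)] _ ab] long[OF e(1)] \<open>L \<le> l\<close> e
        unfolding G_def W_def by auto
    qed
    \<comment> \<open>For two edges with the same fault off \<pi>, both suffixes from u avoid this
      fault and all of \<pi>, so \<open>forces_swap\<close> applies.\<close>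
    moreover have "inj_on g N"
    proof (rule inj_onI)
      fix x y assume xy: "x \<in> N" "y \<in> N" "g x = g y"
      then have S: "x \<in> S" "y \<in> S" and u: "u \<in> W x" "u \<in> W y" unfolding N_def by auto
      note dx = det[OF S(1), unfolded detours_def] and dy = det[OF S(2), unfolded detours_def]
      obtain a b where ab: "\<pi> ! k x # q x = a @ u # b" using u(1) unfolding W_def by (metis DiffD1 split_list)
      obtain c d where cd: "\<pi> ! k y # q y = c @ u # d" using u(2) unfolding W_def by (metis DiffD1 split_list)
      have sx: "shortest {fault (\<phi> x), g x} s ((take (k x) \<pi> @ a) @ u # b) v" using dx ab by simp
      have sy: "shortest {fault (\<phi> y), g y} s ((take (k y) \<pi> @ c) @ u # d) v" using dy cd by simp
      have in_Pi: "fault (\<phi> x) \<in> \<Lambda>" "fault (\<phi> y) \<in> \<Lambda>" using dx dy unfolding labs_pi by auto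
      have bw: "walk {fault (\<phi> y)} u (u # b) v"
        using dx ab walk_suffix[of \<Lambda> _ a u b] walk_mono[of \<Lambda> u "u # b" v "{fault (\<phi> y)}"] in_Pi
        by auto
      have dw: "walk {fault (\<phi> x)} u (u # d) v"
        using dy cd walk_suffix[of \<Lambda> _ c u d] walk_mono[of \<Lambda> u "u # d" v "{fault (\<phi> x)}"] in_Pi
        by auto
      have "g x \<notin> labs (u # b)"
        using walk_suffix[OF shortest_walk[OF sx]] unfolding walk_def by auto
      then have bw': "walk {fault (\<phi> y), g y} u (u # b) v"
        using bw xy(3) walk_insert[of "g y" "{fault (\<phi> y)}"] by (simp add: insert_commute)
      have "g y \<notin> labs (u # d)"
        using walk_suffix[OF shortest_walk[OF sy]] unfolding walk_def by auto
      then have dw': "walk {fault (\<phi> x), g x} u (u # d) v"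
        using dw xy(3) walk_insert[of "g x" "{fault (\<phi> x)}"] by (simp add: insert_commute)
      show "x = y"
        using forces_swap[OF _ sx _ sy bw' dw'] dx dy u unfolding W_def by blast
    qed
    moreover have "finite G" unfolding G_def by (rule labs_finite)
    ultimately have "card N \<le> card G" using card_inj_on_le by blast
    also have "\<dots> \<le> L" unfolding G_def using card_labs[of "drop (length (detour u) - Suc L) (detour u)"] by simp
    finally have "card N \<le> L" .
    moreover have "{e \<in> S. u \<in> W e} \<subseteq> insert (end_lab (detour u)) N" unfolding N_def by auto
    moreover have "finite N" using \<open>finite S\<close> unfolding N_def by simp
    ultimately have "card {e \<in> S. u \<in> W e} \<le> card (insert (end_lab (detour u)) N)"
      by (intro card_mono) auto
    also have "\<dots> \<le> Suc L" using \<open>card N \<le> L\<close> \<open>finite N\<close> by (simp add: card_insert_if)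
    finally show ?thesis .
  qed
  have W: "l \<le> card (W e)" "W e \<subseteq> V" if e: "e \<in> S" for e
    using detours_vertices[OF det[OF e]] long[OF e] unfolding W_def by auto
  have "card S * l \<le> (\<Sum>e\<in>S. card (W e))" using W sum_bounded_below[of S l] by simp
  also have "\<dots> = (\<Sum>e\<in>S. \<Sum>u\<in>V. if u \<in> W e then 1 else 0)"
    using W(2) finite_V by (intro sum.cong) (auto simp: sum.If_cases Int_absorb1)
  also have "\<dots> = (\<Sum>u\<in>V. \<Sum>e\<in>S. if u \<in> W e then 1 else 0)" by (rule sum.swap)
  also have "\<dots> = (\<Sum>u\<in>V. card {e \<in> S. u \<in> W e})"
    using \<open>finite S\<close> by (intro sum.cong) (auto simp: sum.If_cases Int_def)
  also have "\<dots> \<le> card V * Suc L" using per_vertex sum_bounded_above[of V _ "Suc L"] by simp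
  finally show ?thesis .
qed

lemma card_forced_aux:
  assumes "finite I" and I: "\<And>e. e \<in> I \<Longrightarrow> \<exists>F. finite F \<and> card F \<le> 2 \<and> forces s v F e"
    and "0 < L" "card V \<le> L ^ 3"
  shows "card I \<le> 8 * L\<^sup>2"
proof -
  define B where "B = {e \<in> I. L \<le> card (detour_basin e)}"
  define S1 where "S1 = {e \<in> I - B. e \<noteq> end_lab \<pi> \<and> (\<exists>F \<subseteq> \<Lambda>. forces s v F e)}"
  define S2 where "S2 = {e \<in> I - B. e \<noteq> end_lab \<pi> \<and> (\<exists>j g. j < D \<and> g \<notin> \<Lambda> \<and> forces s v {fault j, g} e)}"
  have cover: "I \<subseteq> insert (end_lab \<pi>) (B \<union> S1 \<union> S2)"
  proof
    fix e assume "e \<in> I"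
    then obtain F where F: "finite F" "card F \<le> 2" "forces s v F e" using I by blast
    show "e \<in> insert (end_lab \<pi>) (B \<union> S1 \<union> S2)"
    proof (cases "F \<inter> \<Lambda> = {}")
      case True
      then have "walk F s \<pi> v" using walk_disjoint[OF shortest_walk[OF pi_shortest]] by blast
      moreover have "length \<pi> \<le> length p" if "walk F s p v" for p
        using shortest_le[OF pi_shortest walk_mono[OF that]] by simp
      ultimately have "shortest F s \<pi> v" unfolding shortest_def by blast
      then have "end_lab \<pi> = e" using F(3) unfolding forces_def by blast
      then show ?thesis by simp
    next
      case False
      then obtain j where j: "j < D" "fault j \<in> F" unfolding labs_pi by auto
      show ?thesis
      proof (cases "F \<subseteq> \<Lambda>")
        case True
        then show ?thesis using F(3) \<open>e \<in> I\<close> unfolding S1_def by blast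
      next
        case False
        then obtain g where g: "g \<in> F" "g \<notin> \<Lambda>" by blast
        have "fault j \<noteq> g" using j(1) g(2) unfolding labs_pi by auto
        \<comment> \<open>Two different elements exhaust F, as it has at most two.\<close>
        then have "{fault j, g} = F" using j(2) g(1) F(1,2) by (intro card_seteq) auto
        then show ?thesis using F(3) j(1) g(2) \<open>e \<in> I\<close> unfolding S2_def by blast
      qed
    qed
  qed
  have "\<forall>e\<in>S2. \<exists>\<phi> g k q. detours \<phi> g k q e \<and> tight \<phi> g e"
    using detours_exist unfolding S2_def by (auto; metis)
  from bchoice[OF this] obtain \<phi> where "\<forall>e\<in>S2. \<exists>g k q. detours (\<phi> e) g k q e \<and> tight (\<phi> e) g e"
    by blast
  from bchoice[OF this] obtain g where "\<forall>e\<in>S2. \<exists>k q. detours (\<phi> e) (g e) k q e \<and> tight (\<phi> e) (g e) e"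
    by blast
  from bchoice[OF this] obtain k where "\<forall>e\<in>S2. \<exists>q. detours (\<phi> e) (g e) (k e) q e \<and> tight (\<phi> e) (g e) e"
    by blast
  from bchoice[OF this] obtain q where dt: "\<forall>e\<in>S2. detours (\<phi> e) (g e) (k e) (q e) e \<and> tight (\<phi> e) (g e) e"
    by blast
  \<comment> \<open>The threshold balances two bounds: the number of short detours is linear in it,
    while the number of long ones is at most n (L + 1) divided by it, which is at most L (L +
    1).\<close>
  define S3 where "S3 = {e \<in> S2. length (q e) < L\<^sup>2}"
  define S4 where "S4 = {e \<in> S2. L\<^sup>2 \<le> length (q e)}"
  have "card B * L \<le> card V"
    by (rule card_detour_basins) (simp_all add: B_def \<open>finite I\<close>)
  moreover have "L ^ 3 = L\<^sup>2 * L" by (simp add: power2_eq_square power3_eq_cube algebra_simps)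
  ultimately have "card B * L \<le> L\<^sup>2 * L" using assms(4) by linarith
  then have B: "card B \<le> L\<^sup>2" using \<open>0 < L\<close> by simp
  have S1: "card S1 \<le> L"
    by (rule card_faults_on_path) (auto simp: S1_def B_def)
  have S3: "card S3 \<le> 3 * L\<^sup>2"
    by (rule card_short_detours[of S3 \<phi> g k q]) (use dt S3_def in auto)
  have "card S4 * L\<^sup>2 \<le> card V * Suc L"
    by (rule card_long_detours[of S4 \<phi> g k q])
      (use \<open>finite I\<close> dt \<open>0 < L\<close> in \<open>auto simp: S4_def S2_def B_def power2_eq_square\<close>)
  also have "\<dots> \<le> L ^ 3 * Suc L" using assms(4) by (rule mult_le_mono1)
  also have "\<dots> = (L * Suc L) * L\<^sup>2" by (simp add: power2_eq_square power3_eq_cube algebra_simps)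
  finally have S4: "card S4 \<le> L * Suc L" using \<open>0 < L\<close> by simp
  have "finite B" "finite S1" "finite S3" "finite S4"
    using \<open>finite I\<close> unfolding B_def S1_def S3_def S4_def S2_def by auto
  moreover have "I \<subseteq> insert (end_lab \<pi>) (B \<union> S1 \<union> (S3 \<union> S4))"
    using cover unfolding S3_def S4_def by auto
  ultimately have "card I \<le> card (insert (end_lab \<pi>) (B \<union> S1 \<union> (S3 \<union> S4)))"
    by (intro card_mono) auto
  also have "\<dots> \<le> Suc (card (B \<union> S1 \<union> (S3 \<union> S4)))"
    by (rule card_insert_le_m1) auto
  also have "\<dots> \<le> Suc ((card B + card S1) + (card S3 + card S4))"
    using card_Un_le[of "B \<union> S1" "S3 \<union> S4"] card_Un_le[of B S1] card_Un_le[of S3 S4] by linarith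
  \<comment> \<open>The terms are the edges with large basins, those with all faults on \<pi>, the
    short detours and the long ones; \<open>Suc\<close> counts the last edge of \<pi>.\<close>
  also have "\<dots> \<le> Suc (L\<^sup>2 + L + 3 * L\<^sup>2 + L * Suc L)"
    using B S1 S3 S4 by linarith
  also have "\<dots> \<le> 8 * L\<^sup>2"
  proof -
    have "L \<le> L\<^sup>2" "1 \<le> L\<^sup>2" using \<open>0 < L\<close> by (auto simp: power2_eq_square)
    moreover have "L * Suc L = L\<^sup>2 + L" by (simp add: power2_eq_square)
    ultimately show ?thesis by linarith
  qed
  finally show ?thesis .
qed

end

context labelled_digraph
begin

lemma card_forced:
  assumes "finite I" "\<And>e. e \<in> I \<Longrightarrow> \<exists>F. finite F \<and> card F \<le> 2 \<and> forces s v F e"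
    and "0 < L" "card V \<le> L ^ 3" and "s \<in> V" "s \<noteq> v"
  shows "card I \<le> 8 * L\<^sup>2"
proof (cases "I = {}")
  case False
  then obtain F p where "walk F s p v" using assms(2) unfolding forces_def by blast
  then have "walk {} s p v" by (rule walk_mono) simp
  then obtain \<pi> where "shortest {} s \<pi> v" using shortest_exists by blast
  then interpret labelled_digraph_target V A lab s v \<pi>
    by unfold_locales (use assms in auto)
  show ?thesis using assms card_forced_aux by blast
qed simp

end

section \<open>Program logic\<close>

text \<open>Total correctness with a time bound. The initial state is fixed, so that Q can relate
  the final state to it.\<close>

definition spec :: "prog \<Rightarrow> nat \<Rightarrow> state \<Rightarrow> (state \<Rightarrow> bool) \<Rightarrow> bool" where
  "spec P T \<sigma> Q \<longleftrightarrow> (\<exists>t \<tau>. runs P \<sigma> t \<tau> \<and> t \<le> T \<and> Q \<tau>)"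

lemma spec_Skip: "Q \<sigma> \<Longrightarrow> spec Skip 1 \<sigma> Q"
  unfolding spec_def using runs.Skip by blast

lemma spec_Skip_le: "Q \<sigma> \<Longrightarrow> 1 \<le> T \<Longrightarrow> spec Skip T \<sigma> Q"
  unfolding spec_def using runs.Skip by blast

lemma spec_Write: "Q (update \<sigma> a (eval_expr i \<sigma>) (eval_expr e \<sigma>)) \<Longrightarrow> spec (Write a i e) 1 \<sigma> Q"
  unfolding spec_def using runs.Write by blast

lemma spec_Seq:
  assumes "spec P T \<sigma> R" "\<And>\<tau>. R \<tau> \<Longrightarrow> spec P' T' \<tau> Q"
  shows "spec (Seq P P') (T + T') \<sigma> Q"
proof -
  obtain t \<tau> where "runs P \<sigma> t \<tau>" "t \<le> T" "R \<tau>" using assms(1) unfolding spec_def by blast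
  moreover from this assms(2) obtain t' \<tau>' where "runs P' \<tau> t' \<tau>'" "t' \<le> T'" "Q \<tau>'"
    unfolding spec_def by blast
  ultimately show ?thesis unfolding spec_def using runs.Seq add_mono by blast
qed

lemma spec_Cond:
  assumes "eval_expr b \<sigma> \<noteq> 0 \<Longrightarrow> spec P T \<sigma> Q" "eval_expr b \<sigma> = 0 \<Longrightarrow> spec P' T \<sigma> Q"
  shows "spec (Cond b P P') (T + 1) \<sigma> Q"
proof (cases "eval_expr b \<sigma> = 0")
  case True
  then obtain t \<tau> where "runs P' \<sigma> t \<tau>" "t \<le> T" "Q \<tau>" using assms(2) unfolding spec_def by blast
  then show ?thesis unfolding spec_def using runs.CondFalse[OF True] by (meson add_le_mono1)
next
  case False
  then obtain t \<tau> where "runs P \<sigma> t \<tau>" "t \<le> T" "Q \<tau>" using assms(1) unfolding spec_def by blast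
  then show ?thesis unfolding spec_def using runs.CondTrue[OF False] by (meson add_le_mono1)
qed

lemma spec_weaken:
  assumes "spec P T \<sigma> Q" "T \<le> T'" "\<And>\<tau>. Q \<tau> \<Longrightarrow> Q' \<tau>"
  shows "spec P T' \<sigma> Q'"
  using assms unfolding spec_def by (meson le_trans)

lemma update_same: "update \<sigma> a i c a = (\<sigma> a)(i := c)"
  unfolding update_def by simp

lemma update_other: "a \<noteq> b \<Longrightarrow> update \<sigma> a i c b = \<sigma> b"
  unfolding update_def by simp

abbreviation scalar :: "string \<Rightarrow> expr" where "scalar x \<equiv> Read x (Lit 0)"

definition For :: "string \<Rightarrow> expr \<Rightarrow> prog \<Rightarrow> prog" where
  "For x b P = Seq (Write x (Lit 0) (Lit 0))
     (Loop (Sub b (scalar x)) (Seq P (Write x (Lit 0) (Add (scalar x) (Lit 1)))))"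

lemma spec_For_aux:
  assumes bound: "\<And>j \<tau>. I j \<tau> \<Longrightarrow> eval_expr b \<tau> = N"
    and var: "\<And>j \<tau> c. I j \<tau> \<Longrightarrow> I j (update \<tau> x 0 c)"
    and body: "\<And>j \<tau>. j < N \<Longrightarrow> \<tau> x 0 = j \<Longrightarrow> I j \<tau> \<Longrightarrow> spec P T \<tau> (\<lambda>\<tau>'. \<tau>' x 0 = j \<and> I (Suc j) \<tau>')"
    and "j \<le> N" "\<tau> x 0 = j" "I j \<tau>"
  shows "spec (Loop (Sub b (scalar x)) (Seq P (Write x (Lit 0) (Add (scalar x) (Lit 1)))))
     ((N - j) * (T + 2) + 1) \<tau> (I N)"
  using assms(4-6)
proof (induction "N - j" arbitrary: j \<tau>)
  case 0
  then have "j = N" by simp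
  then have "eval_expr (Sub b (scalar x)) \<tau> = 0" using 0 bound by simp
  then show ?case unfolding spec_def
    by (intro exI conjI, rule runs.LoopFalse) (use 0 \<open>j = N\<close> in auto)
next
  case (Suc d)
  let ?body = "Seq P (Write x (Lit 0) (Add (scalar x) (Lit 1)))"
  have j: "j < N" using Suc by simp
  have "spec ?body (T + 1) \<tau> (\<lambda>\<tau>'. \<tau>' x 0 = Suc j \<and> I (Suc j) \<tau>')"
    by (rule spec_Seq[OF body[OF j Suc.prems(2,3)]], rule spec_Write)
      (auto intro: var simp: update_same)
  then obtain t \<tau>' where 1: "runs ?body \<tau> t \<tau>'" "t \<le> T + 1" "\<tau>' x 0 = Suc j" "I (Suc j) \<tau>'"
    unfolding spec_def by blast
  have "spec (Loop (Sub b (scalar x)) ?body) ((N - Suc j) * (T + 2) + 1) \<tau>' (I N)"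
    using Suc.hyps(1)[of "Suc j" \<tau>'] Suc.hyps(2) 1 j by simp
  then obtain u \<tau>'' where 2: "runs (Loop (Sub b (scalar x)) ?body) \<tau>' u \<tau>''"
      "u \<le> (N - Suc j) * (T + 2) + 1" "I N \<tau>''"
    unfolding spec_def by blast
  have "eval_expr (Sub b (scalar x)) \<tau> \<noteq> 0" using bound[OF Suc.prems(3)] Suc.prems(2) j by simp
  then have "runs (Loop (Sub b (scalar x)) ?body) \<tau> (t + u + 1) \<tau>''"
    using runs.LoopTrue 1(1) 2(1) by blast
  moreover have "t + u + 1 \<le> (N - j) * (T + 2) + 1"
  proof -
    have "N - j = Suc (N - Suc j)" using j by simp
    then show ?thesis using 1(2) 2(2) by simp
  qed
  ultimately show ?case using 2(3) unfolding spec_def by blast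
qed

text \<open>A round costs T for the body, 1 for the increment and 1 for the test; the initial write
  and the failing test add 2. By \<open>var\<close>, the invariant must not depend on the counter
  cell, whose value is supplied separately as j.\<close>

lemma spec_For:
  assumes "I 0 \<sigma>"
    and bound: "\<And>j \<tau>. I j \<tau> \<Longrightarrow> eval_expr b \<tau> = N"
    and var: "\<And>j \<tau> c. I j \<tau> \<Longrightarrow> I j (update \<tau> x 0 c)"
    and body: "\<And>j \<tau>. j < N \<Longrightarrow> \<tau> x 0 = j \<Longrightarrow> I j \<tau> \<Longrightarrow> spec P T \<tau> (\<lambda>\<tau>'. \<tau>' x 0 = j \<and> I (Suc j) \<tau>')"
    and time: "N * (T + 2) + 2 \<le> T'" and post: "\<And>\<tau>. I N \<tau> \<Longrightarrow> Q \<tau>"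
  shows "spec (For x b P) T' \<sigma> Q"
proof -
  have "spec (For x b P) (1 + ((N - 0) * (T + 2) + 1)) \<sigma> (I N)"
    unfolding For_def
  proof (rule spec_Seq[where R = "\<lambda>\<tau>. \<tau> x 0 = 0 \<and> I 0 \<tau>"])
    show "spec (Write x (Lit 0) (Lit 0)) 1 \<sigma> (\<lambda>\<tau>. \<tau> x 0 = 0 \<and> I 0 \<tau>)"
      by (rule spec_Write) (use assms(1) var in \<open>simp add: update_same\<close>)
  qed (rule spec_For_aux[of I, OF bound var body], auto)
  then show ?thesis using time post by (elim spec_weaken) auto
qed

text \<open>A frame condition: M collects the arrays that a program may modify.\<close>

definition agree :: "string set \<Rightarrow> state \<Rightarrow> state \<Rightarrow> bool" where
  "agree M \<sigma> \<tau> \<longleftrightarrow> (\<forall>a. a \<notin> M \<longrightarrow> \<tau> a = \<sigma> a)"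

lemma agree_refl: "agree M \<sigma> \<sigma>"
  unfolding agree_def by simp

lemma agree_trans: "agree M \<sigma> \<tau> \<Longrightarrow> agree M' \<tau> \<tau>' \<Longrightarrow> M' \<subseteq> M \<Longrightarrow> agree M \<sigma> \<tau>'"
  unfolding agree_def by auto

lemma agree_update: "agree M \<sigma> \<tau> \<Longrightarrow> a \<in> M \<Longrightarrow> agree M \<sigma> (update \<tau> a i c)"
  unfolding agree_def update_def by auto

lemma agreeD: "agree M \<sigma> \<tau> \<Longrightarrow> a \<notin> M \<Longrightarrow> \<tau> a = \<sigma> a"
  unfolding agree_def by simp

text \<open>Distances are described by their sublevel sets, so that unreachable vertices need no
  special value and inclusions of graphs act monotonically.\<close>

definition reach_within :: "('v \<times> 'v) set \<Rightarrow> 'v \<Rightarrow> 'v \<Rightarrow> nat \<Rightarrow> bool" where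
  "reach_within B x y k \<longleftrightarrow> (\<exists>j\<le>k. (x, y) \<in> B ^^ j)"

lemma reach_within_mono: "reach_within B x y k \<Longrightarrow> k \<le> k' \<Longrightarrow> reach_within B x y k'"
  unfolding reach_within_def using le_trans by blast

lemma reach_within_subset:
  assumes "reach_within B x y k" "B \<subseteq> B'"
  shows "reach_within B' x y k"
proof -
  have "B ^^ j \<subseteq> B' ^^ j" for j using assms(2) by (induction j) auto
  then show ?thesis using assms(1) unfolding reach_within_def by blast
qed

lemma reach_within_refl: "reach_within B x x k"
  unfolding reach_within_def by (intro exI[of _ 0]) simp

lemma reach_within_step: "reach_within B x y k \<Longrightarrow> (y, z) \<in> B \<Longrightarrow> reach_within B x z (Suc k)"
  unfolding reach_within_def by (meson Suc_le_mono relpow_Suc_I)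

lemma reach_within_cases:
  assumes "reach_within B x z k"
  obtains "z = x" | y k' where "k = Suc k'" "reach_within B x y k'" "(y, z) \<in> B"
proof -
  obtain j where j: "j \<le> k" "(x, z) \<in> B ^^ j" using assms unfolding reach_within_def by blast
  show thesis
  proof (cases j)
    case 0
    then show thesis using j that(1) by simp
  next
    case (Suc i)
    then obtain y where y: "(x, y) \<in> B ^^ i" "(y, z) \<in> B" using j(2) by auto
    obtain k' where k': "k = Suc k'" using Suc j(1) by (cases k) auto
    then have "reach_within B x y k'" using y(1) Suc j(1) unfolding reach_within_def by auto
    then show thesis using that(2) y(2) k' by blast
  qed
qed

text \<open>The truncated difference is nonzero iff the stored distance of the end exceeds that of
  the start by more than 1. The arrays a and b are parameters, so exchanging them relaxes the
  reverse arc.\<close>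

definition relax :: "string \<Rightarrow> string \<Rightarrow> string \<Rightarrow> prog" where
  "relax d a b =
     Cond (Sub (Read d (Read b (scalar ''i''))) (Add (Read d (Read a (scalar ''i''))) (Lit 1)))
       (Write d (Read b (scalar ''i'')) (Add (Read d (Read a (scalar ''i''))) (Lit 1))) Skip"

definition relax_edge :: "bool \<Rightarrow> string \<Rightarrow> prog" where
  "relax_edge undir d = Seq (relax d ''tail'' ''head'') (if undir then relax d ''head'' ''tail'' else Skip)"

definition differ :: "expr \<Rightarrow> expr \<Rightarrow> expr" where
  "differ a b = Add (Sub a b) (Sub b a)"

text \<open>The scalars \<open>f\<close> and \<open>g\<close> hold the indices of the failed edges, where index \<open>m\<close> stands for no
  edge; \<open>b\<close> tests whether edge \<open>i\<close> belongs to the subgraph.  Distance \<open>n\<close> stands for unreachable.\<close>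

definition bellman_ford :: "bool \<Rightarrow> expr \<Rightarrow> string \<Rightarrow> prog" where
  "bellman_ford undir b d =
     Seq (For ''y'' (scalar ''n'') (Write d (scalar ''y'') (scalar ''n'')))
    (Seq (Write d (scalar ''source'') (Lit 0))
         (For ''r'' (scalar ''n'') (For ''i'' (scalar ''m'')
           (Cond b
             (Cond (differ (scalar ''i'') (scalar ''f''))
               (Cond (differ (scalar ''i'') (scalar ''g'')) (relax_edge undir d) Skip)
               Skip)
             Skip))))"

text \<open>\<open>Lit 1\<close> makes every edge a member, which yields distances in the whole
  graph. The flag \<open>bad\<close> is set but never cleared here, so it accumulates over all pairs
  of faults.\<close>

definition check_faults :: "bool \<Rightarrow> prog" where
  "check_faults undir =
     Seq (bellman_ford undir (Lit 1) ''d'')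
    (Seq (bellman_ford undir (Read ''keep'' (scalar ''i'')) ''h'')
         (For ''x'' (scalar ''n'')
           (Cond (differ (Read ''d'' (scalar ''x'')) (Read ''h'' (scalar ''x'')))
             (Write ''bad'' (Lit 0) (Lit 1)) Skip)))"

text \<open>With the bound m + 1 the indices f and g also take the value m, so fault sets with fewer
  than two edges are tested as well.\<close>

definition try_delete :: "bool \<Rightarrow> prog" where
  "try_delete undir =
     Seq (Write ''keep'' (scalar ''e'') (Lit 0))
    (Seq (Write ''bad'' (Lit 0) (Lit 0))
    (Seq (For ''f'' (Add (scalar ''m'') (Lit 1)) (For ''g'' (Add (scalar ''m'') (Lit 1)) (check_faults undir)))
         (Cond (scalar ''bad'') (Write ''keep'' (scalar ''e'') (Lit 1)) Skip)))"

definition greedy_prog :: "bool \<Rightarrow> prog" where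
  "greedy_prog undir =
     Seq (For ''i'' (scalar ''m'') (Write ''keep'' (scalar ''i'') (Lit 1)))
         (For ''e'' (scalar ''m'') (try_delete undir))"

lemma differ_eq_0: "eval_expr (differ a b) \<sigma> = 0 \<longleftrightarrow> eval_expr a \<sigma> = eval_expr b \<sigma>"
  unfolding differ_def by auto

section \<open>Correctness of the distance computation\<close>

locale input_graph =
  fixes n m source :: nat and src dst :: "nat \<Rightarrow> nat" and undir :: bool
  assumes source: "source < n"
    and ends: "\<And>i. i < m \<Longrightarrow> src i < n \<and> dst i < n"
begin

definition size :: nat where "size = n + m"

definition is_input :: "state \<Rightarrow> bool" where
  "is_input \<sigma> \<longleftrightarrow> \<sigma> ''n'' 0 = n \<and> \<sigma> ''m'' 0 = m \<and> \<sigma> ''source'' 0 = source \<and>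
     (\<forall>i<m. \<sigma> ''tail'' i = src i \<and> \<sigma> ''head'' i = dst i)"

definition arcs_at :: "nat \<Rightarrow> (nat \<times> nat) set" where
  "arcs_at i = {(src i, dst i)} \<union> (if undir then {(dst i, src i)} else {})"

definition arcs_in :: "nat set \<Rightarrow> (nat \<times> nat) set" where
  "arcs_in X = (\<Union>i\<in>X. arcs_at i)"

text \<open>The restriction to indices below m lets UNIV stand for the whole graph and makes the
  fault index m harmless.\<close>

definition active :: "nat set \<Rightarrow> nat \<Rightarrow> nat \<Rightarrow> nat set" where
  "active S f g = {i \<in> S. i < m \<and> i \<noteq> f \<and> i \<noteq> g}"

definition sound :: "nat set \<Rightarrow> (nat \<Rightarrow> nat) \<Rightarrow> bool" where
  "sound X d \<longleftrightarrow> (\<forall>v<n. d v \<le> n \<and> (d v < n \<longrightarrow> reach_within (arcs_in X) source v (d v)))"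

text \<open>Relaxation works in place, so after r rounds some values may be ahead of what r rounds
  promise. Hence only this upper bound refers to r; the opposite direction is
  \<open>sound\<close>.\<close>

definition complete :: "nat set \<Rightarrow> nat \<Rightarrow> (nat \<Rightarrow> nat) \<Rightarrow> bool" where
  "complete X r d \<longleftrightarrow> (\<forall>v<n. \<forall>k\<le>r. reach_within (arcs_in X) source v k \<longrightarrow> d v \<le> k)"

text \<open>Stated with reachability instead of \<open>d (fst a)\<close> so that it is stable: later
  relaxations in the same round may lower \<open>d (fst a)\<close>, but they cannot destroy
  it.\<close>

definition relaxed :: "nat set \<Rightarrow> nat \<Rightarrow> (nat \<times> nat) \<Rightarrow> (nat \<Rightarrow> nat) \<Rightarrow> bool" where
  "relaxed X r a d \<longleftrightarrow> (\<forall>k\<le>r. reach_within (arcs_in X) source (fst a) k \<longrightarrow> d (snd a) \<le> Suc k)"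

definition distances :: "nat set \<Rightarrow> (nat \<Rightarrow> nat) \<Rightarrow> bool" where
  "distances X d \<longleftrightarrow> (\<forall>v<n. d v \<le> n \<and> (\<forall>k<n. d v \<le> k \<longleftrightarrow> reach_within (arcs_in X) source v k))"

definition relax_arc :: "nat \<times> nat \<Rightarrow> (nat \<Rightarrow> nat) \<Rightarrow> nat \<Rightarrow> nat" where
  "relax_arc a d = d(snd a := min (d (snd a)) (Suc (d (fst a))))"

lemma size_pos: "1 \<le> size"
  using source unfolding size_def by simp

lemma relax_arc_le: "relax_arc a d v \<le> d v"
  unfolding relax_arc_def by auto

lemma complete_antimono: "complete X r d \<Longrightarrow> (\<And>v. d' v \<le> d v) \<Longrightarrow> complete X r d'"
  unfolding complete_def by (meson le_trans)

lemma relaxed_antimono: "relaxed X r a d \<Longrightarrow> (\<And>v. d' v \<le> d v) \<Longrightarrow> relaxed X r a d'"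
  unfolding relaxed_def by (meson le_trans)

lemma arcs_in_bounded: "X \<subseteq> {..<m} \<Longrightarrow> (x, y) \<in> arcs_in X \<Longrightarrow> x < n \<and> y < n"
  using ends unfolding arcs_in_def arcs_at_def by (auto split: if_splits)

lemma sound_relax_arc:
  assumes "sound X d" "a \<in> arcs_in X" "X \<subseteq> {..<m}"
  shows "sound X (relax_arc a d)"
proof -
  obtain x y where a: "a = (x, y)" by (cases a)
  have "x < n" using arcs_in_bounded assms a by blast
  then show ?thesis
    using assms(1,2) reach_within_step[of "arcs_in X" source x "d x" y]
    unfolding sound_def relax_arc_def a by (auto simp: min_def)
qed

lemma relaxed_relax_arc:
  assumes "complete X r d" "a \<in> arcs_in X" "X \<subseteq> {..<m}"
  shows "relaxed X r a (relax_arc a d)"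
proof -
  obtain x y where a: "a = (x, y)" by (cases a)
  have "x < n" using arcs_in_bounded assms a by blast
  then show ?thesis
    using assms(1) unfolding complete_def relaxed_def relax_arc_def a by (auto simp: min_le_iff_disj)
qed

lemma complete_Suc:
  assumes "complete X r d" "\<And>a. a \<in> arcs_in X \<Longrightarrow> relaxed X r a d"
  shows "complete X (Suc r) d"
  unfolding complete_def
proof (intro allI impI)
  fix v k assume v: "v < n" and k: "k \<le> Suc r" and w: "reach_within (arcs_in X) source v k"
  from w show "d v \<le> k"
  proof (cases rule: reach_within_cases)
    case 1
    then have "reach_within (arcs_in X) source v 0" using reach_within_refl by simp
    then have "d v \<le> 0" using assms(1) v unfolding complete_def by blast
    then show ?thesis by simp
  next
    case (2 u k')
    then show ?thesis using assms(2)[of "(u, v)"] k unfolding relaxed_def by simp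
  qed
qed

lemma distancesI:
  assumes "sound X d" "complete X n d"
  shows "distances X d"
  unfolding distances_def
proof (intro allI impI conjI iffI)
  fix v k assume "v < n" "k < n" "d v \<le> k"
  then have "reach_within (arcs_in X) source v (d v)" using assms(1) unfolding sound_def by simp
  then show "reach_within (arcs_in X) source v k" using \<open>d v \<le> k\<close> reach_within_mono by metis
qed (use assms in \<open>auto simp: sound_def complete_def\<close>)

lemma distances_eq_iff:
  assumes "distances X d" "distances Y h"
  shows "(\<forall>v<n. d v = h v) \<longleftrightarrow>
    (\<forall>v<n. \<forall>k<n. reach_within (arcs_in X) source v k \<longleftrightarrow> reach_within (arcs_in Y) source v k)"
proof
  assume "\<forall>v<n. d v = h v"
  then show "\<forall>v<n. \<forall>k<n. reach_within (arcs_in X) source v k \<longleftrightarrow> reach_within (arcs_in Y) source v k"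
    using assms unfolding distances_def by metis
next
  assume eq: "\<forall>v<n. \<forall>k<n. reach_within (arcs_in X) source v k \<longleftrightarrow> reach_within (arcs_in Y) source v k"
  show "\<forall>v<n. d v = h v"
  proof (intro allI impI)
    fix v assume v: "v < n"
    have le: "d v \<le> k \<longleftrightarrow> h v \<le> k" if "k < n" for k using assms eq v that unfolding distances_def by blast
    have "d v \<le> n" "h v \<le> n" using assms v unfolding distances_def by blast+
    then show "d v = h v" using le[of "d v"] le[of "h v"] by (cases "d v < n"; cases "h v < n") auto
  qed
qed

lemma spec_relax:
  assumes "d \<notin> {a, b, ''i''}"
  shows "spec (relax d a b) 2 \<sigma>
    (\<lambda>\<tau>. agree {d} \<sigma> \<tau> \<and> \<tau> d = relax_arc (\<sigma> a (\<sigma> ''i'' 0), \<sigma> b (\<sigma> ''i'' 0)) (\<sigma> d))"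
  unfolding relax_def one_add_one[symmetric]
  using assms
  by (intro spec_Cond spec_Write spec_Skip)
    (auto simp: relax_arc_def agree_refl agree_update update_same min_def fun_eq_iff)

lemma spec_relax_edge:
  assumes "d \<notin> {''tail'', ''head'', ''i''}" "is_input \<sigma>" "\<sigma> ''i'' 0 = i" "i < m"
    and "sound X (\<sigma> d)" "complete X r (\<sigma> d)" "i \<in> X" "X \<subseteq> {..<m}"
  shows "spec (relax_edge undir d) 4 \<sigma> (\<lambda>\<tau>. agree {d} \<sigma> \<tau> \<and> sound X (\<tau> d) \<and>
     (\<forall>v. \<tau> d v \<le> \<sigma> d v) \<and> (\<forall>a\<in>arcs_at i. relaxed X r a (\<tau> d)))"
proof -
  let ?a = "(src i, dst i)" and ?a' = "(dst i, src i)"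
  let ?R = "\<lambda>\<tau>. agree {d} \<sigma> \<tau> \<and> \<tau> d = relax_arc ?a (\<sigma> d)"
  have i: "\<sigma> ''tail'' i = src i" "\<sigma> ''head'' i = dst i" using assms(2,4) unfolding is_input_def by auto
  have 1: "spec (relax d ''tail'' ''head'') 2 \<sigma> ?R"
    using spec_relax[of d "''tail''" "''head''" \<sigma>] assms(1,3) i by simp
  have a: "?a \<in> arcs_in X" "undir \<Longrightarrow> ?a' \<in> arcs_in X" using assms(7) unfolding arcs_in_def arcs_at_def by auto
  have s1: "sound X (relax_arc ?a (\<sigma> d))" "relaxed X r ?a (relax_arc ?a (\<sigma> d))"
      "complete X r (relax_arc ?a (\<sigma> d))"
    using sound_relax_arc relaxed_relax_arc assms a complete_antimono relax_arc_le by blast+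
  show ?thesis
  proof (cases undir)
    case False
    then have at: "arcs_at i = {?a}" unfolding arcs_at_def by simp
    have "spec (relax_edge undir d) (2 + 1) \<sigma> (\<lambda>\<tau>. agree {d} \<sigma> \<tau> \<and> sound X (\<tau> d) \<and>
       (\<forall>v. \<tau> d v \<le> \<sigma> d v) \<and> (\<forall>a\<in>arcs_at i. relaxed X r a (\<tau> d)))"
      unfolding relax_edge_def if_not_P[OF False]
      by (rule spec_Seq[OF 1], rule spec_Skip) (use s1 at in \<open>auto simp: relax_arc_le\<close>)
    then show ?thesis by (rule spec_weaken) auto
  next
    case True
    have "spec (relax_edge undir d) (2 + 2) \<sigma> (\<lambda>\<tau>. agree {d} \<sigma> \<tau> \<and> sound X (\<tau> d) \<and>
       (\<forall>v. \<tau> d v \<le> \<sigma> d v) \<and> (\<forall>a\<in>arcs_at i. relaxed X r a (\<tau> d)))"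
      unfolding relax_edge_def
    proof (rule spec_Seq[OF 1])
      fix \<tau> assume \<tau>: "?R \<tau>"
      then have eq: "\<tau> ''i'' 0 = i" "\<tau> ''tail'' i = src i" "\<tau> ''head'' i = dst i"
        using assms(1,3) i agreeD[of "{d}" \<sigma> \<tau>] by auto
      have "spec (relax d ''head'' ''tail'') 2 \<tau> (\<lambda>\<tau>'. agree {d} \<tau> \<tau>' \<and> \<tau>' d = relax_arc ?a' (\<tau> d))"
        using spec_relax[of d "''head''" "''tail''" \<tau>] assms(1) eq by simp
      then show "spec (if undir then relax d ''head'' ''tail'' else Skip) 2 \<tau> (\<lambda>\<tau>. agree {d} \<sigma> \<tau> \<and> sound X (\<tau> d) \<and>
          (\<forall>v. \<tau> d v \<le> \<sigma> d v) \<and> (\<forall>a\<in>arcs_at i. relaxed X r a (\<tau> d)))"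
        unfolding if_P[OF True]
      proof (rule spec_weaken)
        fix \<tau>' assume \<tau>': "agree {d} \<tau> \<tau>' \<and> \<tau>' d = relax_arc ?a' (\<tau> d)"
        have "agree {d} \<sigma> \<tau>'" using \<tau> \<tau>' agree_trans by blast
        moreover have "sound X (\<tau>' d)" "relaxed X r ?a' (\<tau>' d)" "relaxed X r ?a (\<tau>' d)"
          using \<tau> \<tau>' s1 a(2)[OF True] sound_relax_arc relaxed_relax_arc relaxed_antimono[OF s1(2)]
            relax_arc_le assms(8) by auto
        moreover have "\<tau>' d v \<le> \<sigma> d v" for v using \<tau> \<tau>' relax_arc_le le_trans by metis
        ultimately show "agree {d} \<sigma> \<tau>' \<and> sound X (\<tau>' d) \<and>
          (\<forall>v. \<tau>' d v \<le> \<sigma> d v) \<and> (\<forall>a\<in>arcs_at i. relaxed X r a (\<tau>' d))"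
          unfolding arcs_at_def by auto
      qed simp
    qed
    then show ?thesis by simp
  qed
qed

lemma is_input_agree:
  assumes "is_input \<sigma>" "agree M \<sigma> \<tau>" "M \<inter> {''n'', ''m'', ''source'', ''tail'', ''head''} = {}"
  shows "is_input \<tau>"
proof -
  have "\<tau> a = \<sigma> a" if "a \<in> {''n'', ''m'', ''source'', ''tail'', ''head''}" for a
    by (rule agreeD[OF assms(2)]) (use assms(3) that in blast)
  then show ?thesis using assms(1) unfolding is_input_def by simp
qed

abbreviation bf_vars :: "string \<Rightarrow> string set" where
  "bf_vars d \<equiv> {d, ''i'', ''r'', ''y''}"

lemma spec_relax_if_active:
  assumes d: "d \<notin> {''tail'', ''head'', ''i'', ''f'', ''g''}" and "is_input \<sigma>" "\<sigma> ''i'' 0 = i" "i < m"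
    and b: "eval_expr b \<sigma> \<noteq> 0 \<longleftrightarrow> i \<in> S"
    and X: "X = active S (\<sigma> ''f'' 0) (\<sigma> ''g'' 0)" and "sound X (\<sigma> d)" "complete X r (\<sigma> d)"
  shows "spec (Cond b
             (Cond (differ (scalar ''i'') (scalar ''f''))
               (Cond (differ (scalar ''i'') (scalar ''g'')) (relax_edge undir d) Skip)
               Skip)
             Skip) 7 \<sigma> (\<lambda>\<tau>. agree {d} \<sigma> \<tau> \<and> sound X (\<tau> d) \<and> (\<forall>v. \<tau> d v \<le> \<sigma> d v) \<and>
               (i \<in> X \<longrightarrow> (\<forall>a\<in>arcs_at i. relaxed X r a (\<tau> d))))"
    (is "spec _ _ _ ?Q")
proof -
  have mem: "i \<in> X \<longleftrightarrow> eval_expr b \<sigma> \<noteq> 0 \<and> eval_expr (differ (scalar ''i'') (scalar ''f'')) \<sigma> \<noteq> 0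
      \<and> eval_expr (differ (scalar ''i'') (scalar ''g'')) \<sigma> \<noteq> 0"
    using b \<open>\<sigma> ''i'' 0 = i\<close> \<open>i < m\<close> unfolding differ_eq_0 X active_def by auto
  have skip: "spec Skip T \<sigma> ?Q" if "i \<notin> X" "1 \<le> T" for T
    using that assms(7) by (auto intro!: spec_Skip_le simp: agree_refl)
  have go: "spec (relax_edge undir d) 4 \<sigma> ?Q" if "i \<in> X"
    by (rule spec_weaken[OF spec_relax_edge[of d \<sigma> i X r]])
      (use assms that in \<open>auto simp: active_def\<close>)
  have "spec (Cond b
             (Cond (differ (scalar ''i'') (scalar ''f''))
               (Cond (differ (scalar ''i'') (scalar ''g'')) (relax_edge undir d) Skip)
               Skip)
             Skip) (4 + 1 + 1 + 1) \<sigma> ?Q"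
    by (intro spec_Cond go skip) (use mem in auto)
  then show ?thesis by (rule spec_weaken) auto
qed

lemma spec_bellman_ford:
  assumes d: "d \<notin> {''n'', ''m'', ''source'', ''tail'', ''head'', ''f'', ''g'', ''i'', ''r'', ''y''}"
    and input: "is_input \<sigma>"
    and b: "\<And>\<tau> i. agree (bf_vars d) \<sigma> \<tau> \<Longrightarrow> \<tau> ''i'' 0 = i \<Longrightarrow> i < m \<Longrightarrow> eval_expr b \<tau> \<noteq> 0 \<longleftrightarrow> i \<in> S"
  shows "spec (bellman_ford undir b d) (21 * size ^ 2) \<sigma> (\<lambda>\<tau>. agree (bf_vars d) \<sigma> \<tau> \<and>
     distances (active S (\<sigma> ''f'' 0) (\<sigma> ''g'' 0)) (\<tau> d))"
proof -
  define X where "X = active S (\<sigma> ''f'' 0) (\<sigma> ''g'' 0)"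
  have X: "X \<subseteq> {..<m}" unfolding X_def active_def by auto
  let ?A = "agree (bf_vars d) \<sigma>"
  have unchanged: "is_input \<tau>" "\<tau> ''n'' 0 = n" "\<tau> ''m'' 0 = m" "\<tau> ''source'' 0 = source"
    "\<tau> ''f'' = \<sigma> ''f''" "\<tau> ''g'' = \<sigma> ''g''" if "?A \<tau>" for \<tau>
  proof -
    show "is_input \<tau>" using is_input_agree[OF input that] d by auto
    then show "\<tau> ''n'' 0 = n" "\<tau> ''m'' 0 = m" "\<tau> ''source'' 0 = source" unfolding is_input_def by auto
    show "\<tau> ''f'' = \<sigma> ''f''" "\<tau> ''g'' = \<sigma> ''g''" using agreeD[OF that] d by auto
  qed
  have init_loop: "spec (For ''y'' (scalar ''n'') (Write d (scalar ''y'') (scalar ''n''))) (n * 3 + 2) \<sigma>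
      (\<lambda>\<tau>. ?A \<tau> \<and> (\<forall>v<n. \<tau> d v = n))"
  proof (rule spec_For[where I = "\<lambda>j \<tau>. ?A \<tau> \<and> (\<forall>v<j. \<tau> d v = n)" and N = n and T = 1])
    fix j \<tau> assume "\<tau> ''y'' 0 = j" "?A \<tau> \<and> (\<forall>v<j. \<tau> d v = n)"
    then show "spec (Write d (scalar ''y'') (scalar ''n'')) 1 \<tau>
        (\<lambda>\<tau>'. \<tau>' ''y'' 0 = j \<and> ?A \<tau>' \<and> (\<forall>v<Suc j. \<tau>' d v = n))"
      using unchanged(2) d by (intro spec_Write) (auto simp: agree_update update_same update_other less_Suc_eq)
  qed (use unchanged d in \<open>auto simp: agree_refl agree_update update_other\<close>)
  let ?I = "\<lambda>r \<tau>. ?A \<tau> \<and> sound X (\<tau> d) \<and> complete X r (\<tau> d)"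
  have source_step: "spec (Write d (scalar ''source'') (Lit 0)) 1 \<tau> (?I 0)"
    if "?A \<tau> \<and> (\<forall>v<n. \<tau> d v = n)" for \<tau>
  proof (rule spec_Write)
    have "(update \<tau> d source 0) d v = (if v = source then 0 else n)" if "v < n" for v
      using that \<open>?A \<tau> \<and> (\<forall>v<n. \<tau> d v = n)\<close> by (simp add: update_same)
    then have "sound X ((update \<tau> d source 0) d)" "complete X 0 ((update \<tau> d source 0) d)"
      unfolding sound_def complete_def by (auto simp: reach_within_def)
    then show "?I 0 (update \<tau> d (eval_expr (scalar ''source'') \<tau>) (eval_expr (Lit 0) \<tau>))"
      using that unchanged(4)[of \<tau>] by (simp add: agree_update)
  qed
  let ?body = "Cond b
             (Cond (differ (scalar ''i'') (scalar ''f''))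
               (Cond (differ (scalar ''i'') (scalar ''g'')) (relax_edge undir d) Skip)
               Skip)
             Skip"
  have one_round: "spec (For ''i'' (scalar ''m'') ?body) (m * 9 + 2) \<tau> (\<lambda>\<tau>'. \<tau>' ''r'' 0 = r \<and> ?I (Suc r) \<tau>')"
    if "\<tau> ''r'' 0 = r" "?I r \<tau>" for r \<tau>
  \<comment> \<open>Throughout a round completeness stays at level r; it rises to r + 1 only at the
    end, when all active arcs have been relaxed.\<close>
  proof (rule spec_For[where N = m and T = 7 and I = "\<lambda>j \<tau>. \<tau> ''r'' 0 = r \<and> ?I r \<tau> \<and>
       (\<forall>i\<in>X. i < j \<longrightarrow> (\<forall>a\<in>arcs_at i. relaxed X r a (\<tau> d)))"])
    fix i \<tau>
    assume i: "i < m" "\<tau> ''i'' 0 = i" and I: "\<tau> ''r'' 0 = r \<and> ?I r \<tau> \<and>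
       (\<forall>j\<in>X. j < i \<longrightarrow> (\<forall>a\<in>arcs_at j. relaxed X r a (\<tau> d)))"
    show "spec ?body 7 \<tau> (\<lambda>\<tau>'. \<tau>' ''i'' 0 = i \<and> \<tau>' ''r'' 0 = r \<and> ?I r \<tau>' \<and>
       (\<forall>j\<in>X. j < Suc i \<longrightarrow> (\<forall>a\<in>arcs_at j. relaxed X r a (\<tau>' d))))"
    proof (rule spec_weaken[OF spec_relax_if_active[of d \<tau> i b S X r]])
      show "X = active S (\<tau> ''f'' 0) (\<tau> ''g'' 0)" using unchanged(5,6) I unfolding X_def by simp
      fix \<tau>' assume \<tau>': "agree {d} \<tau> \<tau>' \<and> sound X (\<tau>' d) \<and> (\<forall>v. \<tau>' d v \<le> \<tau> d v) \<and>
               (i \<in> X \<longrightarrow> (\<forall>a\<in>arcs_at i. relaxed X r a (\<tau>' d)))"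
      have "\<tau>' ''i'' = \<tau> ''i''" "\<tau>' ''r'' = \<tau> ''r''" using agreeD[of "{d}" \<tau> \<tau>'] \<tau>' d by auto
      moreover have "?A \<tau>'" using agree_trans[of "bf_vars d" \<sigma> \<tau> "{d}" \<tau>'] I \<tau>' by auto
      moreover have "complete X r (\<tau>' d)" using complete_antimono I \<tau>' by blast
      moreover have "\<forall>j\<in>X. j < Suc i \<longrightarrow> (\<forall>a\<in>arcs_at j. relaxed X r a (\<tau>' d))"
      proof (intro ballI impI)
        fix j a assume "j \<in> X" "j < Suc i" "a \<in> arcs_at j"
        then show "relaxed X r a (\<tau>' d)"
          using I \<tau>' relaxed_antimono[of X r a "\<tau> d" "\<tau>' d"] by (cases "j = i") auto
      qed
      ultimately show "\<tau>' ''i'' 0 = i \<and> \<tau>' ''r'' 0 = r \<and> ?I r \<tau>' \<and>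
       (\<forall>j\<in>X. j < Suc i \<longrightarrow> (\<forall>a\<in>arcs_at j. relaxed X r a (\<tau>' d)))"
        using i I \<tau>' by simp
    qed (use d i I unchanged(1) b in auto)
  next
    fix \<tau> assume *: "\<tau> ''r'' 0 = r \<and> ?I r \<tau> \<and>
       (\<forall>j\<in>X. j < m \<longrightarrow> (\<forall>a\<in>arcs_at j. relaxed X r a (\<tau> d)))"
    then have "relaxed X r a (\<tau> d)" if "a \<in> arcs_in X" for a
      using that X unfolding arcs_in_def by blast
    then have "complete X (Suc r) (\<tau> d)" using complete_Suc * by blast
    then show "\<tau> ''r'' 0 = r \<and> ?I (Suc r) \<tau>" using * by simp
  qed (use that unchanged(3) d in \<open>auto simp: agree_update update_other\<close>)
  have all_rounds: "spec (For ''r'' (scalar ''n'') (For ''i'' (scalar ''m'') ?body)) (n * (m * 9 + 2 + 2) + 2) \<tau> (?I n)"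
    if "?I 0 \<tau>" for \<tau>
    by (rule spec_For[where N = n and T = "m * 9 + 2" and I = ?I])
      (use that one_round unchanged(2) d in \<open>auto simp: agree_update update_other\<close>)
  have "spec (bellman_ford undir b d) ((n * 3 + 2) + (1 + (n * (m * 9 + 2 + 2) + 2))) \<sigma> (?I n)"
    unfolding bellman_ford_def by (rule spec_Seq[OF init_loop spec_Seq[OF source_step all_rounds]])
  then show ?thesis
  proof (rule spec_weaken)
    \<comment> \<open>The total is 9 n m + 7 n + 5, and 9 + 7 + 5 = 21.\<close>
    have "n * m \<le> size * size" "n \<le> size * size" "1 \<le> size * size"
      using size_pos mult_le_mono[of n size m size] mult_le_mono[of n size 1 size] mult_le_mono[of 1 size 1 size]
      unfolding size_def by auto
    moreover have "n * (m * 9 + 2 + 2) = 9 * (n * m) + 4 * n" by (simp add: algebra_simps)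
    ultimately show "(n * 3 + 2) + (1 + (n * (m * 9 + 2 + 2) + 2)) \<le> 21 * size ^ 2"
      unfolding power2_eq_square by linarith
  qed (use distancesI X_def in auto)
qed

section \<open>Greedy deletion of edges\<close>

definition preserves :: "nat set \<Rightarrow> nat \<Rightarrow> nat \<Rightarrow> bool" where
  "preserves S f g \<longleftrightarrow> (\<forall>v<n. \<forall>k<n. reach_within (arcs_in (active UNIV f g)) source v k
     \<longleftrightarrow> reach_within (arcs_in (active S f g)) source v k)"

fun greedy :: "nat \<Rightarrow> nat set" where
  "greedy 0 = {..<m}"
| "greedy (Suc e) = (if \<forall>f\<le>m. \<forall>g\<le>m. preserves (greedy e - {e}) f g then greedy e - {e} else greedy e)"

lemma arcs_in_mono: "X \<subseteq> Y \<Longrightarrow> arcs_in X \<subseteq> arcs_in Y"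
  unfolding arcs_in_def by auto

lemma active_mono: "S \<subseteq> S' \<Longrightarrow> active S f g \<subseteq> active S' f g"
  unfolding active_def by auto

text \<open>Reachability within k steps grows with the edge set, so the subgraph for
  \<open>S'\<close> is squeezed between the one for S and the whole graph, which agree.\<close>

lemma preserves_mono: "preserves S f g \<Longrightarrow> S \<subseteq> S' \<Longrightarrow> preserves S' f g"
  unfolding preserves_def
  using reach_within_subset[OF _ arcs_in_mono[OF active_mono[of S S']]]
    reach_within_subset[OF _ arcs_in_mono[OF active_mono[of S' UNIV]]] by blast

text \<open>The invariants of the program describe \<open>keep\<close> only below m; other cells
  must not matter.\<close>

lemma preserves_cong: "S \<inter> {..<m} = S' \<inter> {..<m} \<Longrightarrow> preserves S f g = preserves S' f g"
proof -
  assume "S \<inter> {..<m} = S' \<inter> {..<m}"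
  then have "active S f g = active S' f g" unfolding active_def by auto
  then show ?thesis unfolding preserves_def by simp
qed

lemma greedy_antimono: "e \<le> e' \<Longrightarrow> greedy e' \<subseteq> greedy e"
  by (rule lift_Suc_antimono_le[of greedy]) auto

lemma greedy_subset: "greedy e \<subseteq> {..<m}"
  by (induction e) auto

lemma greedy_preserves: "f \<le> m \<Longrightarrow> g \<le> m \<Longrightarrow> preserves (greedy e) f g"
proof (induction e)
  case 0
  have "preserves UNIV f g" unfolding preserves_def by simp
  then show ?case using preserves_cong[of UNIV "{..<m}" f g] by simp
qed auto

text \<open>When e was examined, removing it from \<open>greedy e\<close> failed for some pair of
  faults. The final set is contained in \<open>greedy e\<close>, so by \<open>preserves_mono\<close>
  the removal still fails; this is why one pass suffices.\<close>

lemma greedy_minimal: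
  assumes "e \<in> greedy m"
  shows "\<exists>f\<le>m. \<exists>g\<le>m. \<not> preserves (greedy m - {e}) f g"
proof -
  have "e < m" using assms greedy_subset by auto
  then have "greedy m \<subseteq> greedy (Suc e)" "greedy m \<subseteq> greedy e"
    using greedy_antimono by (meson Suc_leI less_imp_le)+
  then have "greedy m - {e} \<subseteq> greedy e - {e}" "e \<in> greedy (Suc e)" using assms by blast+
  then show ?thesis using preserves_mono by (metis DiffD2 greedy.simps(2) insertI1)
qed

abbreviation check_vars :: "string set" where
  "check_vars \<equiv> {''d'', ''h'', ''i'', ''r'', ''y'', ''x'', ''bad''}"

lemma spec_check_faults:
  assumes input: "is_input \<sigma>" and S: "S = {i. \<sigma> ''keep'' i \<noteq> 0}"
  shows "spec (check_faults undir) (48 * size ^ 2) \<sigma> (\<lambda>\<tau>. agree check_vars \<sigma> \<tau> \<and>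
     (\<tau> ''bad'' 0 = 0 \<longleftrightarrow> \<sigma> ''bad'' 0 = 0 \<and> preserves S (\<sigma> ''f'' 0) (\<sigma> ''g'' 0)))"
proof -
  let ?f = "\<sigma> ''f'' 0" and ?g = "\<sigma> ''g'' 0"
  let ?A = "agree check_vars \<sigma>"
  let ?R1 = "\<lambda>\<tau>. agree (bf_vars ''d'') \<sigma> \<tau> \<and> distances (active UNIV ?f ?g) (\<tau> ''d'')"
  let ?R2 = "\<lambda>\<tau>. agree (bf_vars ''d'' \<union> bf_vars ''h'') \<sigma> \<tau> \<and> distances (active UNIV ?f ?g) (\<tau> ''d'')
     \<and> distances (active S ?f ?g) (\<tau> ''h'')"
  have 1: "spec (bellman_ford undir (Lit 1) ''d'') (21 * size ^ 2) \<sigma> ?R1"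
    by (rule spec_bellman_ford) (use input in auto)
  have 2: "spec (bellman_ford undir (Read ''keep'' (scalar ''i'')) ''h'') (21 * size ^ 2) \<tau> ?R2"
    if "?R1 \<tau>" for \<tau>
  proof -
    have eq: "\<tau> ''f'' = \<sigma> ''f''" "\<tau> ''g'' = \<sigma> ''g''" "\<tau> ''keep'' = \<sigma> ''keep''"
      using that agreeD[of "bf_vars ''d''" \<sigma> \<tau>] by auto
    have "is_input \<tau>" using is_input_agree[OF input] that by auto
    then have "spec (bellman_ford undir (Read ''keep'' (scalar ''i'')) ''h'') (21 * size ^ 2) \<tau>
      (\<lambda>\<tau>'. agree (bf_vars ''h'') \<tau> \<tau>' \<and> distances (active S (\<tau> ''f'' 0) (\<tau> ''g'' 0)) (\<tau>' ''h''))"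
    proof (rule spec_bellman_ford[rotated])
      fix \<tau>' i assume *: "agree (bf_vars ''h'') \<tau> \<tau>'" "\<tau>' ''i'' 0 = i"
      have "\<tau>' ''keep'' = \<sigma> ''keep''" using agreeD[OF *(1)] eq by auto
      then show "eval_expr (Read ''keep'' (scalar ''i'')) \<tau>' \<noteq> 0 \<longleftrightarrow> i \<in> S" using * S by simp
    qed simp
    then show ?thesis
    proof (rule spec_weaken)
      fix \<tau>' assume *: "agree (bf_vars ''h'') \<tau> \<tau>' \<and> distances (active S (\<tau> ''f'' 0) (\<tau> ''g'' 0)) (\<tau>' ''h'')"
      then have "\<tau>' ''d'' = \<tau> ''d''" using agreeD[of "bf_vars ''h''" \<tau> \<tau>'] by auto
      moreover have "agree (bf_vars ''d'' \<union> bf_vars ''h'') \<sigma> \<tau>'" using that * unfolding agree_def by auto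
      ultimately show "?R2 \<tau>'" using that * eq by simp
    qed simp
  qed
  have 3: "spec (For ''x'' (scalar ''n'')
      (Cond (differ (Read ''d'' (scalar ''x'')) (Read ''h'' (scalar ''x'')))
        (Write ''bad'' (Lit 0) (Lit 1)) Skip)) (n * 4 + 2) \<tau>
      (\<lambda>\<tau>. ?A \<tau> \<and> (\<tau> ''bad'' 0 = 0 \<longleftrightarrow> \<sigma> ''bad'' 0 = 0 \<and> preserves S ?f ?g))" if R2: "?R2 \<tau>" for \<tau>
  proof (rule spec_For[where N = n and T = 2 and I = "\<lambda>j \<tau>'. ?A \<tau>' \<and> \<tau>' ''d'' = \<tau> ''d'' \<and> \<tau>' ''h'' = \<tau> ''h''
      \<and> (\<tau>' ''bad'' 0 = 0 \<longleftrightarrow> \<sigma> ''bad'' 0 = 0 \<and> (\<forall>v<j. \<tau> ''d'' v = \<tau> ''h'' v))"])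
    have "\<tau> ''bad'' = \<sigma> ''bad''" using R2 agreeD[of "bf_vars ''d'' \<union> bf_vars ''h''" \<sigma> \<tau>] by auto
    moreover have "?A \<tau>" using R2 unfolding agree_def by auto
    ultimately show "?A \<tau> \<and> \<tau> ''d'' = \<tau> ''d'' \<and> \<tau> ''h'' = \<tau> ''h''
      \<and> (\<tau> ''bad'' 0 = 0 \<longleftrightarrow> \<sigma> ''bad'' 0 = 0 \<and> (\<forall>v<0. \<tau> ''d'' v = \<tau> ''h'' v))" by simp
  next
    fix j \<tau>' assume "?A \<tau>' \<and> \<tau>' ''d'' = \<tau> ''d'' \<and> \<tau>' ''h'' = \<tau> ''h''
      \<and> (\<tau>' ''bad'' 0 = 0 \<longleftrightarrow> \<sigma> ''bad'' 0 = 0 \<and> (\<forall>v<j. \<tau> ''d'' v = \<tau> ''h'' v))"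
    then have "is_input \<tau>'" using is_input_agree[OF input, of check_vars] by auto
    then show "eval_expr (scalar ''n'') \<tau>' = n" unfolding is_input_def by simp
  next
    fix j \<tau>' assume "\<tau>' ''x'' 0 = j" "?A \<tau>' \<and> \<tau>' ''d'' = \<tau> ''d'' \<and> \<tau>' ''h'' = \<tau> ''h''
      \<and> (\<tau>' ''bad'' 0 = 0 \<longleftrightarrow> \<sigma> ''bad'' 0 = 0 \<and> (\<forall>v<j. \<tau> ''d'' v = \<tau> ''h'' v))"
    then show "spec (Cond (differ (Read ''d'' (scalar ''x'')) (Read ''h'' (scalar ''x'')))
        (Write ''bad'' (Lit 0) (Lit 1)) Skip) 2 \<tau>' (\<lambda>\<tau>'. \<tau>' ''x'' 0 = j \<and> ?A \<tau>' \<and> \<tau>' ''d'' = \<tau> ''d'' \<and> \<tau>' ''h'' = \<tau> ''h''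
      \<and> (\<tau>' ''bad'' 0 = 0 \<longleftrightarrow> \<sigma> ''bad'' 0 = 0 \<and> (\<forall>v<Suc j. \<tau> ''d'' v = \<tau> ''h'' v)))"
      unfolding one_add_one[symmetric]
      by (intro spec_Cond spec_Write spec_Skip)
        (auto simp: differ_eq_0 agree_update update_same update_other less_Suc_eq)
  next
    fix \<tau>' assume "?A \<tau>' \<and> \<tau>' ''d'' = \<tau> ''d'' \<and> \<tau>' ''h'' = \<tau> ''h''
      \<and> (\<tau>' ''bad'' 0 = 0 \<longleftrightarrow> \<sigma> ''bad'' 0 = 0 \<and> (\<forall>v<n. \<tau> ''d'' v = \<tau> ''h'' v))"
    then show "?A \<tau>' \<and> (\<tau>' ''bad'' 0 = 0 \<longleftrightarrow> \<sigma> ''bad'' 0 = 0 \<and> preserves S ?f ?g)"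
      using distances_eq_iff[of "active UNIV ?f ?g" "\<tau> ''d''" "active S ?f ?g" "\<tau> ''h''"] R2
      unfolding preserves_def by simp
  qed (auto simp: agree_update update_other)
  have "spec (check_faults undir) (21 * size ^ 2 + (21 * size ^ 2 + (n * 4 + 2))) \<sigma>
     (\<lambda>\<tau>. ?A \<tau> \<and> (\<tau> ''bad'' 0 = 0 \<longleftrightarrow> \<sigma> ''bad'' 0 = 0 \<and> preserves S ?f ?g))"
    unfolding check_faults_def by (rule spec_Seq[OF 1 spec_Seq[OF 2 3]])
  then show ?thesis
  proof (rule spec_weaken)
    have "size ^ 1 \<le> size ^ 2" using size_pos by (intro power_increasing) auto
    then show "21 * size ^ 2 + (21 * size ^ 2 + (n * 4 + 2)) \<le> 48 * size ^ 2"
      using size_pos unfolding power_one_right by (simp add: size_def)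
  qed
qed

text \<open>The recurrence behind the constants of the nested loops: 102 = 2 * 48 + 6, 210 = 2 * 102
  + 6 and, after 4 more steps per deletion, 434 = 2 * 214 + 6.\<close>

lemma for_time:
  assumes "N \<le> 2 * size" "T \<le> c * size ^ k"
  shows "N * (T + 2) + 2 \<le> (2 * c + 6) * size ^ Suc k"
proof -
  have one: "1 \<le> size ^ k" "1 \<le> size" using size_pos by auto
  have "N * (T + 2) \<le> (2 * size) * (c * size ^ k + 2 * size ^ k)"
    using assms one by (intro mult_le_mono add_mono) auto
  also have "\<dots> = (2 * c + 4) * size ^ Suc k" by (simp add: algebra_simps)
  finally have "N * (T + 2) \<le> (2 * c + 4) * size ^ Suc k" .
  moreover have "1 \<le> size ^ Suc k" using size_pos by (metis one_le_power)
  moreover have "(2 * c + 6) * x = (2 * c + 4) * x + 2 * x" for x by (simp add: algebra_simps)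
  ultimately show ?thesis by (metis add_mono mult_le_mono2 mult.right_neutral)
qed

abbreviation fault_vars :: "string set" where
  "fault_vars \<equiv> insert ''f'' (insert ''g'' check_vars)"

abbreviation delete_vars :: "string set" where
  "delete_vars \<equiv> insert ''keep'' fault_vars"

lemma all_less_Suc_conj: "(\<forall>f<Suc j. P f) \<longleftrightarrow> (\<forall>f<j. P f) \<and> P j" for j :: nat
  by (auto simp: less_Suc_eq)

lemma spec_fault_loops:
  assumes input: "is_input \<sigma>" and S: "S = {i. \<sigma> ''keep'' i \<noteq> 0}" and "\<sigma> ''bad'' 0 = 0"
  shows "spec (For ''f'' (Add (scalar ''m'') (Lit 1)) (For ''g'' (Add (scalar ''m'') (Lit 1)) (check_faults undir)))
     (210 * size ^ 4) \<sigma> (\<lambda>\<tau>. agree fault_vars \<sigma> \<tau> \<and>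
       (\<tau> ''bad'' 0 = 0 \<longleftrightarrow> (\<forall>f\<le>m. \<forall>g\<le>m. preserves S f g)))"
proof -
  let ?A = "agree fault_vars \<sigma>"
  have unchanged: "is_input \<tau>" "eval_expr (Add (scalar ''m'') (Lit 1)) \<tau> = Suc m" "\<tau> ''keep'' = \<sigma> ''keep''"
    if "?A \<tau>" for \<tau>
  proof -
    show "is_input \<tau>" using is_input_agree[OF input that] by auto
    then show "eval_expr (Add (scalar ''m'') (Lit 1)) \<tau> = Suc m" unfolding is_input_def by simp
    show "\<tau> ''keep'' = \<sigma> ''keep''" using agreeD[OF that] by auto
  qed
  have m: "Suc m \<le> 2 * size" using size_pos unfolding size_def by simp
  have inner: "spec (For ''g'' (Add (scalar ''m'') (Lit 1)) (check_faults undir)) (102 * size ^ 3) \<tau>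
      (\<lambda>\<tau>'. \<tau>' ''f'' 0 = f \<and> ?A \<tau>' \<and>
        (\<tau>' ''bad'' 0 = 0 \<longleftrightarrow> (\<forall>f'<Suc f. \<forall>g\<le>m. preserves S f' g)))"
    if \<tau>: "\<tau> ''f'' 0 = f" "?A \<tau> \<and> (\<tau> ''bad'' 0 = 0 \<longleftrightarrow> (\<forall>f'<f. \<forall>g\<le>m. preserves S f' g))" for f \<tau>
  proof (rule spec_For[where N = "Suc m" and T = "48 * size ^ 2" and I = "\<lambda>j \<tau>'. \<tau>' ''f'' 0 = f \<and> ?A \<tau>' \<and>
      (\<tau>' ''bad'' 0 = 0 \<longleftrightarrow> (\<forall>f'<f. \<forall>g\<le>m. preserves S f' g) \<and> (\<forall>g<j. preserves S f g))"])
    fix j \<tau>'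
    assume j: "\<tau>' ''g'' 0 = j" and I: "\<tau>' ''f'' 0 = f \<and> ?A \<tau>' \<and>
      (\<tau>' ''bad'' 0 = 0 \<longleftrightarrow> (\<forall>f'<f. \<forall>g\<le>m. preserves S f' g) \<and> (\<forall>g<j. preserves S f g))"
    show "spec (check_faults undir) (48 * size ^ 2) \<tau>' (\<lambda>\<tau>'. \<tau>' ''g'' 0 = j \<and> \<tau>' ''f'' 0 = f \<and> ?A \<tau>' \<and>
      (\<tau>' ''bad'' 0 = 0 \<longleftrightarrow> (\<forall>f'<f. \<forall>g\<le>m. preserves S f' g) \<and> (\<forall>g<Suc j. preserves S f g)))"
    proof (rule spec_weaken[OF spec_check_faults[of \<tau>' S]])
      fix \<rho> assume \<rho>: "agree check_vars \<tau>' \<rho> \<and>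
        (\<rho> ''bad'' 0 = 0 \<longleftrightarrow> \<tau>' ''bad'' 0 = 0 \<and> preserves S (\<tau>' ''f'' 0) (\<tau>' ''g'' 0))"
      have "\<rho> ''f'' = \<tau>' ''f''" "\<rho> ''g'' = \<tau>' ''g''" using agreeD[of check_vars \<tau>' \<rho>] \<rho> by auto
      moreover have "?A \<rho>" using I \<rho> unfolding agree_def by auto
      ultimately show "\<rho> ''g'' 0 = j \<and> \<rho> ''f'' 0 = f \<and> ?A \<rho> \<and>
        (\<rho> ''bad'' 0 = 0 \<longleftrightarrow> (\<forall>f'<f. \<forall>g\<le>m. preserves S f' g) \<and> (\<forall>g<Suc j. preserves S f g))"
        using I \<rho> j by (auto simp: less_Suc_eq)
    qed (use unchanged I S in auto)
  next
    show "Suc m * (48 * size ^ 2 + 2) + 2 \<le> 102 * size ^ 3"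
      using for_time[OF m, of "48 * size ^ 2" 48 2] by simp
  next
    show "eval_expr (Add (scalar ''m'') (Lit 1)) \<tau>' = Suc m" if "\<tau>' ''f'' 0 = f \<and> ?A \<tau>' \<and>
      (\<tau>' ''bad'' 0 = 0 \<longleftrightarrow> (\<forall>f'<f. \<forall>g\<le>m. preserves S f' g) \<and> (\<forall>g<j. preserves S f g))" for j \<tau>'
      using that unchanged(2) by blast
  next
    show "\<tau>' ''f'' 0 = f \<and> ?A \<tau>' \<and>
      (\<tau>' ''bad'' 0 = 0 \<longleftrightarrow> (\<forall>f'<Suc f. \<forall>g\<le>m. preserves S f' g))" if "\<tau>' ''f'' 0 = f \<and> ?A \<tau>' \<and>
      (\<tau>' ''bad'' 0 = 0 \<longleftrightarrow> (\<forall>f'<f. \<forall>g\<le>m. preserves S f' g) \<and> (\<forall>g<Suc m. preserves S f g))" for \<tau>'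
      using that unfolding all_less_Suc_conj[of f] by (simp only: less_Suc_eq_le)
  qed (use \<tau> in \<open>simp_all add: agree_update update_other less_Suc_eq_le all_less_Suc_conj\<close>)
  show ?thesis
  proof (rule spec_For[where N = "Suc m" and T = "102 * size ^ 3" and I = "\<lambda>j \<tau>. ?A \<tau> \<and>
      (\<tau> ''bad'' 0 = 0 \<longleftrightarrow> (\<forall>f<j. \<forall>g\<le>m. preserves S f g))"])
    show "Suc m * (102 * size ^ 3 + 2) + 2 \<le> 210 * size ^ 4"
      using for_time[OF m, of "102 * size ^ 3" 102 3] by simp
  next
    show "eval_expr (Add (scalar ''m'') (Lit 1)) \<tau> = Suc m" if "?A \<tau> \<and>
      (\<tau> ''bad'' 0 = 0 \<longleftrightarrow> (\<forall>f<j. \<forall>g\<le>m. preserves S f g))" for j \<tau>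
      using that unchanged(2) by blast
  next
    show "spec (For ''g'' (Add (scalar ''m'') (Lit 1)) (check_faults undir)) (102 * size ^ 3) \<tau>
      (\<lambda>\<tau>'. \<tau>' ''f'' 0 = j \<and> ?A \<tau>' \<and> (\<tau>' ''bad'' 0 = 0 \<longleftrightarrow> (\<forall>f<Suc j. \<forall>g\<le>m. preserves S f g)))"
      if "\<tau> ''f'' 0 = j" "?A \<tau> \<and> (\<tau> ''bad'' 0 = 0 \<longleftrightarrow> (\<forall>f<j. \<forall>g\<le>m. preserves S f g))" for j \<tau>
      using inner[OF that] .
  qed (use assms(3) in \<open>simp_all add: agree_refl agree_update update_other less_Suc_eq_le\<close>)
qed

lemma spec_try_delete:
  assumes input: "is_input \<sigma>" and keep: "\<And>i. i < m \<Longrightarrow> \<sigma> ''keep'' i \<noteq> 0 \<longleftrightarrow> i \<in> greedy e"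
    and e: "\<sigma> ''e'' 0 = e" "e < m"
  shows "spec (try_delete undir) (214 * size ^ 4) \<sigma> (\<lambda>\<tau>. agree delete_vars \<sigma> \<tau> \<and>
     (\<forall>i<m. \<tau> ''keep'' i \<noteq> 0 \<longleftrightarrow> i \<in> greedy (Suc e)))"
proof -
  let ?A = "agree delete_vars \<sigma>"
  let ?S = "greedy e - {e}"
  let ?R = "\<lambda>\<tau>. ?A \<tau> \<and> (\<forall>i<m. \<tau> ''keep'' i \<noteq> 0 \<longleftrightarrow> i \<in> ?S)"
  let ?ok = "\<forall>f\<le>m. \<forall>g\<le>m. preserves ?S f g"
  have A_e: "\<tau> ''e'' 0 = e" "is_input \<tau>" if "?A \<tau>" for \<tau>
    using agreeD[OF that] is_input_agree[OF input that] e by auto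
  have 1: "spec (Write ''keep'' (scalar ''e'') (Lit 0)) 1 \<sigma> ?R"
    by (rule spec_Write) (use e keep in \<open>auto simp: agree_refl agree_update update_same\<close>)
  have 2: "spec (Write ''bad'' (Lit 0) (Lit 0)) 1 \<tau> (\<lambda>\<tau>. ?R \<tau> \<and> \<tau> ''bad'' 0 = 0)" if "?R \<tau>" for \<tau>
    by (rule spec_Write) (use that in \<open>auto simp: agree_update update_same update_other\<close>)
  have 3: "spec (For ''f'' (Add (scalar ''m'') (Lit 1)) (For ''g'' (Add (scalar ''m'') (Lit 1)) (check_faults undir)))
     (210 * size ^ 4) \<tau> (\<lambda>\<tau>. ?R \<tau> \<and> (\<tau> ''bad'' 0 = 0 \<longleftrightarrow> ?ok))" if \<tau>: "?R \<tau> \<and> \<tau> ''bad'' 0 = 0" for \<tau>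
  proof (rule spec_weaken[OF spec_fault_loops[OF _ refl]])
    have "{i. \<tau> ''keep'' i \<noteq> 0} \<inter> {..<m} = ?S \<inter> {..<m}" using \<tau> by auto
    then have ok: "preserves {i. \<tau> ''keep'' i \<noteq> 0} = preserves ?S" by (intro ext preserves_cong)
    fix \<rho> assume \<rho>: "agree fault_vars \<tau> \<rho> \<and>
       (\<rho> ''bad'' 0 = 0 \<longleftrightarrow> (\<forall>f\<le>m. \<forall>g\<le>m. preserves {i. \<tau> ''keep'' i \<noteq> 0} f g))"
    then have "\<rho> ''keep'' = \<tau> ''keep''" using agreeD[of fault_vars \<tau> \<rho>] by simp
    moreover have "?A \<rho>" using agree_trans[of delete_vars \<sigma> \<tau> fault_vars \<rho>] \<tau> \<rho> by blast
    ultimately show "?R \<rho> \<and> (\<rho> ''bad'' 0 = 0 \<longleftrightarrow> ?ok)" using \<tau> \<rho> unfolding ok by simp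
  qed (use \<tau> A_e in auto)
  have 4: "spec (Cond (scalar ''bad'') (Write ''keep'' (scalar ''e'') (Lit 1)) Skip) (1 + 1) \<tau>
      (\<lambda>\<tau>. ?A \<tau> \<and> (\<forall>i<m. \<tau> ''keep'' i \<noteq> 0 \<longleftrightarrow> i \<in> greedy (Suc e)))"
    if \<tau>: "?R \<tau> \<and> (\<tau> ''bad'' 0 = 0 \<longleftrightarrow> ?ok)" for \<tau>
  proof (rule spec_Cond)
    assume "eval_expr (scalar ''bad'') \<tau> \<noteq> 0"
    then have "\<not> ?ok" using \<tau> by simp
    \<comment> \<open>Resetting \<open>keep\<close> to 1 is right only if e was present before.
      Otherwise the tested set would be \<open>greedy e\<close> itself, which passes every
      test.\<close>
    then have "e \<in> greedy e"
      using greedy_preserves[of _ _ e] by (metis Diff_empty Diff_insert0)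
    then show "spec (Write ''keep'' (scalar ''e'') (Lit 1)) 1 \<tau>
      (\<lambda>\<tau>. ?A \<tau> \<and> (\<forall>i<m. \<tau> ''keep'' i \<noteq> 0 \<longleftrightarrow> i \<in> greedy (Suc e)))"
      using \<tau> A_e \<open>\<not> ?ok\<close> by (intro spec_Write) (auto simp: agree_update update_same)
  next
    assume "eval_expr (scalar ''bad'') \<tau> = 0"
    then have ?ok using \<tau> by simp
    then have "greedy (Suc e) = ?S" by simp
    then show "spec Skip 1 \<tau>
      (\<lambda>\<tau>. ?A \<tau> \<and> (\<forall>i<m. \<tau> ''keep'' i \<noteq> 0 \<longleftrightarrow> i \<in> greedy (Suc e)))"
      using \<tau> by (intro spec_Skip) simp
  qed
  have "spec (try_delete undir) (1 + (1 + (210 * size ^ 4 + (1 + 1)))) \<sigma>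
     (\<lambda>\<tau>. ?A \<tau> \<and> (\<forall>i<m. \<tau> ''keep'' i \<noteq> 0 \<longleftrightarrow> i \<in> greedy (Suc e)))"
    unfolding try_delete_def by (rule spec_Seq[OF 1 spec_Seq[OF 2 spec_Seq[OF 3 4]]])
  then show ?thesis
  proof (rule spec_weaken)
    show "1 + (1 + (210 * size ^ 4 + (1 + 1))) \<le> 214 * size ^ 4" using size_pos by simp
  qed
qed

lemma spec_greedy_prog:
  assumes input: "is_input \<sigma>"
  shows "spec (greedy_prog undir) (446 * size ^ 5) \<sigma> (\<lambda>\<tau>. \<forall>i<m. \<tau> ''keep'' i \<noteq> 0 \<longleftrightarrow> i \<in> greedy m)"
proof -
  let ?V = "insert ''e'' delete_vars"
  have unchanged: "is_input \<tau>" "\<tau> ''m'' 0 = m" if "agree ?V \<sigma> \<tau>" for \<tau>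
  proof -
    show "is_input \<tau>" using is_input_agree[OF input that] by auto
    then show "\<tau> ''m'' 0 = m" unfolding is_input_def by simp
  qed
  have m: "m \<le> 2 * size" unfolding size_def by simp
  have 1: "spec (For ''i'' (scalar ''m'') (Write ''keep'' (scalar ''i'') (Lit 1))) (m * (1 + 2) + 2) \<sigma>
      (\<lambda>\<tau>. agree ?V \<sigma> \<tau> \<and> (\<forall>i<m. \<tau> ''keep'' i \<noteq> 0))"
  proof (rule spec_For[where N = m and T = 1 and I = "\<lambda>j \<tau>. agree ?V \<sigma> \<tau> \<and> (\<forall>i<j. \<tau> ''keep'' i \<noteq> 0)"])
    fix j \<tau> assume "\<tau> ''i'' 0 = j" "agree ?V \<sigma> \<tau> \<and> (\<forall>i<j. \<tau> ''keep'' i \<noteq> 0)"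
    then show "spec (Write ''keep'' (scalar ''i'') (Lit 1)) 1 \<tau>
        (\<lambda>\<tau>'. \<tau>' ''i'' 0 = j \<and> agree ?V \<sigma> \<tau>' \<and> (\<forall>i<Suc j. \<tau>' ''keep'' i \<noteq> 0))"
      by (intro spec_Write) (auto simp: agree_update update_same update_other)
  qed (use unchanged(2) in \<open>auto simp: agree_refl agree_update update_other\<close>)
  have 2: "spec (For ''e'' (scalar ''m'') (try_delete undir)) (434 * size ^ 5) \<tau>
      (\<lambda>\<tau>. \<forall>i<m. \<tau> ''keep'' i \<noteq> 0 \<longleftrightarrow> i \<in> greedy m)"
    if \<tau>: "agree ?V \<sigma> \<tau> \<and> (\<forall>i<m. \<tau> ''keep'' i \<noteq> 0)" for \<tau>
  proof (rule spec_For[where N = m and T = "214 * size ^ 4" and I = "\<lambda>j \<tau>. agree ?V \<sigma> \<tau> \<and>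
       (\<forall>i<m. \<tau> ''keep'' i \<noteq> 0 \<longleftrightarrow> i \<in> greedy j)"])
    fix e \<tau> assume e: "e < m" "\<tau> ''e'' 0 = e" and I: "agree ?V \<sigma> \<tau> \<and>
       (\<forall>i<m. \<tau> ''keep'' i \<noteq> 0 \<longleftrightarrow> i \<in> greedy e)"
    show "spec (try_delete undir) (214 * size ^ 4) \<tau> (\<lambda>\<tau>'. \<tau>' ''e'' 0 = e \<and> agree ?V \<sigma> \<tau>' \<and>
       (\<forall>i<m. \<tau>' ''keep'' i \<noteq> 0 \<longleftrightarrow> i \<in> greedy (Suc e)))"
    proof (rule spec_weaken[OF spec_try_delete[of \<tau> e]])
      fix \<rho> assume \<rho>: "agree delete_vars \<tau> \<rho> \<and> (\<forall>i<m. \<rho> ''keep'' i \<noteq> 0 \<longleftrightarrow> i \<in> greedy (Suc e))"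
      then have "\<rho> ''e'' = \<tau> ''e''" "agree ?V \<sigma> \<rho>" using I unfolding agree_def by auto
      then show "\<rho> ''e'' 0 = e \<and> agree ?V \<sigma> \<rho> \<and>
        (\<forall>i<m. \<rho> ''keep'' i \<noteq> 0 \<longleftrightarrow> i \<in> greedy (Suc e))" using e \<rho> by simp
    qed (use I e unchanged in auto)
  next
    show "m * (214 * size ^ 4 + 2) + 2 \<le> 434 * size ^ 5"
      using for_time[OF m, of "214 * size ^ 4" 214 4] by simp
  qed (use \<tau> unchanged(2) in \<open>auto simp: agree_update update_other\<close>)
  have "spec (greedy_prog undir) ((m * (1 + 2) + 2) + 434 * size ^ 5) \<sigma>
      (\<lambda>\<tau>. \<forall>i<m. \<tau> ''keep'' i \<noteq> 0 \<longleftrightarrow> i \<in> greedy m)"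
    unfolding greedy_prog_def by (rule spec_Seq[OF 1 2])
  then show ?thesis
  proof (rule spec_weaken)
    have "size ^ 1 \<le> size ^ 5" using size_pos by (intro power_increasing) auto
    then show "(m * (1 + 2) + 2) + 434 * size ^ 5 \<le> 446 * size ^ 5"
      using size_pos unfolding power_one_right by (simp add: size_def)
  qed
qed

end

section \<open>Minimal subgraphs\<close>

context labelled_digraph
begin

definition avoiding :: "'e set \<Rightarrow> ('a \<times> 'a) set" where
  "avoiding F = {a \<in> A. lab a \<notin> F}"

lemma walk_snoc:
  assumes "walk F x p y" "(y, z) \<in> avoiding F"
  shows "walk F x (p @ [z]) z"
proof -
  obtain q where q: "p = q @ [y]" using assms(1) unfolding walk_def by (metis append_butlast_last_id)
  have "walk F y [y, z] z" using assms(2) unfolding walk_def avoiding_def by simp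
  then show ?thesis using walk_append[of F x q y "[z]" z] assms(1) q by simp
qed

lemma relpow_walk:
  assumes "(x, y) \<in> avoiding F ^^ k"
  obtains p where "walk F x p y" "length p = Suc k"
proof -
  have "\<exists>p. walk F x p y \<and> length p = Suc k"
    using assms
  proof (induction k arbitrary: y)
    case 0
    then have "walk F x [x] y" unfolding walk_def by simp
    then show ?case by (intro exI[of _ "[x]"]) simp
  next
    case (Suc k)
    then obtain z where "(x, z) \<in> avoiding F ^^ k" "(z, y) \<in> avoiding F" by auto
    then obtain p where "walk F x p z" "length p = Suc k" using Suc.IH by blast
    then show ?case using walk_snoc \<open>(z, y) \<in> avoiding F\<close> by (intro exI[of _ "p @ [y]"]) simp
  qed
  then show thesis using that by blast
qed

lemma walk_relpow:
  assumes "walk F x p y"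
  shows "(x, y) \<in> avoiding F ^^ (length p - 1)"
  using assms
proof (induction p arbitrary: y rule: rev_induct)
  case Nil
  then show ?case unfolding walk_def by simp
next
  case (snoc z p)
  show ?case
  proof (cases p rule: rev_cases)
    case Nil
    then show ?thesis using snoc.prems unfolding walk_def by auto
  next
    case (snoc q u)
    then have w: "walk F x (q @ u # [z]) y" using snoc.prems by simp
    have y: "y = z" using snoc.prems unfolding walk_def by simp
    have "walk F x p u" using walk_prefix[OF w] snoc by simp
    then have "(x, u) \<in> avoiding F ^^ (length p - 1)" by (rule snoc.IH)
    moreover have "(u, z) \<in> avoiding F" using walk_suffix[OF w] unfolding walk_def avoiding_def by auto
    ultimately show ?thesis using y \<open>p = q @ [u]\<close> by auto
  qed
qed

lemma reach_within_walk:
  "reach_within (avoiding F) x y k \<longleftrightarrow> (\<exists>p. walk F x p y \<and> length p \<le> Suc k)"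
proof
  assume "reach_within (avoiding F) x y k"
  then obtain j where "j \<le> k" "(x, y) \<in> avoiding F ^^ j" unfolding reach_within_def by blast
  then show "\<exists>p. walk F x p y \<and> length p \<le> Suc k" using relpow_walk by (metis Suc_le_mono)
next
  assume "\<exists>p. walk F x p y \<and> length p \<le> Suc k"
  then obtain p where p: "walk F x p y" "length p \<le> Suc k" by blast
  then have "length p - 1 \<le> k" by simp
  then show "reach_within (avoiding F) x y k" using walk_relpow[OF p(1)] unfolding reach_within_def by blast
qed

text \<open>A shortest walk repeats no vertex. Therefore comparing distances below n, as the program
  does, settles all distances.\<close>

lemma reach_within_card:
  assumes "reach_within (avoiding F) x y k" "x \<in> V"
  shows "reach_within (avoiding F) x y (card V - 1)"
proof -
  obtain p where "walk F x p y" using assms reach_within_walk by blast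
  then obtain q where q: "shortest F x q y" using shortest_exists by blast
  have "length q = card (set q)" using distinct_card[OF shortest_distinct[OF q]] by simp
  also have "\<dots> \<le> card V" using walk_in_V[OF shortest_walk[OF q] assms(2)] finite_V card_mono by blast
  finally have "length q \<le> Suc (card V - 1)" by simp
  then show ?thesis using q reach_within_walk shortest_walk by blast
qed

text \<open>At a vertex whose distance grows when \<open>e\<close> is deleted, and which is closest to the source
  among these, every shortest path ends with \<open>e\<close>.\<close>

lemma forces_if_needed:
  assumes "reach_within (avoiding F) s v k" "\<not> reach_within (avoiding (insert e F)) s v k"
  obtains w where "w \<noteq> s" "forces s w F e"
proof -
  define bad where "bad k w \<longleftrightarrow> reach_within (avoiding F) s w k \<and> \<not> reach_within (avoiding (insert e F)) s w k"
    for k w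
  have "\<exists>k w. bad k w" using assms unfolding bad_def by blast
  then obtain k w where k: "bad k w" "\<And>j u. j < k \<Longrightarrow> \<not> bad j u"
    using exists_least_iff[of "\<lambda>k. \<exists>w. bad k w"] by blast
  have "w \<noteq> s" using k(1) reach_within_refl unfolding bad_def by metis
  moreover have "forces s w F e"
    unfolding forces_def
  proof (intro conjI allI impI)
    obtain r where r: "walk F s r w" "length r \<le> Suc k" using k(1) reach_within_walk unfolding bad_def by blast
    then show "\<exists>p. walk F s p w" by blast
    fix p assume p: "shortest F s p w"
    then have len: "length p \<le> Suc k" using r shortest_le by (meson le_trans)
    obtain q z where q: "p = q @ [z]" using shortest_walk[OF p] walk_nonempty by (metis rev_exhaust)
    have "z = w" using shortest_walk[OF p] q unfolding walk_def by simp
    have "q \<noteq> []" using shortest_walk[OF p] q \<open>w \<noteq> s\<close> \<open>z = w\<close> unfolding walk_def by auto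
    then obtain q' u where q': "q = q' @ [u]" by (metis rev_exhaust)
    have w: "walk F s (q' @ u # [w]) w" using shortest_walk[OF p] q q' \<open>z = w\<close> by simp
    have "end_lab p = lab (u, w)" using q q' \<open>z = w\<close> unfolding end_lab_def by (simp add: butlast_append)
    moreover have "lab (u, w) = e"
    proof (rule ccontr)
      assume ne: "lab (u, w) \<noteq> e"
      have uw: "(u, w) \<in> avoiding F" using walk_suffix[OF w] unfolding walk_def avoiding_def by simp
      obtain k' where k': "k = Suc k'" using len q q' by (cases k) auto
      have "reach_within (avoiding F) s u k'"
        using walk_prefix[OF w] len q q' k' reach_within_walk by fastforce
      \<comment> \<open>Minimality of k: the predecessor u is reachable in fewer steps, so it is not
        bad.\<close>
      then have "reach_within (avoiding (insert e F)) s u k'" using k(2)[of k' u] k' unfolding bad_def by simp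
      moreover have "(u, w) \<in> avoiding (insert e F)" using uw ne unfolding avoiding_def by simp
      ultimately have "reach_within (avoiding (insert e F)) s w k" using reach_within_step k' by metis
      then show False using k(1) unfolding bad_def by simp
    qed
    ultimately show "end_lab p = e" by simp
  qed
  ultimately show thesis using that by blast
qed

lemma card_needed:
  assumes "finite H" "s \<in> V" "0 < L" "card V \<le> L ^ 3"
    and H: "\<And>e. e \<in> H \<Longrightarrow> \<exists>F v k. finite F \<and> card F \<le> 2 \<and>
      reach_within (avoiding F) s v k \<and> \<not> reach_within (avoiding (insert e F)) s v k"
  shows "card H \<le> card V * (8 * L\<^sup>2)"
proof -
  define I where "I w = {e \<in> H. \<exists>F. finite F \<and> card F \<le> 2 \<and> forces s w F e}" for w
  have "H \<subseteq> (\<Union>w\<in>V - {s}. I w)"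
  proof
    fix e assume e: "e \<in> H"
    then obtain F w where F: "finite F" "card F \<le> 2" "w \<noteq> s" "forces s w F e"
      using H[OF e] forces_if_needed by metis
    then obtain p where p: "walk F s p w" unfolding forces_def by blast
    then have "w \<in> V" using walk_in_V[OF p assms(2)] walk_last walk_nonempty last_in_set by blast
    then show "e \<in> (\<Union>w\<in>V - {s}. I w)" using F e unfolding I_def by blast
  qed
  moreover have "finite (\<Union>w\<in>V - {s}. I w)"
    using finite_V assms(1) unfolding I_def by simp
  ultimately have "card H \<le> card (\<Union>w\<in>V - {s}. I w)" by (rule card_mono[rotated])
  also have "\<dots> \<le> (\<Sum>w\<in>V - {s}. card (I w))" using finite_V by (intro card_UN_le) simp
  also have "\<dots> \<le> card (V - {s}) * (8 * L\<^sup>2)"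
  proof -
    have "card (I w) \<le> 8 * L\<^sup>2" if "w \<in> V - {s}" for w
      by (rule card_forced[of _ s w]) (use that assms(1-4) in \<open>auto simp: I_def\<close>)
    then show ?thesis using sum_bounded_above[of "V - {s}" "\<lambda>w. card (I w)" "8 * L\<^sup>2"] by simp
  qed
  also have "\<dots> \<le> card V * (8 * L\<^sup>2)" using finite_V by (intro mult_le_mono1 card_mono) auto
  finally show ?thesis .
qed

end

section \<open>Renumbering of vertices and hop distances\<close>

lemma relpow_map_prod:
  assumes "inj_on \<nu> V" "B \<subseteq> V \<times> V" "x \<in> V" "y \<in> V"
  shows "(\<nu> x, \<nu> y) \<in> (map_prod \<nu> \<nu> ` B) ^^ k \<longleftrightarrow> (x, y) \<in> B ^^ k"
  using assms(4)
proof (induction k arbitrary: y)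
  case 0
  then show ?case using assms by (auto dest: inj_onD)
next
  case (Suc k)
  have "(\<nu> x, \<nu> y) \<in> (map_prod \<nu> \<nu> ` B) ^^ Suc k \<longleftrightarrow>
      (\<exists>z\<in>V. (\<nu> x, \<nu> z) \<in> (map_prod \<nu> \<nu> ` B) ^^ k \<and> (z, y) \<in> B)"
    using assms(1,2) Suc.prems by (fastforce dest: inj_onD)
  also have "\<dots> \<longleftrightarrow> (\<exists>z\<in>V. (x, z) \<in> B ^^ k \<and> (z, y) \<in> B)" using Suc.IH by blast
  also have "\<dots> \<longleftrightarrow> (x, y) \<in> B ^^ Suc k" using assms(2) by auto
  finally show ?case .
qed

lemma awalk_relpow:
  assumes "A \<subseteq> V \<times> V" "u \<in> V"
  shows "(\<exists>p. pre_digraph.awalk (with_proj \<lparr>pverts = V, parcs = A\<rparr>) u p v \<and> length p = k) \<longleftrightarrow> (u, v) \<in> A ^^ k"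
  using assms(2)
proof (induction k arbitrary: u)
  interpret wf_digraph "with_proj \<lparr>pverts = V, parcs = A\<rparr>"
    using assms(1) by unfold_locales auto
  case 0
  then show ?case by (auto simp: awalk_Nil_iff)
next
  interpret wf_digraph "with_proj \<lparr>pverts = V, parcs = A\<rparr>"
    using assms(1) by unfold_locales auto
  case (Suc k)
  have "(\<exists>p. awalk u p v \<and> length p = Suc k) \<longleftrightarrow> (\<exists>e p. awalk u (e # p) v \<and> length p = k)"
    by (metis length_Suc_conv)
  also have "\<dots> \<longleftrightarrow> (\<exists>w. (u, w) \<in> A \<and> (\<exists>p. awalk w p v \<and> length p = k))"
    using Suc.prems by (auto simp: awalk_Cons_iff)
  also have "\<dots> \<longleftrightarrow> (\<exists>w. (u, w) \<in> A \<and> (w, v) \<in> A ^^ k)"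
    using Suc.IH assms(1) by blast
  also have "\<dots> \<longleftrightarrow> (u, v) \<in> A ^^ Suc k" by (metis relpow_Suc_D2 relpow_Suc_I2)
  finally show ?case .
qed

lemma hop_dist_INF:
  assumes "A \<subseteq> V \<times> V" "u \<in> V"
  shows "hop_dist V A u v = (INF k\<in>{k. (u, v) \<in> A ^^ k}. ereal (real k))"
proof -
  interpret wf_digraph "with_proj \<lparr>pverts = V, parcs = A\<rparr>"
    using assms(1) by unfold_locales auto
  have "awalk_cost (\<lambda>_. 1) p = real (length p)" for p :: "('a \<times> 'a) list"
    by (induction p) auto
  then have "hop_dist V A u v = (INF p\<in>{p. awalk u p v}. ereal (real (length p)))"
    unfolding hop_dist_def \<mu>_def by simp
  also have "\<dots> = (INF k\<in>length ` {p. awalk u p v}. ereal (real k))" by (simp add: image_image)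
  also have "length ` {p. awalk u p v} = {k. (u, v) \<in> A ^^ k}"
    using awalk_relpow[OF assms, of v] by (auto simp: image_iff) metis+
  finally show ?thesis .
qed

text \<open>Every walk in one graph is matched by a walk in the other that is no longer, so the
  infima agree, also when there is no walk.\<close>

lemma hop_dist_eqI:
  assumes "A \<subseteq> V \<times> V" "B \<subseteq> V \<times> V" "u \<in> V"
    and "\<And>k. reach_within A u v k \<longleftrightarrow> reach_within B u v k"
  shows "hop_dist V A u v = hop_dist V B u v"
proof -
  have le: "(INF k\<in>{k. (u, v) \<in> B ^^ k}. ereal (real k)) \<le> (INF k\<in>{k. (u, v) \<in> A ^^ k}. ereal (real k))"
    if "\<And>k. reach_within A u v k \<Longrightarrow> reach_within B u v k" for A B
  proof (rule INF_mono)
    fix k assume "k \<in> {k. (u, v) \<in> A ^^ k}"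
    then have "reach_within B u v k" using that unfolding reach_within_def by blast
    then show "\<exists>j\<in>{k. (u, v) \<in> B ^^ k}. ereal (real j) \<le> ereal (real k)"
      unfolding reach_within_def by auto
  qed
  show ?thesis using le[of A B] le[of B A] assms unfolding hop_dist_INF[OF assms(1,3)] hop_dist_INF[OF assms(2,3)]
    by (intro antisym) auto
qed

text \<open>L is the cube root of n, rounded up. For positive n the rounding at most doubles it, and
  32 = 8 * 2^2.\<close>

lemma exists_cube_bound:
  assumes "0 < (n::nat)"
  obtains L :: nat where "0 < L" "n \<le> L ^ 3" "real n * (8 * real L ^ 2) \<le> 32 * real n powr (5/3)"
proof -
  define x where "x = real n powr (1/3)"
  define L where "L = nat \<lceil>x\<rceil>"
  have x: "1 \<le> x" unfolding x_def using assms by (intro ge_one_powr_ge_zero) auto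
  have L: "x \<le> real L" "real L \<le> 2 * x" unfolding L_def using x by linarith+
  have "x ^ 3 = real n" unfolding x_def using assms by (simp add: powr_realpow[symmetric] powr_powr)
  then have "real n \<le> real L ^ 3" using L(1) x power_mono[of x "real L" 3] by simp
  then have "n \<le> L ^ 3" by (metis of_nat_le_iff of_nat_power)
  moreover have "0 < L" using L x by (cases L) auto
  moreover have "real n * (8 * real L ^ 2) \<le> 32 * real n powr (5/3)"
  proof -
    have "real L ^ 2 \<le> (2 * x) ^ 2" using L(2) by (intro power_mono) auto
    moreover have "x ^ 2 = real n powr (2/3)"
      unfolding x_def using assms by (simp add: powr_realpow[symmetric] powr_powr)
    ultimately have "real n * (8 * real L ^ 2) \<le> real n * (32 * real n powr (2/3))"
      by (intro mult_left_mono) (auto simp: power_mult_distrib)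
    also have "\<dots> = 32 * (real n powr 1 * real n powr (2/3))" using assms by simp
    also have "\<dots> = 32 * real n powr (5/3)" unfolding powr_add[symmetric] by simp
    finally show ?thesis .
  qed
  ultimately show thesis using that by blast
qed


text \<open>Covers directed and undirected graphs at once. The third assumption states which arcs
  share a label, and thereby matches the labels with the arcs that \<open>relax_edge undir\<close>
  relaxes.\<close>

lemma dual_FT_BFS_greedy:
  fixes lab :: "'a \<times> 'a \<Rightarrow> 'e" and arcs_of :: "'e set \<Rightarrow> ('a \<times> 'a) set"
  assumes arcs_of: "\<And>S. arcs_of S = {a. lab a \<in> S}"
    and lab_eqD: "\<And>x y x' y'. lab (x, y) = lab (x', y') \<Longrightarrow> {x, y} = {x', y'}"
    and undir: "\<And>u v. {a. lab a = lab (u, v)} = {(u, v)} \<union> (if undir then {(v, u)} else {})"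
    and V: "finite V" "arcs_of E \<subseteq> V \<times> V" "s \<in> V"
    and \<nu>: "bij_betw \<nu> V {..<card V}"
    and es: "distinct (map lab es)" "set (map lab es) = E"
  shows "\<exists>E' t \<sigma>. dual_FT_BFS arcs_of V E s E' \<and>
     real (card E') \<le> 32 * real (card V) powr (5/3) \<and>
     runs (greedy_prog undir) (graph_input \<nu> (card V) s es) t \<sigma> \<and>
     t \<le> 446 * (card V + card E) ^ 5 \<and> kept_edges \<sigma> (map lab es) = E'"
proof -
  define n where "n = card V"
  define m where "m = length es"
  define src where "src i = \<nu> (fst (es ! i))" for i
  define dst where "dst i = \<nu> (snd (es ! i))" for i
  define edge where "edge i = lab (es ! i)" for i
  have "set es = (\<lambda>i. es ! i) ` {..<m}" unfolding m_def by (auto simp: set_conv_nth)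
  then have E_edge: "E = edge ` {..<m}" using es(2) unfolding edge_def by (simp add: image_image)
  have inj: "inj_on edge {..<m}"
    using es(1) unfolding edge_def m_def inj_on_def by (auto simp: distinct_conv_nth)
  have cardE: "card E = m" using E_edge inj card_image by fastforce
  have "finite E" using E_edge by simp
  have inj\<nu>: "inj_on \<nu> V" and range\<nu>: "\<nu> ` V = {..<n}" using \<nu> unfolding bij_betw_def n_def by auto
  have es_V: "es ! i \<in> V \<times> V" if "i < m" for i
    using that V(2) E_edge unfolding arcs_of edge_def by auto
  interpret input_graph n m "\<nu> s" src dst undir
  proof
    show "\<nu> s < n" using range\<nu> V(3) by auto
    fix i assume "i < m"
    then have "fst (es ! i) \<in> V" "snd (es ! i) \<in> V" using es_V by (auto simp: mem_Times_iff)
    then show "src i < n \<and> dst i < n" using range\<nu> unfolding src_def dst_def by auto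
  qed
  define H where "H = edge ` greedy m"
  define dists where "dists S = (\<lambda>v k. reach_within (arcs_of S) s v k)" for S
  have "H \<subseteq> E" using greedy_subset unfolding H_def E_edge by blast
  have arcs_V: "arcs_of S \<subseteq> V \<times> V" if "S \<subseteq> E" for S using that V(2) unfolding arcs_of by auto
  have arcs_in_eq: "arcs_in X = map_prod \<nu> \<nu> ` arcs_of (edge ` X)" if "X \<subseteq> {..<m}" for X
  proof -
    have "arcs_at i = map_prod \<nu> \<nu> ` {a. lab a = edge i}" for i
    proof -
      obtain u v where "es ! i = (u, v)" by (cases "es ! i")
      then show ?thesis using undir[of u v] unfolding arcs_at_def src_def dst_def edge_def by simp
    qed
    then have "arcs_in X = (\<Union>i\<in>X. map_prod \<nu> \<nu> ` {a. lab a = edge i})" unfolding arcs_in_def by simp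
    also have "\<dots> = map_prod \<nu> \<nu> ` (\<Union>i\<in>X. {a. lab a = edge i})" by blast
    also have "(\<Union>i\<in>X. {a. lab a = edge i}) = arcs_of (edge ` X)" unfolding arcs_of by auto
    finally show ?thesis .
  qed
  have transfer: "reach_within (arcs_in X) (\<nu> s) (\<nu> v) k \<longleftrightarrow> dists (edge ` X) v k"
    if "X \<subseteq> {..<m}" "v \<in> V" for X v k
    using relpow_map_prod[OF inj\<nu> arcs_V V(3) that(2), of "edge ` X"] that(1)
    unfolding dists_def reach_within_def arcs_in_eq[OF that(1)] E_edge by (metis image_mono)
  \<comment> \<open>Intersecting with the indices below m drops the index that stands for no
    edge.\<close>
  have active_edge: "edge ` active S f g = edge ` (S \<inter> {..<m}) - edge ` ({f, g} \<inter> {..<m})" for S f g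
    using inj unfolding active_def by (auto dest: inj_onD)
  have all_vertices: "(\<forall>v<n. P v) \<longleftrightarrow> (\<forall>v\<in>V. P (\<nu> v))" for P
    unfolding lessThan_iff[symmetric] range\<nu>[symmetric] by blast
  have active_less: "active S f g \<subseteq> {..<m}" for S f g unfolding active_def by auto
  have preserves_iff: "preserves S f g \<longleftrightarrow>
      (\<forall>v\<in>V. \<forall>k<n. dists (E - edge ` ({f, g} \<inter> {..<m})) v k \<longleftrightarrow> dists (edge ` S - edge ` ({f, g} \<inter> {..<m})) v k)"
    if "S \<subseteq> {..<m}" for S f g
  proof -
    have "preserves S f g \<longleftrightarrow> (\<forall>v\<in>V. \<forall>k<n. reach_within (arcs_in (active UNIV f g)) (\<nu> s) (\<nu> v) k
        \<longleftrightarrow> reach_within (arcs_in (active S f g)) (\<nu> s) (\<nu> v) k)"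
      unfolding preserves_def by (rule all_vertices)
    also have "\<dots> \<longleftrightarrow> (\<forall>v\<in>V. \<forall>k<n. dists (edge ` active UNIV f g) v k \<longleftrightarrow> dists (edge ` active S f g) v k)"
      by (simp add: transfer[OF active_less])
    finally show ?thesis
      unfolding active_edge using that E_edge by (simp add: Int_absorb2)
  qed
  have faults: "\<exists>f\<le>m. \<exists>g\<le>m. F = edge ` ({f, g} \<inter> {..<m})" if F: "F \<subseteq> E" "finite F" "card F \<le> 2" for F
  proof -
    have idx: "\<exists>i<m. edge i = e" if "e \<in> E" for e using that E_edge by auto
    consider "card F = 0" | "card F = 1" | "card F = 2" using F(3) by linarith
    then show ?thesis
    proof cases
      case 1
      then have "F = edge ` ({m, m} \<inter> {..<m})" using F(2) by simp
      then show ?thesis by blast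
    next
      case 2
      then obtain a where a: "F = {a}" using card_1_singletonE by blast
      moreover obtain i where "i < m" "edge i = a" using idx[of a] F(1) a by auto
      ultimately have "i \<le> m" "F = edge ` ({i, i} \<inter> {..<m})" by auto
      then show ?thesis by blast
    next
      case 3
      then obtain a b where ab: "F = {a, b}" using card_2_iff by metis
      obtain i where "i < m" "edge i = a" using idx[of a] F(1) ab by auto
      moreover obtain j where "j < m" "edge j = b" using idx[of b] F(1) ab by auto
      moreover note ab
      ultimately have "i \<le> m" "j \<le> m" "F = edge ` ({i, j} \<inter> {..<m})" by auto
      then show ?thesis by blast
    qed
  qed
  \<comment> \<open>\<open>preserves\<close> speaks only of k < n, whereas equality of hop distances
    needs every k.\<close>
  have all_lengths: "dists S v k \<longleftrightarrow> dists S v (min k (n - 1))" if "S \<subseteq> E" for S v k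
  proof (cases "k \<le> n - 1")
    case False
    interpret labelled_digraph V "arcs_of S" lab
      using V(1) arcs_V[OF that] lab_eqD by unfold_locales
    have av: "avoiding {} = arcs_of S" unfolding avoiding_def by simp
    show ?thesis
      using reach_within_card[of "{}" s v k] reach_within_mono[of "arcs_of S" s v "n - 1" k] False V(3)
      unfolding dists_def av n_def by (auto simp: min_def)
  qed (simp add: min_def)
  have "0 < n" using V(1,3) unfolding n_def by (auto simp: card_gt_0_iff)
  have dual: "dual_FT_BFS arcs_of V E s H"
    unfolding dual_FT_BFS_def
  proof (intro conjI allI impI ballI)
    fix F v assume F: "F \<subseteq> E" "finite F \<and> card F \<le> 2" and v: "v \<in> V"
    then obtain f g where fg: "f \<le> m" "g \<le> m" "F = edge ` ({f, g} \<inter> {..<m})" using faults by metis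
    then have eq: "dists (E - F) v k \<longleftrightarrow> dists (H - F) v k" if "k < n" for k
      using greedy_preserves[of f g m] preserves_iff[OF greedy_subset, of m f g] v that
      unfolding H_def by simp
    have "dists (H - F) v k \<longleftrightarrow> dists (E - F) v k" for k
      using eq[of "min k (n - 1)"] all_lengths[of "H - F" v k] all_lengths[of "E - F" v k] \<open>H \<subseteq> E\<close> \<open>0 < n\<close>
      by auto
    then show "hop_dist V (arcs_of (H - F)) s v = hop_dist V (arcs_of (E - F)) s v"
      using \<open>H \<subseteq> E\<close> V(3) unfolding dists_def by (intro hop_dist_eqI arcs_V) auto
  qed (rule \<open>H \<subseteq> E\<close>)
  \<comment> \<open>The counting takes place in H and not in the whole graph: its forced edges are
    those that H cannot spare.\<close>
  interpret HG: labelled_digraph V "arcs_of H" lab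
    using V(1) arcs_V[OF \<open>H \<subseteq> E\<close>] lab_eqD by unfold_locales
  have avoiding: "HG.avoiding F = arcs_of (H - F)" for F
    unfolding HG.avoiding_def unfolding arcs_of by auto
  have needed: "\<exists>F v k. finite F \<and> card F \<le> 2 \<and> reach_within (HG.avoiding F) s v k \<and>
      \<not> reach_within (HG.avoiding (insert e F)) s v k" if "e \<in> H" for e
  proof -
    obtain i where i: "i \<in> greedy m" "e = edge i" using \<open>e \<in> H\<close> unfolding H_def by blast
    then obtain f g where fg: "f \<le> m" "g \<le> m" "\<not> preserves (greedy m - {i}) f g"
      using greedy_minimal by blast
    define F where "F = edge ` ({f, g} \<inter> {..<m})"
    have F: "finite F" "card F \<le> 2"
    proof -
      show "finite F" unfolding F_def by simp
      have "card F \<le> card ({f, g} \<inter> {..<m})" unfolding F_def by (intro card_image_le) simp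
      also have "\<dots> \<le> card {f, g}" by (intro card_mono) auto
      also have "\<dots> \<le> 2" by (simp add: card_insert_if)
      finally show "card F \<le> 2" .
    qed
    have "edge ` (greedy m - {i}) = H - {e}"
      using i inj_on_image_set_diff[OF inj, of "greedy m" "{i}"] greedy_subset[of m] unfolding H_def by auto
    then obtain v k where vk: "v \<in> V" "k < n" "dists (E - F) v k \<noteq> dists (H - {e} - F) v k"
      using fg(3) preserves_iff[of "greedy m - {i}" f g] greedy_subset[of m] unfolding F_def by fastforce
    \<comment> \<open>Under the faults F, H agrees with the whole graph but H without e does not; so
      the difference is due to e, and it can only be a loss of reachability.\<close>
    have "dists (E - F) v k \<longleftrightarrow> dists (H - F) v k"
      using greedy_preserves[OF fg(1,2), of m] preserves_iff[OF greedy_subset, of m f g] vk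
      unfolding F_def H_def by simp
    moreover have "dists (H - {e} - F) v k \<Longrightarrow> dists (H - F) v k"
      unfolding dists_def arcs_of by (erule reach_within_subset) auto
    ultimately have "dists (H - F) v k \<and> \<not> dists (H - {e} - F) v k" using vk by blast
    moreover have "H - {e} - F = H - insert e F" by blast
    ultimately show ?thesis using F unfolding avoiding dists_def by metis
  qed
  obtain L where L: "0 < L" "n \<le> L ^ 3" "real n * (8 * real L ^ 2) \<le> 32 * real n powr (5/3)"
    using exists_cube_bound[OF \<open>0 < n\<close>] .
  have "card H \<le> n * (8 * L\<^sup>2)"
    using HG.card_needed[OF _ V(3) L(1) _ needed] L(2) \<open>finite E\<close> \<open>H \<subseteq> E\<close> finite_subset
    unfolding n_def by blast
  then have "real (card H) \<le> real (n * (8 * L\<^sup>2))" by (rule of_nat_mono)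
  then have card_H: "real (card H) \<le> 32 * real n powr (5/3)" using L(3) by simp
  have "is_input (graph_input \<nu> n s es)"
    unfolding is_input_def by (simp add: graph_input_def m_def src_def dst_def)
  then obtain t \<sigma> where run: "runs (greedy_prog undir) (graph_input \<nu> n s es) t \<sigma>"
      "t \<le> 446 * size ^ 5" "\<And>i. i < m \<Longrightarrow> \<sigma> ''keep'' i \<noteq> 0 \<longleftrightarrow> i \<in> greedy m"
    using spec_greedy_prog unfolding spec_def by blast
  have "kept_edges \<sigma> (map lab es) = H"
  proof -
    have "kept_edges \<sigma> (map lab es) = {edge i |i. i < m \<and> \<sigma> ''keep'' i \<noteq> 0}"
      unfolding kept_edges_def edge_def m_def by (metis (no_types, lifting) length_map nth_map)
    also have "\<dots> = H" using run(3) greedy_subset[of m] unfolding H_def by auto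
    finally show ?thesis .
  qed
  moreover have "size = card V + card E" using cardE unfolding size_def by (simp add: n_def)
  then have "t \<le> 446 * (card V + card E) ^ 5" using run(2) by simp
  ultimately show ?thesis using dual card_H run(1) unfolding n_def by blast
qed

theorem theorem1:
  shows "(\<exists>P (C::real) (c::nat) (k::nat).
           \<forall>(V::'a set) (E::('a \<times> 'a) set) s \<nu> es.
             finite V \<and> E \<subseteq> V \<times> V \<and> s \<in> V \<and>
             bij_betw \<nu> V {..<card V} \<and> distinct es \<and> set es = E \<longrightarrow>
             (\<exists>E' t \<sigma>. dual_FT_BFS (\<lambda>D. D) V E s E' \<and>
                real (card E') \<le> C * real (card V) powr (5/3) \<and>
                runs P (graph_input \<nu> (card V) s es) t \<sigma> \<and>
                t \<le> c * (card V + card E) ^ k \<and>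
                kept_edges \<sigma> es = E'))
       \<and> (\<exists>P (C::real) (c::nat) (k::nat).
           \<forall>(V::'a set) (E::'a set set) s \<nu> es.
             finite V \<and> E \<subseteq> {{u, v} | u v. u \<in> V \<and> v \<in> V} \<and> s \<in> V \<and>
             bij_betw \<nu> V {..<card V} \<and>
             distinct (map undirected_edge es) \<and> set (map undirected_edge es) = E \<longrightarrow>
             (\<exists>E' t \<sigma>. dual_FT_BFS bidirected V E s E' \<and>
                real (card E') \<le> C * real (card V) powr (5/3) \<and>
                runs P (graph_input \<nu> (card V) s es) t \<sigma> \<and>
                t \<le> c * (card V + card E) ^ k \<and>
                kept_edges \<sigma> (map undirected_edge es) = E'))"
proof (intro conjI)
  show "\<exists>P (C::real) (c::nat) (k::nat).
           \<forall>(V::'a set) (E::('a \<times> 'a) set) s \<nu> es.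
             finite V \<and> E \<subseteq> V \<times> V \<and> s \<in> V \<and>
             bij_betw \<nu> V {..<card V} \<and> distinct es \<and> set es = E \<longrightarrow>
             (\<exists>E' t \<sigma>. dual_FT_BFS (\<lambda>D. D) V E s E' \<and>
                real (card E') \<le> C * real (card V) powr (5/3) \<and>
                runs P (graph_input \<nu> (card V) s es) t \<sigma> \<and>
                t \<le> c * (card V + card E) ^ k \<and>
                kept_edges \<sigma> es = E')"
  proof (rule exI[of _ "greedy_prog False"], rule exI[of _ 32], rule exI[of _ 446], rule exI[of _ 5],
      intro allI impI, elim conjE)
    fix V :: "'a set" and E s \<nu> es
    assume "finite V" "E \<subseteq> V \<times> V" "s \<in> V" "bij_betw \<nu> V {..<card V}" "distinct es" "set es = E"
    then show "\<exists>E' t \<sigma>. dual_FT_BFS (\<lambda>D. D) V E s E' \<and>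
                real (card E') \<le> 32 * real (card V) powr (5/3) \<and>
                runs (greedy_prog False) (graph_input \<nu> (card V) s es) t \<sigma> \<and>
                t \<le> 446 * (card V + card E) ^ 5 \<and>
                kept_edges \<sigma> es = E'"
      using dual_FT_BFS_greedy[of "\<lambda>D. D" "\<lambda>a. a" False V E s \<nu> es] by simp
  qed
  show "\<exists>P (C::real) (c::nat) (k::nat).
           \<forall>(V::'a set) (E::'a set set) s \<nu> es.
             finite V \<and> E \<subseteq> {{u, v} | u v. u \<in> V \<and> v \<in> V} \<and> s \<in> V \<and>
             bij_betw \<nu> V {..<card V} \<and>
             distinct (map undirected_edge es) \<and> set (map undirected_edge es) = E \<longrightarrow>
             (\<exists>E' t \<sigma>. dual_FT_BFS bidirected V E s E' \<and>
                real (card E') \<le> C * real (card V) powr (5/3) \<and>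
                runs P (graph_input \<nu> (card V) s es) t \<sigma> \<and>
                t \<le> c * (card V + card E) ^ k \<and>
                kept_edges \<sigma> (map undirected_edge es) = E')"
  proof (rule exI[of _ "greedy_prog True"], rule exI[of _ 32], rule exI[of _ 446], rule exI[of _ 5],
      intro allI impI, elim conjE)
    fix V :: "'a set" and E s \<nu> es
    assume *: "finite V" "E \<subseteq> {{u, v} | u v. u \<in> V \<and> v \<in> V}" "s \<in> V" "bij_betw \<nu> V {..<card V}"
      "distinct (map undirected_edge es)" "set (map undirected_edge es) = E"
    show "\<exists>E' t \<sigma>. dual_FT_BFS bidirected V E s E' \<and>
                real (card E') \<le> 32 * real (card V) powr (5/3) \<and>
                runs (greedy_prog True) (graph_input \<nu> (card V) s es) t \<sigma> \<and>
                t \<le> 446 * (card V + card E) ^ 5 \<and>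
                kept_edges \<sigma> (map undirected_edge es) = E'"
    proof (rule dual_FT_BFS_greedy)
      show "bidirected S = {a. undirected_edge a \<in> S}" for S :: "'a set set"
        unfolding bidirected_def undirected_edge_def by auto
      show "{x, y} = {x', y'}" if "undirected_edge (x, y) = undirected_edge (x', y')" for x y x' y' :: 'a
        using that unfolding undirected_edge_def by simp
      show "{a. undirected_edge a = undirected_edge (u, v)} = {(u, v)} \<union> (if True then {(v, u)} else {})"
        for u v :: 'a
      proof -
        have "undirected_edge (a, b) = undirected_edge (u, v) \<longleftrightarrow> (a, b) = (u, v) \<or> (a, b) = (v, u)"
          for a b :: 'a
          unfolding undirected_edge_def by (simp add: doubleton_eq_iff)
        then show ?thesis by auto
      qed
      show "bidirected E \<subseteq> V \<times> V"
      proof (rule subrelI)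
        fix a b assume "(a, b) \<in> bidirected E"
        then obtain u v where "{a, b} = {u, v}" "u \<in> V" "v \<in> V"
          using *(2) unfolding bidirected_def by blast
        then show "(a, b) \<in> V \<times> V" by (auto simp: doubleton_eq_iff)
      qed
    qed (use * in auto)
  qed
qed

end
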